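(* Let $A$ be a Hopf algebra over a commutative field $\mathbb{K}$ with invertible antipode, $H$ a sub-Hopf algebra of $A$ stable for the adjoint action (that is, $\mathrm{ad}_a(h)\in H$ for all $a\in A$, $h\in H$), and $M$ an $A$-bimodule. Let $\sigma$ be the Woronowicz braiding of $A$. Then the map $\Lambda\circ{}^t\varphi_\sigma$ induces (by restricting the inner arguments to $H$) a morphism of complexes from the normalized Hochschild complex $\mathrm{Hom}_N(T(A),M)$ of $A$ with coefficients in $M$ to $(\mathrm{Hom}_N(T(A),\mathrm{Hom}_N(T(H),M)),\rho)$.
   Context: Sweedler notation $\Delta(a)=\sum a_{(1)}\otimes a_{(2)}$; $\mathrm{ad}_a(b)=\sum \mathrm S(a_{(1)})\,b\,a_{(2)}$. Woronowicz braiding: $\sigma(a\otimes b)=\sum b_{(1)}\otimes\mathrm{ad}_{b_{(2)}}a$, with inverse $\sigma^{-1}(a\otimes b)=\sum a_{(3)}b\,\mathrm S^{-1}(a_{(2)})\otimes a_{(1)}$. $T(A)=\bigoplus_{k\ge0}A^{\otimes k}$; $\sigma_i=\mathrm{Id}^{\otimes i-1}\otimes\sigma\otimes\mathrm{Id}^{\otimes n-i-1}$. Quantum shuffle product (with sign): for $p+q=n$, $S_{p,n}$ is the set of permutations $w$ of $\{1,\dots,n\}$ with $w(1)<\dots<w(p)$, $w(p+1)<\dots<w(n)$; for a reduced decomposition $w=\nu_{i_1}\cdots\nu_{i_r}$, $\nu_i=(i,i+1)$, $T_\sigma(w)=\sigma_{i_1}\cdots\sigma_{i_r}$; $\varphi_\sigma(\underline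 a\otimes\underline b)=\sum_{w\in S_{p,n}}(-1)^{|w|}T_\sigma(w)(\underline a\otimes\underline b)$ for $\underline a\in A^{\otimes p},\underline b\in A^{\otimes q}$ (scalar multiplication if $p=0$ or $q=0$). Normalized maps: $\mathrm{Hom}_N(A^{\otimes p},M)$ is the space of linear maps $A^{\otimes p}\to M$ vanishing on $a^1\otimes\cdots\otimes a^p$ whenever some $a^i=1_A$ (similarly with other coefficients or $H$ in place of $A$). $\mathrm{Hom}_N(T(A),M)$ has degree $n$ part $\mathrm{Hom}_N(A^{\otimes n},M)$, with Hochschild differential $\delta(f)(a^1\otimes\cdots\otimes a^{n+1})=a^1f(a^2\otimes\cdots)+\sum_{i=1}^n(-1)^if(\cdots\otimes a^ia^{i+1}\otimes\cdots)+(-1)^{n+1}f(a^1\otimes\cdots\otimes a^n)a^{n+1}$. $\mathrm{Hom}_N(T(A),\mathrm{Hom}_N(T(H),M))$ has degree $n$ part $\bigoplus_{p+q=n}\mathrm{Hom}_N(A^{\otimes p},\mathrm{Hom}_N(H^{\otimes q},M))$. The differential $\rho$ sends $f\in\mathrm{Hom}_N(A^{\otimes p},\mathrm{Hom}_N(H^{\otimes q},M))$ to the pair of the following components. (i) For $a^1\otimes\cdots\otimes a^{p+1}\in A^{\otimes p+1}$, $\underline b\in H^{\otimes q}$: $$\begin{aligned}\rho(f)(a^1\otimes\cdots\otimes a^{p+1})(\underline b)=\;&(-1)^q\sum_j a^1_j.f(a^2\otimes\cdots\otimes a^{p+1})(\underline b_j)+\sum_{i=1}^p(-1)^{i+q}f(a^1\otimes\cdots\otimes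 a^ia^{i+1}\otimes\cdots\otimes a^{p+1})(\underline b)\\&+(-1)^{p+q+1}f(a^1\otimes\cdots\otimes a^p)(\underline b).a^{p+1},\end{aligned}$$ where $\sum_j a^1_j\otimes\underline b_j=\sigma_1\cdots\sigma_q(\underline b\otimes a^1)$, $\underline b_j\in H^{\otimes q}$. (ii) For $\underline a\in A^{\otimes p}$, $b^1\otimes\cdots\otimes b^{q+1}\in H^{\otimes q+1}$: $$\begin{aligned}\rho(f)(\underline a)(b^1\otimes\cdots\otimes b^{q+1})=\;&b^1.f(\underline a)(b^2\otimes\cdots\otimes b^{q+1})+\sum_{i=1}^q(-1)^if(\underline a)(b^1\otimes\cdots\otimes b^ib^{i+1}\otimes\cdots\otimes b^{q+1})\\&+(-1)^{q+1}\sum_i f(\underline a_i)(b^1\otimes\cdots\otimes b^q).b^{q+1}_i,\end{aligned}$$ where $\sum_i\underline a_i\otimes b^{q+1}_i=\sigma_p\cdots\sigma_1(b^{q+1}\otimes\underline a)$, $\underline a_i\in A^{\otimes p}$. The induced map sends $f\in\mathrm{Hom}_N(A^{\otimes n},M)$ to the family, over $p+q=n$, of the maps $A^{\otimes p}\ni\underline a\mapsto\big(H^{\otimes q}\ni\underline b\mapsto f(\varphi_\sigma(\underline b\otimes\underline a))\big)$. *)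

theory Defs
  imports Complex_Main "HOL-Library.Function_Algebras" "HOL-Combinatorics.Permutations"
begin

section \<open>Linear maps on subspaces\<close>

text \<open>Function spaces carry the pointwise addition of \<^theory>\<open>HOL-Library.Function_Algebras\<close>
  and the pointwise scalar multiplication \<open>fscale\<close>.\<close>

definition fscale :: "('k \<Rightarrow> 'v \<Rightarrow> 'v) \<Rightarrow> 'k \<Rightarrow> ('x \<Rightarrow> 'v) \<Rightarrow> 'x \<Rightarrow> 'v"
  where "fscale sV c f = (\<lambda>x. sV c (f x))"

definition linear_on ::
    "('k \<Rightarrow> 'u::plus \<Rightarrow> 'u) \<Rightarrow> ('k \<Rightarrow> 'v::plus \<Rightarrow> 'v) \<Rightarrow> 'u set \<Rightarrow> ('u \<Rightarrow> 'v) \<Rightarrow> bool"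
  where "linear_on sU sV U f \<longleftrightarrow>
    (\<forall>x\<in>U. \<forall>y\<in>U. f (x + y) = f x + f y) \<and> (\<forall>c. \<forall>x\<in>U. f (sU c x) = sV c (f x))"

text \<open>\<open>multilinear_on s sV [C\<^sub>1, \<dots>, C\<^sub>n] g\<close>: the map \<open>g\<close>, with its \<open>n\<close> arguments collected in a
  list, is multilinear on \<open>C\<^sub>1 \<times> \<dots> \<times> C\<^sub>n\<close>.\<close>

definition multilinear_on ::
    "('k \<Rightarrow> 'a::plus \<Rightarrow> 'a) \<Rightarrow> ('k \<Rightarrow> 'v::plus \<Rightarrow> 'v) \<Rightarrow> 'a set list \<Rightarrow> ('a list \<Rightarrow> 'v) \<Rightarrow> bool"
  where "multilinear_on s sV Cs g \<longleftrightarrow>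
    (\<forall>w\<in>listset Cs. \<forall>i<length Cs. linear_on s sV (Cs ! i) (\<lambda>x. g (w[i := x])))"


section \<open>Tensor powers\<close>

text \<open>Over a field, \<open>a\<^sub>1 \<otimes> \<dots> \<otimes> a\<^sub>n\<close> may be taken to be evaluation at \<open>(a\<^sub>1, \<dots>, a\<^sub>n)\<close> on the
  multilinear forms, and \<open>C\<^sub>1 \<otimes> \<dots> \<otimes> C\<^sub>n\<close> to be the span of the pure tensors with
  \<open>a\<^sub>i \<in> C\<^sub>i\<close>. Forms are considered on words of all lengths at once, so that all tensor powers
  sit in a single type (and \<open>C\<^sub>1 \<otimes> \<dots> \<otimes> C\<^sub>n\<close>, for subspaces \<open>C\<^sub>i\<close> of \<open>A\<close>, sits inside the
  \<open>n\<close>-th tensor power of \<open>A\<close>). That this is the tensor product is the universal property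
  proved below as \<open>tlift_tpure\<close>, \<open>linear_on_tlift\<close> and \<open>tlift_unique\<close>.\<close>

type_synonym ('k, 'a) tensor = "('a list \<Rightarrow> 'k) \<Rightarrow> 'k"

abbreviation tscale :: "'k::times \<Rightarrow> ('k, 'a) tensor \<Rightarrow> ('k, 'a) tensor"
  where "tscale \<equiv> fscale (*)"

definition multilinear_form :: "('k::field \<Rightarrow> 'a::plus \<Rightarrow> 'a) \<Rightarrow> ('a list \<Rightarrow> 'k) \<Rightarrow> bool"
  where "multilinear_form s \<phi> \<longleftrightarrow> (\<forall>n. multilinear_on s (*) (replicate n UNIV) \<phi>)"

definition tpure :: "('k::field \<Rightarrow> 'a::plus \<Rightarrow> 'a) \<Rightarrow> 'a list \<Rightarrow> ('k, 'a) tensor"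
  where "tpure s w = (\<lambda>\<phi>. if multilinear_form s \<phi> then \<phi> w else 0)"

definition tspace :: "('k::field \<Rightarrow> 'a::plus \<Rightarrow> 'a) \<Rightarrow> 'a set list \<Rightarrow> ('k, 'a) tensor set"
  where "tspace s Cs = module.span tscale (tpure s ` listset Cs)"

abbreviation tpower :: "('k::field \<Rightarrow> 'a::plus \<Rightarrow> 'a) \<Rightarrow> 'a set \<Rightarrow> nat \<Rightarrow> ('k, 'a) tensor set"
  where "tpower s C n \<equiv> tspace s (replicate n C)"

text \<open>The linear map on \<open>C\<^sub>1 \<otimes> \<dots> \<otimes> C\<^sub>n\<close> sending \<open>a\<^sub>1 \<otimes> \<dots> \<otimes> a\<^sub>n\<close> to \<open>g [a\<^sub>1, \<dots>, a\<^sub>n]\<close>,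
  extended by \<open>0\<close> to the other elements of the type.\<close>

definition tlift ::
    "('k::field \<Rightarrow> 'a::plus \<Rightarrow> 'a) \<Rightarrow> ('k \<Rightarrow> 'v::ab_group_add \<Rightarrow> 'v) \<Rightarrow> 'a set list \<Rightarrow>
     ('a list \<Rightarrow> 'v) \<Rightarrow> ('k, 'a) tensor \<Rightarrow> 'v"
  where "tlift s sV Cs g t =
    (if t \<in> tspace s Cs
     then THE v. \<exists>W c. finite W \<and> W \<subseteq> listset Cs \<and>
            t = (\<Sum>w\<in>W. tscale (c w) (tpure s w)) \<and> v = (\<Sum>w\<in>W. sV (c w) (g w))
     else 0)"

lemma vector_space_fscale: "vector_space sV \<Longrightarrow> vector_space (fscale sV)"
  unfolding vector_space_def fscale_def by (auto simp: fun_eq_iff)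

lemma vector_space_field: "vector_space ((*) :: 'k::field \<Rightarrow> 'k \<Rightarrow> 'k)"
  by unfold_locales (auto simp: algebra_simps)

lemma listset_iff: "w \<in> listset Cs \<longleftrightarrow> list_all2 (\<in>) w Cs"
  by (induction Cs arbitrary: w) (auto simp: set_Cons_def list_all2_Cons2)

lemma projection_exists:
  assumes "vector_space s" "module.subspace s C"
  shows "\<exists>P. Vector_Spaces.linear s s P \<and> range P \<subseteq> C \<and> (\<forall>x\<in>C. P x = x)"
proof -
  interpret vector_space s by fact
  interpret vector_space_pair s s by unfold_locales
  obtain B where B: "B \<subseteq> C" "independent B" "span B = C"
    using assms(2) basis_exists[of C] by (metis span_subspace)
  obtain P where P: "Vector_Spaces.linear s s P" "\<forall>x\<in>B. P x = id x" "range P = span (id ` B)"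
    using linear_independent_extend_subspace[OF B(2), of id] by auto
  have "P x = x" if "x \<in> C" for x
    using linear_eq_on[OF P(1) module_hom_id, of x B] P(2) B(3) that by simp
  then show ?thesis using P B by auto
qed

lemma functional_separates:
  fixes sV :: "'k::field \<Rightarrow> 'v::ab_group_add \<Rightarrow> 'v"
  assumes "vector_space sV" "v \<noteq> v'"
  shows "\<exists>l. Vector_Spaces.linear sV (*) l \<and> l v \<noteq> (l v' :: 'k)"
proof -
  interpret vector_space sV by fact
  interpret vector_space_pair sV "(*) :: 'k \<Rightarrow> 'k \<Rightarrow> 'k"
    using assms(1) vector_space_field by (simp add: vector_space_pair_def)
  have "independent {v - v'}" using assms(2) by (simp add: dependent_single)
  then obtain l where l: "Vector_Spaces.linear sV (*) l" "l (v - v') = (1::'k)"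
    using linear_independent_extend[of "{v - v'}" "\<lambda>_. 1"] by auto
  then have "l v - l v' = 1" using linear_diff[OF l(1)] by metis
  then show ?thesis using l(1) by (intro exI[of _ l]) auto
qed

lemma tlift_wd:
  fixes s :: "'k::field \<Rightarrow> 'a::ab_group_add \<Rightarrow> 'a" and sV :: "'k \<Rightarrow> 'v::ab_group_add \<Rightarrow> 'v"
  assumes s: "vector_space s" and sV: "vector_space sV"
    and Cs: "\<forall>C\<in>set Cs. module.subspace s C" and g: "multilinear_on s sV Cs g"
    and W: "finite W" "W \<subseteq> listset Cs" and W': "finite W'" "W' \<subseteq> listset Cs"
    and eq: "(\<Sum>w\<in>W. tscale (c w) (tpure s w)) = (\<Sum>w\<in>W'. tscale (c' w) (tpure s w))"
  shows "(\<Sum>w\<in>W. sV (c w) (g w)) = (\<Sum>w\<in>W'. sV (c' w) (g w))"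
proof (rule ccontr)
  assume "\<not> ?thesis"
  from functional_separates[OF sV this] obtain l where l: "Vector_Spaces.linear sV (*) l"
    and neq: "l (\<Sum>w\<in>W. sV (c w) (g w)) \<noteq> (l (\<Sum>w\<in>W'. sV (c' w) (g w)) :: 'k)" by blast
  interpret l: Vector_Spaces.linear sV "(*)" l by fact
  have "\<forall>C. \<exists>P. C \<in> set Cs \<longrightarrow> Vector_Spaces.linear s s P \<and> range P \<subseteq> C \<and> (\<forall>x\<in>C. P x = x)"
    using projection_exists[OF s] Cs by metis
  then obtain P where P: "\<And>C. C \<in> set Cs \<Longrightarrow> Vector_Spaces.linear s s (P C)"
      "\<And>C x. C \<in> set Cs \<Longrightarrow> P C x \<in> C" "\<And>C x. C \<in> set Cs \<Longrightarrow> x \<in> C \<Longrightarrow> P C x = x"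
    by (metis range_subsetD)
  define pr where "pr w = map2 P Cs w" for w
  have pr_in: "pr w \<in> listset Cs" if "length w = length Cs" for w
    using that P(2) by (auto simp: pr_def listset_iff list_all2_conv_all_nth)
  have pr_id: "pr w = w" if "w \<in> listset Cs" for w
    using that P(3) by (auto simp: pr_def listset_iff list_all2_conv_all_nth intro!: nth_equalityI)
  have pr_upd: "pr (w[i := x]) = (pr w)[i := P (Cs ! i) x]" if "length w = length Cs" "i < length Cs" for w i x
    using that by (auto simp: pr_def nth_list_update intro!: nth_equalityI)
  define \<phi> where "\<phi> w = (if length w = length Cs then l (g (pr w)) else 0)" for w
  have "linear_on s (*) UNIV (\<lambda>x. \<phi> (w[i := x]))" if "i < length w" for w i
  proof (cases "length w = length Cs")
    case True
    interpret P: Vector_Spaces.linear s s "P (Cs ! i)" using P(1) True that by simp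
    have "linear_on s sV (Cs ! i) (\<lambda>x. g ((pr w)[i := x]))"
      using g pr_in[OF True] True that by (auto simp: multilinear_on_def)
    then show ?thesis using True that P(2)[of "Cs ! i"]
      by (simp add: linear_on_def \<phi>_def pr_upd P.add P.scale l.add l.scale)
  qed (simp add: \<phi>_def linear_on_def)
  then have ml: "multilinear_form s \<phi>"
    by (auto simp: multilinear_form_def multilinear_on_def listset_iff list_all2_conv_all_nth)
  have ev: "(\<Sum>w\<in>X. tscale (d w) (tpure s w)) \<phi> = l (\<Sum>w\<in>X. sV (d w) (g w))"
    if "finite X" "X \<subseteq> listset Cs" for X d
  proof -
    have "(\<Sum>w\<in>X. tscale (d w) (tpure s w)) \<phi> = (\<Sum>w\<in>X. d w * tpure s w \<phi>)"
      using that(1) by (induction X rule: finite_induct) (auto simp: fscale_def)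
    also have "\<dots> = (\<Sum>w\<in>X. l (sV (d w) (g w)))"
      using that(2) ml pr_id by (intro sum.cong)
        (auto simp: tpure_def \<phi>_def l.scale listset_iff list_all2_lengthD subset_iff)
    finally show ?thesis by (simp add: l.sum)
  qed
  show False using neq ev[OF W] ev[OF W'] eq by metis
qed

context
  fixes s :: "'k::field \<Rightarrow> 'a::ab_group_add \<Rightarrow> 'a" and sV :: "'k \<Rightarrow> 'v::ab_group_add \<Rightarrow> 'v" and Cs g
  assumes s: "vector_space s" and sV: "vector_space sV"
    and Cs: "\<forall>C\<in>set Cs. module.subspace s C" and g: "multilinear_on s sV Cs g"
begin

interpretation T: vector_space "tscale :: 'k \<Rightarrow> ('k, 'a) tensor \<Rightarrow> _"
  by (rule vector_space_fscale[OF vector_space_field])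

interpretation V: vector_space sV by (rule sV)

lemma tlift_eq:
  assumes "finite W" "W \<subseteq> listset Cs"
  shows "tlift s sV Cs g (\<Sum>w\<in>W. tscale (c w) (tpure s w)) = (\<Sum>w\<in>W. sV (c w) (g w))"
proof -
  have "(\<Sum>w\<in>W. tscale (c w) (tpure s w)) \<in> tspace s Cs"
    unfolding tspace_def using assms
    by (intro T.span_sum T.span_scale T.span_base) auto
  then show ?thesis unfolding tlift_def using assms
    by (auto intro!: the_equality tlift_wd[OF s sV Cs g] exI[of _ W] exI[of _ c])
qed

lemma tspace_rep:
  assumes "t \<in> tspace s Cs"
  obtains W c where "finite W" "W \<subseteq> listset Cs" "t = (\<Sum>w\<in>W. tscale (c w) (tpure s w))"
proof -
  have "\<exists>W c. finite W \<and> W \<subseteq> listset Cs \<and> t = (\<Sum>w\<in>W. tscale (c w) (tpure s w))"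
    using assms unfolding tspace_def
  proof (induction rule: T.span_induct_alt)
    case base
    then show ?case by (intro exI[of _ "{}"]) auto
  next
    case (step d x t)
    then obtain W c u where W: "finite W" "W \<subseteq> listset Cs" "t = (\<Sum>w\<in>W. tscale (c w) (tpure s w))"
      "u \<in> listset Cs" "x = tpure s u" by auto
    define c' where "c' w = (if w \<in> W then c w else 0) + (if w = u then d else 0)" for w
    have "(\<Sum>w\<in>insert u W. tscale (c' w) (tpure s w)) =
        (\<Sum>w\<in>insert u W. tscale (if w \<in> W then c w else 0) (tpure s w)) +
        (\<Sum>w\<in>insert u W. tscale (if w = u then d else 0) (tpure s w))"
      by (simp add: c'_def T.scale_left_distrib sum.distrib)
    also have "(\<Sum>w\<in>insert u W. tscale (if w \<in> W then c w else 0) (tpure s w)) = t"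
      unfolding W(3) using W(1) by (intro sum.mono_neutral_cong_right) auto
    also have "(\<Sum>w\<in>insert u W. tscale (if w = u then d else 0) (tpure s w)) = tscale d x"
    proof -
      have "(\<Sum>w\<in>insert u W. tscale (if w = u then d else 0) (tpure s w)) =
          (\<Sum>w\<in>{u}. tscale d (tpure s w))"
        using W(1) by (intro sum.mono_neutral_cong_right) auto
      then show ?thesis using W(5) by simp
    qed
    finally show ?case using W by (intro exI[of _ "insert u W"] exI[of _ c']) (auto simp: add.commute)
  qed
  then show ?thesis using that by blast
qed

lemma tlift_tpure: "w \<in> listset Cs \<Longrightarrow> tlift s sV Cs g (tpure s w) = g w"
  using tlift_eq[of "{w}" "\<lambda>_. 1"] by simp

lemma linear_on_tlift: "linear_on tscale sV (tspace s Cs) (tlift s sV Cs g)"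
proof -
  have "tlift s sV Cs g (tscale d t + tscale e t') = sV d (tlift s sV Cs g t) + sV e (tlift s sV Cs g t')"
    if t: "t \<in> tspace s Cs" and t': "t' \<in> tspace s Cs" for d e t t'
  proof -
    obtain W c where W: "finite W" "W \<subseteq> listset Cs" "t = (\<Sum>w\<in>W. tscale (c w) (tpure s w))"
      using tspace_rep[OF t] .
    obtain W' c' where W': "finite W'" "W' \<subseteq> listset Cs" "t' = (\<Sum>w\<in>W'. tscale (c' w) (tpure s w))"
      using tspace_rep[OF t'] .
    define U where "U = W \<union> W'"
    define b where "b w = (if w \<in> W then c w else 0)" for w
    define b' where "b' w = (if w \<in> W' then c' w else 0)" for w
    have U: "finite U" "U \<subseteq> listset Cs" using W W' by (auto simp: U_def)
    have t: "t = (\<Sum>w\<in>U. tscale (b w) (tpure s w))"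
      unfolding W(3) b_def using U(1) by (intro sum.mono_neutral_cong_left) (auto simp: U_def)
    have t': "t' = (\<Sum>w\<in>U. tscale (b' w) (tpure s w))"
      unfolding W'(3) b'_def using U(1) by (intro sum.mono_neutral_cong_left) (auto simp: U_def)
    have "tscale d t + tscale e t' = (\<Sum>w\<in>U. tscale (d * b w + e * b' w) (tpure s w))"
      unfolding t t' by (simp add: T.scale_left_distrib sum.distrib T.scale_sum_right)
    then have "tlift s sV Cs g (tscale d t + tscale e t') = (\<Sum>w\<in>U. sV (d * b w + e * b' w) (g w))"
      using tlift_eq[OF U] by simp
    also have "\<dots> = sV d (\<Sum>w\<in>U. sV (b w) (g w)) + sV e (\<Sum>w\<in>U. sV (b' w) (g w))"
      by (simp add: V.scale_left_distrib sum.distrib V.scale_sum_right)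
    finally show ?thesis unfolding t t' using tlift_eq[OF U] by simp
  qed
  from this[of _ _ 1 1] this[of _ _ _ 0] show ?thesis
    unfolding linear_on_def by (metis T.scale_one V.scale_one T.scale_zero_left V.scale_zero_left add_0_right)
qed

lemma tlift_unique:
  assumes f: "linear_on tscale sV (tspace s Cs) f" and fg: "\<And>w. w \<in> listset Cs \<Longrightarrow> f (tpure s w) = g w"
    and t: "t \<in> tspace s Cs"
  shows "f t = tlift s sV Cs g t"
proof -
  let ?X = "{t \<in> tspace s Cs. f t = tlift s sV Cs g t}"
  have sub: "T.subspace (tspace s Cs)" unfolding tspace_def by simp
  have z: "h 0 = 0" if "linear_on tscale sV (tspace s Cs) h" for h
  proof -
    have "h (tscale 0 0) = sV 0 (h 0)"
      using that T.subspace_0[OF sub] unfolding linear_on_def by blast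
    then show ?thesis by simp
  qed
  have "T.subspace ?X"
    using f linear_on_tlift z[OF f] z[OF linear_on_tlift] sub
    by (intro T.subspaceI) (auto simp: linear_on_def T.subspace_0 T.subspace_add T.subspace_scale)
  moreover have "tpure s ` listset Cs \<subseteq> ?X"
    using fg tlift_tpure by (auto simp: tspace_def intro: T.span_base)
  ultimately have "tspace s Cs \<subseteq> ?X" unfolding tspace_def by (rule T.span_minimal[rotated])
  then show ?thesis using t by auto
qed

end

text \<open>\<open>u \<otimes> t \<otimes> v\<close> for words \<open>u\<close>, \<open>v\<close> (standing for pure tensors) and \<open>t \<in> A \<otimes> A\<close>.\<close>

definition tinsert ::
    "('k::field \<Rightarrow> 'a::plus \<Rightarrow> 'a) \<Rightarrow> 'a list \<Rightarrow> ('k, 'a) tensor \<Rightarrow> 'a list \<Rightarrow> ('k, 'a) tensor"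
  where "tinsert s u t v = tlift s tscale [UNIV, UNIV] (\<lambda>z. tpure s (u @ z @ v)) t"


section \<open>Hopf algebras\<close>

text \<open>\<open>sweedler s sV D (\<lambda>x y. g x y) a\<close> is \<open>\<Sum> g(a\<^sub>(\<^sub>1\<^sub>), a\<^sub>(\<^sub>2\<^sub>))\<close>, for \<open>g\<close> bilinear.\<close>

definition sweedler ::
    "('k::field \<Rightarrow> 'a::plus \<Rightarrow> 'a) \<Rightarrow> ('k \<Rightarrow> 'v::ab_group_add \<Rightarrow> 'v) \<Rightarrow> ('a \<Rightarrow> ('k, 'a) tensor) \<Rightarrow>
     ('a \<Rightarrow> 'a \<Rightarrow> 'v) \<Rightarrow> 'a \<Rightarrow> 'v"
  where "sweedler s sV D g a = tlift s sV [UNIV, UNIV] (\<lambda>z. g (z ! 0) (z ! 1)) (D a)"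

locale hopf_algebra = vector_space s
  for s :: "'k::field \<Rightarrow> 'a::ring_1 \<Rightarrow> 'a" +
  fixes D :: "'a \<Rightarrow> ('k, 'a) tensor" and \<epsilon> :: "'a \<Rightarrow> 'k" and S :: "'a \<Rightarrow> 'a"
  assumes mult_scale_left: "s c a * b = s c (a * b)"
    and mult_scale_right: "a * s c b = s c (a * b)"
    and comult_linear: "Vector_Spaces.linear s tscale D"
    and comult_in: "D a \<in> tpower s UNIV 2"
    and counit_linear: "Vector_Spaces.linear s (*) \<epsilon>"
    and coassoc: "sweedler s tscale D (\<lambda>x y. tinsert s [] (D x) [y]) a =
                  sweedler s tscale D (\<lambda>x y. tinsert s [x] (D y) []) a"
    and counit_left: "sweedler s s D (\<lambda>x y. s (\<epsilon> x) y) a = a"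
    and counit_right: "sweedler s s D (\<lambda>x y. s (\<epsilon> y) x) a = a"
    and comult_mult: "D (a * b) =
      sweedler s tscale D (\<lambda>x y. sweedler s tscale D (\<lambda>x' y'. tpure s [x * x', y * y']) b) a"
    and comult_one: "D 1 = tpure s [1, 1]"
    and counit_mult: "\<epsilon> (a * b) = \<epsilon> a * \<epsilon> b"
    and counit_one: "\<epsilon> 1 = 1"
    and antipode_linear: "Vector_Spaces.linear s s S"
    and antipode_left: "sweedler s s D (\<lambda>x y. S x * y) a = s (\<epsilon> a) 1"
    and antipode_right: "sweedler s s D (\<lambda>x y. x * S y) a = s (\<epsilon> a) 1"

definition sub_hopf_algebra ::
    "('k::field \<Rightarrow> 'a::ring_1 \<Rightarrow> 'a) \<Rightarrow> ('a \<Rightarrow> ('k, 'a) tensor) \<Rightarrow> ('a \<Rightarrow> 'a) \<Rightarrow> 'a set \<Rightarrow> bool"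
  where "sub_hopf_algebra s D S H \<longleftrightarrow>
    module.subspace s H \<and> 1 \<in> H \<and> (\<forall>x\<in>H. \<forall>y\<in>H. x * y \<in> H) \<and>
    (\<forall>x\<in>H. D x \<in> tpower s H 2) \<and> (\<forall>x\<in>H. S x \<in> H)"

definition adj ::
    "('k::field \<Rightarrow> 'a::ring_1 \<Rightarrow> 'a) \<Rightarrow> ('a \<Rightarrow> ('k, 'a) tensor) \<Rightarrow> ('a \<Rightarrow> 'a) \<Rightarrow> 'a \<Rightarrow> 'a \<Rightarrow> 'a"
  where "adj s D S a b = sweedler s s D (\<lambda>x y. S x * b * y) a"

locale bimodule = vector_space sM
  for sM :: "'k::field \<Rightarrow> 'm::ab_group_add \<Rightarrow> 'm" +
  fixes s :: "'k \<Rightarrow> 'a::ring_1 \<Rightarrow> 'a" and l :: "'a \<Rightarrow> 'm \<Rightarrow> 'm" and r :: "'m \<Rightarrow> 'a \<Rightarrow> 'm"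
  assumes left_linear: "Vector_Spaces.linear sM sM (\<lambda>m. l a m)" "Vector_Spaces.linear s sM (\<lambda>a. l a m)"
    and right_linear: "Vector_Spaces.linear sM sM (\<lambda>m. r m a)" "Vector_Spaces.linear s sM (\<lambda>a. r m a)"
    and left_one: "l 1 m = m" and left_mult: "l (a * b) m = l a (l b m)"
    and right_one: "r m 1 = m" and right_mult: "r m (a * b) = r (r m a) b"
    and left_right: "r (l a m) b = l a (r m b)"


section \<open>The Woronowicz braiding and the quantum shuffle product\<close>

definition woronowicz ::
    "('k::field \<Rightarrow> 'a::ring_1 \<Rightarrow> 'a) \<Rightarrow> ('a \<Rightarrow> ('k, 'a) tensor) \<Rightarrow> ('a \<Rightarrow> 'a) \<Rightarrow>
     ('k, 'a) tensor \<Rightarrow> ('k, 'a) tensor"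
  where "woronowicz s D S = tlift s tscale [UNIV, UNIV]
    (\<lambda>z. sweedler s tscale D (\<lambda>x y. tpure s [x, adj s D S y (z ! 0)]) (z ! 1))"

text \<open>\<open>braid_at s \<sigma> n i\<close> is \<open>\<sigma>\<^sub>i\<close> acting on the \<open>n\<close>-th tensor power, for \<open>1 \<le> i < n\<close>; list
  positions are counted from \<open>0\<close>.\<close>

definition braid_at ::
    "('k::field \<Rightarrow> 'a::ring_1 \<Rightarrow> 'a) \<Rightarrow> (('k, 'a) tensor \<Rightarrow> ('k, 'a) tensor) \<Rightarrow> nat \<Rightarrow> nat \<Rightarrow>
     ('k, 'a) tensor \<Rightarrow> ('k, 'a) tensor"
  where "braid_at s \<sigma> n i = tlift s tscale (replicate n UNIV)
    (\<lambda>w. tinsert s (take (i - 1) w) (\<sigma> (tpure s [w ! (i - 1), w ! i])) (drop (i + 1) w))"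

text \<open>\<open>braid_word s \<sigma> n [i\<^sub>1, \<dots>, i\<^sub>r]\<close> is the composite \<open>\<sigma>\<^sub>i\<^sub>1 \<circ> \<dots> \<circ> \<sigma>\<^sub>i\<^sub>r\<close>.\<close>

definition braid_word ::
    "('k::field \<Rightarrow> 'a::ring_1 \<Rightarrow> 'a) \<Rightarrow> (('k, 'a) tensor \<Rightarrow> ('k, 'a) tensor) \<Rightarrow> nat \<Rightarrow> nat list \<Rightarrow>
     ('k, 'a) tensor \<Rightarrow> ('k, 'a) tensor"
  where "braid_word s \<sigma> n is = foldr (\<lambda>i f. braid_at s \<sigma> n i \<circ> f) is id"

definition decomposition :: "nat \<Rightarrow> (nat \<Rightarrow> nat) \<Rightarrow> nat list \<Rightarrow> bool"
  where "decomposition n w is \<longleftrightarrow>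
    set is \<subseteq> {1..<n} \<and> w = foldr (\<lambda>i f. transpose i (i + 1) \<circ> f) is id"

definition reduced_decomposition :: "nat \<Rightarrow> (nat \<Rightarrow> nat) \<Rightarrow> nat list \<Rightarrow> bool"
  where "reduced_decomposition n w is \<longleftrightarrow>
    decomposition n w is \<and> (\<forall>js. decomposition n w js \<longrightarrow> length is \<le> length js)"

definition reduced_word :: "nat \<Rightarrow> (nat \<Rightarrow> nat) \<Rightarrow> nat list"
  where "reduced_word n w = (SOME is. reduced_decomposition n w is)"

definition shuffle_perms :: "nat \<Rightarrow> nat \<Rightarrow> (nat \<Rightarrow> nat) set"
  where "shuffle_perms p n =
    {w. w permutes {1..n} \<and> strict_mono_on {1..p} w \<and> strict_mono_on {p + 1..n} w}"

text \<open>\<open>qshuffle s \<sigma> p q\<close> is the product of a tensor of degree \<open>p\<close> with one of degree \<open>q\<close>, as a map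
  on the tensor power of degree \<open>p + q\<close>.\<close>

definition qshuffle ::
    "('k::field \<Rightarrow> 'a::ring_1 \<Rightarrow> 'a) \<Rightarrow> (('k, 'a) tensor \<Rightarrow> ('k, 'a) tensor) \<Rightarrow> nat \<Rightarrow> nat \<Rightarrow>
     ('k, 'a) tensor \<Rightarrow> ('k, 'a) tensor"
  where "qshuffle s \<sigma> p q t =
    (\<Sum>w\<in>shuffle_perms p (p + q).
       tscale ((-1) ^ length (reduced_word (p + q) w)) (braid_word s \<sigma> (p + q) (reduced_word (p + q) w) t))"


section \<open>Cochain complexes\<close>

text \<open>Spaces of maps on a subspace are realised by maps vanishing outside that subspace, so that
  equality of cochains is equality of functions.\<close>

definition Hom_N ::
    "('k::field \<Rightarrow> 'a::ring_1 \<Rightarrow> 'a) \<Rightarrow> 'a set \<Rightarrow> nat \<Rightarrow> ('k \<Rightarrow> 'v::ab_group_add \<Rightarrow> 'v) \<Rightarrow> 'v set \<Rightarrow>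
     (('k, 'a) tensor \<Rightarrow> 'v) set"
  where "Hom_N s C n sV V =
    {f. linear_on tscale sV (tpower s C n) f \<and>
        (\<forall>t\<in>tpower s C n. f t \<in> V) \<and> (\<forall>t. t \<notin> tpower s C n \<longrightarrow> f t = 0) \<and>
        (\<forall>w\<in>listset (replicate n C). 1 \<in> set w \<longrightarrow> f (tpure s w) = 0)}"

definition cochain_complex ::
    "('k::field \<Rightarrow> 'x::ab_group_add \<Rightarrow> 'x) \<Rightarrow> (nat \<Rightarrow> 'x set) \<Rightarrow> (nat \<Rightarrow> 'x \<Rightarrow> 'x) \<Rightarrow> bool"
  where "cochain_complex sX X d \<longleftrightarrow> vector_space sX \<and>
    (\<forall>n. module.subspace sX (X n) \<and> linear_on sX sX (X n) (d n) \<and>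
         d n ` X n \<subseteq> X (Suc n) \<and> (\<forall>x\<in>X n. d (Suc n) (d n x) = 0))"

definition complex_morphism ::
    "('k::field \<Rightarrow> 'x::ab_group_add \<Rightarrow> 'x) \<Rightarrow> (nat \<Rightarrow> 'x set) \<Rightarrow> (nat \<Rightarrow> 'x \<Rightarrow> 'x) \<Rightarrow>
     ('k \<Rightarrow> 'y::ab_group_add \<Rightarrow> 'y) \<Rightarrow> (nat \<Rightarrow> 'y set) \<Rightarrow> (nat \<Rightarrow> 'y \<Rightarrow> 'y) \<Rightarrow>
     (nat \<Rightarrow> 'x \<Rightarrow> 'y) \<Rightarrow> bool"
  where "complex_morphism sX X d sY Y e F \<longleftrightarrow>
    cochain_complex sX X d \<and> cochain_complex sY Y e \<and>
    (\<forall>n. linear_on sX sY (X n) (F n) \<and> F n ` X n \<subseteq> Y n \<and>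
         (\<forall>x\<in>X n. F (Suc n) (d n x) = e n (F n x)))"

text \<open>Multiply the \<open>i\<close>-th and the \<open>(i+1)\<close>-st letter, counted from \<open>1\<close>.\<close>

definition merge :: "nat \<Rightarrow> 'a::times list \<Rightarrow> 'a list"
  where "merge i w = take (i - 1) w @ [w ! (i - 1) * w ! i] @ drop (i + 1) w"

definition hochschild_cochains ::
    "('k::field \<Rightarrow> 'a::ring_1 \<Rightarrow> 'a) \<Rightarrow> ('k \<Rightarrow> 'm::ab_group_add \<Rightarrow> 'm) \<Rightarrow> nat \<Rightarrow>
     (('k, 'a) tensor \<Rightarrow> 'm) set"
  where "hochschild_cochains s sM n = Hom_N s UNIV n sM UNIV"

definition hochschild_diff ::
    "('k::field \<Rightarrow> 'a::ring_1 \<Rightarrow> 'a) \<Rightarrow> ('k \<Rightarrow> 'm::ab_group_add \<Rightarrow> 'm) \<Rightarrow>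
     ('a \<Rightarrow> 'm \<Rightarrow> 'm) \<Rightarrow> ('m \<Rightarrow> 'a \<Rightarrow> 'm) \<Rightarrow> nat \<Rightarrow>
     (('k, 'a) tensor \<Rightarrow> 'm) \<Rightarrow> ('k, 'a) tensor \<Rightarrow> 'm"
  where "hochschild_diff s sM l r n f = tlift s sM (replicate (n + 1) UNIV) (\<lambda>as.
      l (hd as) (f (tpure s (tl as)))
      + (\<Sum>i = 1..n. sM ((-1) ^ i) (f (tpure s (merge i as))))
      + sM ((-1) ^ (n + 1)) (r (f (tpure s (butlast as))) (last as)))"

text \<open>An element of \<open>\<Oplus>\<^sub>p\<^sub>+\<^sub>q\<^sub>=\<^sub>n Hom\<^sub>N(A\<^sup>\<otimes>\<^sup>p, Hom\<^sub>N(H\<^sup>\<otimes>\<^sup>q, M))\<close> is a family indexed by all pairs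
  \<open>(p, q)\<close> which is \<open>0\<close> for \<open>p + q \<noteq> n\<close>.\<close>

type_synonym ('k, 'a, 'm) bicochain = "nat \<Rightarrow> nat \<Rightarrow> ('k, 'a) tensor \<Rightarrow> ('k, 'a) tensor \<Rightarrow> 'm"

definition double_cochains ::
    "('k::field \<Rightarrow> 'a::ring_1 \<Rightarrow> 'a) \<Rightarrow> 'a set \<Rightarrow> ('k \<Rightarrow> 'm::ab_group_add \<Rightarrow> 'm) \<Rightarrow> nat \<Rightarrow>
     ('k, 'a, 'm) bicochain set"
  where "double_cochains s H sM n =
    {F. \<forall>p q. if p + q = n then F p q \<in> Hom_N s UNIV p (fscale sM) (Hom_N s H q sM UNIV)
              else F p q = 0}"

text \<open>The first component of \<open>\<rho>\<close>, from bidegree \<open>(p, q)\<close> to \<open>(p + 1, q)\<close>. The inner \<open>tlift\<close>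
  is the linear map \<open>A \<otimes> H\<^sup>\<otimes>\<^sup>q \<rightarrow> M\<close>, \<open>a \<otimes> b \<mapsto> a.f(a\<^sup>2 \<otimes> \<dots> \<otimes> a\<^sup>p\<^sup>+\<^sup>1)(b)\<close>, which is applied to
  \<open>\<sigma>\<^sub>1 \<cdots> \<sigma>\<^sub>q(b \<otimes> a\<^sup>1)\<close>.\<close>

definition rho_A ::
    "('k::field \<Rightarrow> 'a::ring_1 \<Rightarrow> 'a) \<Rightarrow> (('k, 'a) tensor \<Rightarrow> ('k, 'a) tensor) \<Rightarrow> 'a set \<Rightarrow>
     ('k \<Rightarrow> 'm::ab_group_add \<Rightarrow> 'm) \<Rightarrow> ('a \<Rightarrow> 'm \<Rightarrow> 'm) \<Rightarrow> ('m \<Rightarrow> 'a \<Rightarrow> 'm) \<Rightarrow> nat \<Rightarrow> nat \<Rightarrow>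
     (('k, 'a) tensor \<Rightarrow> ('k, 'a) tensor \<Rightarrow> 'm) \<Rightarrow> ('k, 'a) tensor \<Rightarrow> ('k, 'a) tensor \<Rightarrow> 'm"
  where "rho_A s \<sigma> H sM l r p q f =
    tlift s (fscale sM) (replicate (p + 1) UNIV) (\<lambda>as. tlift s sM (replicate q H) (\<lambda>bs.
      sM ((-1) ^ q)
        (tlift s sM (UNIV # replicate q H) (\<lambda>w. l (hd w) (f (tpure s (tl as)) (tpure s (tl w))))
          (braid_word s \<sigma> (q + 1) [1..<q + 1] (tpure s (bs @ [hd as]))))
      + (\<Sum>i = 1..p. sM ((-1) ^ (i + q)) (f (tpure s (merge i as)) (tpure s bs)))
      + sM ((-1) ^ (p + q + 1)) (r (f (tpure s (butlast as)) (tpure s bs)) (last as))))"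

text \<open>The second component of \<open>\<rho>\<close>, from bidegree \<open>(p, q)\<close> to \<open>(p, q + 1)\<close>.\<close>

definition rho_H ::
    "('k::field \<Rightarrow> 'a::ring_1 \<Rightarrow> 'a) \<Rightarrow> (('k, 'a) tensor \<Rightarrow> ('k, 'a) tensor) \<Rightarrow> 'a set \<Rightarrow>
     ('k \<Rightarrow> 'm::ab_group_add \<Rightarrow> 'm) \<Rightarrow> ('a \<Rightarrow> 'm \<Rightarrow> 'm) \<Rightarrow> ('m \<Rightarrow> 'a \<Rightarrow> 'm) \<Rightarrow> nat \<Rightarrow> nat \<Rightarrow>
     (('k, 'a) tensor \<Rightarrow> ('k, 'a) tensor \<Rightarrow> 'm) \<Rightarrow> ('k, 'a) tensor \<Rightarrow> ('k, 'a) tensor \<Rightarrow> 'm"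
  where "rho_H s \<sigma> H sM l r p q f =
    tlift s (fscale sM) (replicate p UNIV) (\<lambda>as. tlift s sM (replicate (q + 1) H) (\<lambda>bs.
      l (hd bs) (f (tpure s as) (tpure s (tl bs)))
      + (\<Sum>i = 1..q. sM ((-1) ^ i) (f (tpure s as) (tpure s (merge i bs))))
      + sM ((-1) ^ (q + 1))
        (tlift s sM (replicate (p + 1) UNIV)
          (\<lambda>w. r (f (tpure s (butlast w)) (tpure s (butlast bs))) (last w))
          (braid_word s \<sigma> (p + 1) (rev [1..<p + 1]) (tpure s (last bs # as))))))"

definition rho ::
    "('k::field \<Rightarrow> 'a::ring_1 \<Rightarrow> 'a) \<Rightarrow> (('k, 'a) tensor \<Rightarrow> ('k, 'a) tensor) \<Rightarrow> 'a set \<Rightarrow>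
     ('k \<Rightarrow> 'm::ab_group_add \<Rightarrow> 'm) \<Rightarrow> ('a \<Rightarrow> 'm \<Rightarrow> 'm) \<Rightarrow> ('m \<Rightarrow> 'a \<Rightarrow> 'm) \<Rightarrow> nat \<Rightarrow>
     ('k, 'a, 'm) bicochain \<Rightarrow> ('k, 'a, 'm) bicochain"
  where "rho s \<sigma> H sM l r n F = (\<lambda>p q. if p + q = n + 1 then
      (if p = 0 then 0 else rho_A s \<sigma> H sM l r (p - 1) q (F (p - 1) q))
      + (if q = 0 then 0 else rho_H s \<sigma> H sM l r p (q - 1) (F p (q - 1)))
    else 0)"

text \<open>The map induced by \<open>\<Lambda> \<circ> \<^sup>t\<phi>\<^sub>\<sigma>\<close>.\<close>

definition shuffle_map ::
    "('k::field \<Rightarrow> 'a::ring_1 \<Rightarrow> 'a) \<Rightarrow> (('k, 'a) tensor \<Rightarrow> ('k, 'a) tensor) \<Rightarrow> 'a set \<Rightarrow>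
     ('k \<Rightarrow> 'm::ab_group_add \<Rightarrow> 'm) \<Rightarrow> nat \<Rightarrow> (('k, 'a) tensor \<Rightarrow> 'm) \<Rightarrow> ('k, 'a, 'm) bicochain"
  where "shuffle_map s \<sigma> H sM n f = (\<lambda>p q. if p + q = n then
      tlift s (fscale sM) (replicate p UNIV) (\<lambda>as. tlift s sM (replicate q H) (\<lambda>bs.
        f (qshuffle s \<sigma> q p (tpure s (bs @ as)))))
    else 0)"

end

theory Submission
  imports Defs
begin

text \<open>Tensors are handled as formal sums of words, evaluated by multilinear maps. The braiding makes
  the product of \<open>A\<close> braided commutative, \<open>\<mu>\<sigma> = \<mu>\<close>, and both multiplications slide through \<open>\<sigma>\<close>.
  By induction on the two words, splitting a shuffle according to the origin of its first letter,
  \<open>\<phi>\<^sub>\<sigma>\<close> is then a derivation for the bar differential: the terms that multiply a letter of one factor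
  by a letter of the other cancel in pairs by \<open>\<mu>\<sigma> = \<mu>\<close>. Splitting by the first and by the last letter
  gives the two outer terms of \<open>\<rho>\<close>. Moreover \<open>\<rho>\<close> squares to zero because each of its components is
  a Hochschild differential, for the bimodule structures that \<open>\<sigma>\<close> induces on \<open>Hom(T(H), M)\<close> and
  \<open>Hom(T(A), M)\<close>, and the two commute.\<close>


section \<open>Multilinear maps and formal sums of words\<close>

text \<open>A tensor is here a functional on multilinear forms, so its expansion into pure tensors
  is a choice, as is the reduced word of a permutation. Every identity about the coproduct or the
  braiding is therefore stated after evaluation by a multilinear map, where the choice no longer
  shows. Functions on words of all lengths at once let an induction strip a letter off a word
  without changing the space of cochains; a cochain of degree n enters as a function vanishing on
  words of other lengths. The subspace H would force side conditions into each such induction.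
  Composing with a linear projection of A onto H removes them: the double complex is treated for two
  words over A, and the stability of H under the adjoint action serves to show that the formulas,
  evaluated at words over H, read cochains at words over H only. The identity \<mu>\<sigma> = \<mu>
  has a second use, in the commutation of the two differentials, when a letter of each word acts on
  the same side of M.\<close>

lemma sum_list_swap:
  fixes f :: "'b \<Rightarrow> 'c \<Rightarrow> 'v::comm_monoid_add"
  shows "(\<Sum>x\<leftarrow>xs. \<Sum>y\<leftarrow>ys. f x y) = (\<Sum>y\<leftarrow>ys. \<Sum>x\<leftarrow>xs. f x y)"
  by (induction xs) (auto simp: sum_list_addf)

lemma sum_list_swap_prod:
  fixes f :: "'b \<Rightarrow> 'c \<Rightarrow> 'd \<Rightarrow> 'e \<Rightarrow> 'v::comm_monoid_add"
  shows "(\<Sum>(x, y)\<leftarrow>xs. \<Sum>(u, v)\<leftarrow>us. f x y u v) = (\<Sum>(u, v)\<leftarrow>us. \<Sum>(x, y)\<leftarrow>xs. f x y u v)"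
  using sum_list_swap[of "\<lambda>p q. f (fst p) (snd p) (fst q) (snd q)" us xs]
  by (simp add: case_prod_unfold)

lemma sum_list_cong: "(\<And>x. x \<in> set xs \<Longrightarrow> f x = g x) \<Longrightarrow> sum_list (map f xs) = sum_list (map g xs)"
  by (metis map_cong)

lemma sum_list_additive:
  assumes "h 0 = 0" "\<And>x y. h (x + y) = h x + h y"
  shows "h (sum_list (map f xs)) = (\<Sum>x\<leftarrow>xs. h (f x))"
  by (induction xs) (auto simp: assms)

lemma sum_list_additive_prod:
  assumes "h 0 = 0" "\<And>x y. h (x + y) = h x + h y"
  shows "h (\<Sum>(x, y)\<leftarrow>xs. f x y) = (\<Sum>(x, y)\<leftarrow>xs. h (f x y))"
  by (induction xs) (auto simp: assms)

lemma sum_list_concat_map: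
  fixes g :: "'b \<Rightarrow> 'v::monoid_add"
  shows "sum_list (map g (concat (map F xs))) = (\<Sum>x\<leftarrow>xs. \<Sum>y\<leftarrow>F x. g y)"
  by (induction xs) (auto simp: comp_def)

lemma sum_list_concat_prod:
  fixes g :: "'b \<Rightarrow> 'c \<Rightarrow> 'v::monoid_add"
  shows "(\<Sum>(u, v)\<leftarrow>concat (map F xs). g u v) = (\<Sum>x\<leftarrow>xs. \<Sum>(u, v)\<leftarrow>F x. g u v)"
  by (induction xs) (auto simp: comp_def)

lemma vector_space_tscale: "vector_space (tscale :: 'k::field \<Rightarrow> ('k, 'a) tensor \<Rightarrow> _)"
  by (rule vector_space_fscale[OF vector_space_field])

lemma linear_onI_linear: "Vector_Spaces.linear s sV f \<Longrightarrow> linear_on s sV U f"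
  by (auto simp: linear_on_def Vector_Spaces.linear_iff)

lemma linear_on_zero:
  fixes sU :: "'k::field \<Rightarrow> 'u::ab_group_add \<Rightarrow> 'u" and sV :: "'k \<Rightarrow> 'v::ab_group_add \<Rightarrow> 'v"
  assumes "linear_on sU sV U f" "module.subspace sU U" "vector_space sU" "vector_space sV"
  shows "f 0 = 0"
proof -
  interpret U: vector_space sU by fact
  interpret V: vector_space sV by fact
  have "f (sU 0 0) = sV 0 (f 0)"
    using assms(1) U.subspace_0[OF assms(2)] unfolding linear_on_def by blast
  then show ?thesis by simp
qed

lemma linear_on_sum_list:
  fixes sU :: "'k::field \<Rightarrow> 'u::ab_group_add \<Rightarrow> 'u" and sV :: "'k \<Rightarrow> 'v::ab_group_add \<Rightarrow> 'v"
  assumes f: "linear_on sU sV U f" and U: "module.subspace sU U" and sU: "vector_space sU" and sV: "vector_space sV"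
    and h: "\<And>p. p \<in> set L \<Longrightarrow> h p \<in> U"
  shows "f (\<Sum>p\<leftarrow>L. h p) = (\<Sum>p\<leftarrow>L. f (h p))" "(\<Sum>p\<leftarrow>L. h p) \<in> U"
proof -
  interpret U: vector_space sU by fact
  have "f (\<Sum>p\<leftarrow>L. h p) = (\<Sum>p\<leftarrow>L. f (h p)) \<and> (\<Sum>p\<leftarrow>L. h p) \<in> U"
    using h
  proof (induction L)
    case Nil
    then show ?case using linear_on_zero[OF f U sU sV] U.subspace_0[OF U] by simp
  next
    case (Cons p L)
    then show ?case using f U.subspace_add[OF U] by (auto simp: linear_on_def)
  qed
  then show "f (\<Sum>p\<leftarrow>L. h p) = (\<Sum>p\<leftarrow>L. f (h p))" "(\<Sum>p\<leftarrow>L. h p) \<in> U" by auto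
qed

lemma subspace_tspace:
  fixes s :: "'k::field \<Rightarrow> 'a::plus \<Rightarrow> 'a"
  shows "module.subspace tscale (tspace s Cs)"
proof -
  interpret T: vector_space "tscale :: 'k \<Rightarrow> ('k, 'a) tensor \<Rightarrow> _" by (rule vector_space_tscale)
  show ?thesis unfolding tspace_def by (rule T.subspace_span)
qed

lemma tpure_in_tspace:
  fixes s :: "'k::field \<Rightarrow> 'a::plus \<Rightarrow> 'a"
  assumes "w \<in> listset Cs"
  shows "tpure s w \<in> tspace s Cs"
proof -
  interpret T: vector_space "tscale :: 'k \<Rightarrow> ('k, 'a) tensor \<Rightarrow> _" by (rule vector_space_tscale)
  show ?thesis using assms unfolding tspace_def by (auto intro: T.span_base)
qed

text \<open>\<open>tlift\<close> consults its word function only on words of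
  \<open>listset Cs\<close>, so a formula written with \<open>z ! 0\<close>, \<open>hd\<close> or a
  cochain may be replaced by one that behaves well on all words.\<close>

lemma tlift_cong:
  assumes "\<And>w. w \<in> listset Cs \<Longrightarrow> g w = g' w"
  shows "tlift s sV Cs g = tlift s sV Cs g'"
proof -
  have *: "(\<Sum>w\<in>W. sV (c w) (g w)) = (\<Sum>w\<in>W. sV (c w) (g' w))" if "W \<subseteq> listset Cs" for W c
    using that assms by (intro sum.cong) auto
  show ?thesis unfolding tlift_def
    by (intro ext if_cong refl arg_cong[where f = The] ex_cong1 conj_cong) (simp add: *)
qed

lemma listset_replicate: "w \<in> listset (replicate n C) \<longleftrightarrow> length w = n \<and> set w \<subseteq> C"
  by (auto simp: listset_iff list_all2_conv_all_nth in_set_conv_nth) (metis nth_mem subset_iff)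

text \<open>Multilinearity in all arguments at once, for words of every length: this is the form in which
  it survives inductions over words.\<close>

definition mlin :: "('k::field \<Rightarrow> 'a::ab_group_add \<Rightarrow> 'a) \<Rightarrow> ('k \<Rightarrow> 'v::ab_group_add \<Rightarrow> 'v) \<Rightarrow> ('a list \<Rightarrow> 'v) \<Rightarrow> bool"
  where "mlin s sV g \<longleftrightarrow> (\<forall>u v. Vector_Spaces.linear s sV (\<lambda>x. g (u @ x # v)))"

lemma mlin_multilinear_on: "mlin s sV g \<Longrightarrow> multilinear_on s sV Cs g"
  unfolding multilinear_on_def
proof (intro ballI allI impI)
  fix w i assume g: "mlin s sV g" and w: "w \<in> listset Cs" and i: "i < length Cs"
  then have "length w = length Cs" by (simp add: listset_iff list_all2_lengthD)
  then have "w[i := x] = take i w @ x # drop (Suc i) w" for x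
    using i by (simp add: upd_conv_take_nth_drop)
  then show "linear_on s sV (Cs ! i) (\<lambda>x. g (w[i := x]))"
    using g by (auto simp: mlin_def intro!: linear_onI_linear)
qed

lemma mlin_Cons: "mlin s sV g \<Longrightarrow> mlin s sV (\<lambda>w. g (x # w))"
  unfolding mlin_def
proof (intro allI)
  fix u v assume "\<forall>u v. Vector_Spaces.linear s sV (\<lambda>x. g (u @ x # v))"
  then have "Vector_Spaces.linear s sV (\<lambda>y. g ((x # u) @ y # v))" by blast
  then show "Vector_Spaces.linear s sV (\<lambda>y. g (x # u @ y # v))" by simp
qed

lemma mlin_append: "mlin s sV g \<Longrightarrow> mlin s sV (\<lambda>w. g (u @ w))"
  unfolding mlin_def
proof (intro allI)
  fix u' v assume "\<forall>u v. Vector_Spaces.linear s sV (\<lambda>x. g (u @ x # v))"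
  then have "Vector_Spaces.linear s sV (\<lambda>y. g ((u @ u') @ y # v))" by blast
  then show "Vector_Spaces.linear s sV (\<lambda>y. g (u @ u' @ y # v))" by simp
qed

lemma mlin_snoc: "mlin s sV g \<Longrightarrow> mlin s sV (\<lambda>w. g (w @ v))"
  unfolding mlin_def by simp

lemma mlin_append_Cons: "mlin s sV g \<Longrightarrow> Vector_Spaces.linear s sV (\<lambda>x. g (u @ x # v))"
  unfolding mlin_def by blast

lemma mlin_hd: "mlin s sV g \<Longrightarrow> Vector_Spaces.linear s sV (\<lambda>x. g (x # v))"
  using mlin_append_Cons[where u = "[]"] by auto

lemma multilinear_form_mlin:
  assumes "vector_space s" shows "multilinear_form s \<phi> \<longleftrightarrow> mlin s (*) \<phi>"
proof
  assume *: "multilinear_form s \<phi>"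
  show "mlin s (*) \<phi>" unfolding mlin_def
  proof (intro allI)
    fix u v :: "'b list"
    \<comment> \<open>The \<open>0\<close> is a placeholder: position \<open>length u\<close> is
      overwritten by the varying letter.\<close>
    have "u @ 0 # v \<in> listset (replicate (length (u @ 0 # v)) UNIV)"
      by (subst listset_replicate) auto
    moreover have "replicate (length (u @ 0 # v)) UNIV ! length u = UNIV"
      by (rule nth_replicate) simp
    ultimately have "linear_on s (*) UNIV (\<lambda>x. \<phi> ((u @ 0 # v)[length u := x]))"
      using * unfolding multilinear_form_def multilinear_on_def by (metis add_Suc_right length_Cons length_append length_replicate less_add_Suc1)
    then show "Vector_Spaces.linear s (*) (\<lambda>x. \<phi> (u @ x # v))"
      using assms vector_space_field by (simp add: linear_on_def Vector_Spaces.linear_iff)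
  qed
qed (auto simp: multilinear_form_def mlin_multilinear_on)

text \<open>Multilinearity is inherited from the forms on which \<open>tpure\<close> is evaluated;
  on all other functions it has the constant value 0.\<close>

lemma mlin_tpure: "vector_space s \<Longrightarrow> mlin s tscale (tpure s)"
  unfolding mlin_def tpure_def
  by (auto simp: Vector_Spaces.linear_iff vector_space_tscale fun_eq_iff fscale_def multilinear_form_mlin mlin_def)

lemma tlift_sum_list:
  fixes s :: "'k::field \<Rightarrow> 'a::ab_group_add \<Rightarrow> 'a" and sV :: "'k \<Rightarrow> 'v::ab_group_add \<Rightarrow> 'v"
  assumes s: "vector_space s" and sV: "vector_space sV"
    and Cs: "\<forall>C\<in>set Cs. module.subspace s C" and g: "multilinear_on s sV Cs g"
    and h: "\<And>p. p \<in> set L \<Longrightarrow> h p \<in> listset Cs"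
  shows "tlift s sV Cs g (\<Sum>p\<leftarrow>L. tpure s (h p)) = (\<Sum>p\<leftarrow>L. g (h p))"
proof -
  have "tlift s sV Cs g (\<Sum>p\<leftarrow>L. tpure s (h p)) = (\<Sum>p\<leftarrow>L. tlift s sV Cs g (tpure s (h p)))"
    using h by (intro linear_on_sum_list(1)[OF linear_on_tlift[OF assms(1-4)] subspace_tspace vector_space_tscale sV] tpure_in_tspace)
  also have "\<dots> = (\<Sum>p\<leftarrow>L. g (h p))"
    using h by (intro sum_list_cong tlift_tpure[OF assms(1-4)])
  finally show ?thesis .
qed

text \<open>Scalars are absorbed into the first letter, which stays in the subspace
  \<open>C\<close>; tensors of degree two thus become lists of pairs without coefficients.\<close>

lemma tpower_2_rep:
  fixes s :: "'k::field \<Rightarrow> 'a::ab_group_add \<Rightarrow> 'a"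
  assumes s: "vector_space s" and C: "module.subspace s C" and t: "t \<in> tpower s C 2"
  shows "\<exists>L. set L \<subseteq> C \<times> C \<and> t = (\<Sum>(x, y)\<leftarrow>L. tpure s [x, y])"
proof -
  interpret vector_space s by fact
  interpret T: vector_space "tscale :: 'k \<Rightarrow> ('k, 'a) tensor \<Rightarrow> _" by (rule vector_space_tscale)
  show ?thesis using t unfolding tspace_def
  proof (induction rule: T.span_induct_alt)
    case base
    then show ?case by (intro exI[of _ "[]"]) auto
  next
    case (step d x t)
    then obtain L u where L: "set L \<subseteq> C \<times> C" "t = (\<Sum>(x, y)\<leftarrow>L. tpure s [x, y])"
      and u: "u \<in> listset (replicate 2 C)" "x = tpure s u" by auto
    obtain y z where yz: "u = [y, z]" "y \<in> C" "z \<in> C"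
      using u(1) by (auto simp: numeral_2_eq_2 set_Cons_def)
    have "tscale d x = tpure s [s d y, z]"
      using mlin_hd[OF mlin_tpure[OF s], of "[z]"] by (simp add: u yz Vector_Spaces.linear_iff)
    then show ?case using L yz C by (intro exI[of _ "(s d y, z) # L"]) (auto simp: subspace_scale)
  qed
qed

lemma multilinear_on_2:
  assumes "\<And>y. y \<in> C2 \<Longrightarrow> linear_on s sV C1 (\<lambda>x. g x y)" "\<And>x. x \<in> C1 \<Longrightarrow> linear_on s sV C2 (g x)"
  shows "multilinear_on s sV [C1, C2] (\<lambda>z. g (z ! 0) (z ! 1))"
  using assms by (auto simp: multilinear_on_def set_Cons_def less_Suc_eq linear_on_def)

lemma multilinear_on_3:
  assumes "\<And>y z. linear_on s sV UNIV (\<lambda>x. g x y z)" "\<And>x z. linear_on s sV UNIV (\<lambda>y. g x y z)"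
    "\<And>x y. linear_on s sV UNIV (g x y)"
  shows "multilinear_on s sV [UNIV, UNIV, UNIV] (\<lambda>z. g (z ! 0) (z ! 1) (z ! 2))"
  using assms by (auto simp: multilinear_on_def set_Cons_def less_Suc_eq linear_on_def numeral_2_eq_2)

section \<open>Linearity of maps assembled from linear maps\<close>

abbreviation lin :: "('k::field \<Rightarrow> 'u::ab_group_add \<Rightarrow> 'u) \<Rightarrow> ('k \<Rightarrow> 'v::ab_group_add \<Rightarrow> 'v) \<Rightarrow> ('u \<Rightarrow> 'v) \<Rightarrow> bool"
  where "lin \<equiv> Vector_Spaces.linear"

lemma lin_id: "vector_space s \<Longrightarrow> lin s s (\<lambda>x. x)"
  by (simp add: Vector_Spaces.linear_iff)

lemma lin_zero: "vector_space s \<Longrightarrow> vector_space sV \<Longrightarrow> lin s sV (\<lambda>x. 0)"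
  using module.scale_zero_right[of sV] by (simp add: Vector_Spaces.linear_iff module_iff_vector_space)

lemma lin_add: "lin s sV f \<Longrightarrow> lin s sV g \<Longrightarrow> lin s sV (\<lambda>x. f x + g x)"
  using module.scale_right_distrib[of sV]
  by (simp add: Vector_Spaces.linear_iff algebra_simps module_iff_vector_space)

lemma lin_uminus: "lin s sV f \<Longrightarrow> lin s sV (\<lambda>x. - f x)"
  using module.scale_minus_right[of sV]
  by (simp add: Vector_Spaces.linear_iff module_iff_vector_space)

lemma lin_sum_list:
  "vector_space s \<Longrightarrow> vector_space sV \<Longrightarrow> (\<And>p. p \<in> set L \<Longrightarrow> lin s sV (f p)) \<Longrightarrow> lin s sV (\<lambda>x. \<Sum>p\<leftarrow>L. f p x)"
  by (induction L) (auto intro: lin_zero lin_add)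

lemma lin_sum_list_prod:
  "vector_space s \<Longrightarrow> vector_space sV \<Longrightarrow> (\<And>p q. lin s sV (f p q)) \<Longrightarrow> lin s sV (\<lambda>x. \<Sum>(p, q)\<leftarrow>L. f p q x)"
  by (induction L) (auto intro: lin_zero lin_add)

lemma lin_sum:
  "vector_space s \<Longrightarrow> vector_space sV \<Longrightarrow> (\<And>p. p \<in> I \<Longrightarrow> lin s sV (f p)) \<Longrightarrow> lin s sV (\<lambda>x. \<Sum>p\<in>I. f p x)"
  by (induction I rule: infinite_finite_induct) (auto intro: lin_zero lin_add)

lemma lin_comp: "lin s sU f \<Longrightarrow> lin sU sV g \<Longrightarrow> lin s sV (\<lambda>x. g (f x))"
  by (simp add: Vector_Spaces.linear_iff)

lemma lin_0: "lin s sV f \<Longrightarrow> f 0 = 0"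
  by (rule module_hom.zero[OF Vector_Spaces.linear.axioms(3)])

lemma lin_plus: "lin s sV f \<Longrightarrow> f (x + y) = f x + f y"
  by (simp add: Vector_Spaces.linear_iff)


section \<open>Sweedler calculus\<close>

definition bilin :: "('k::field \<Rightarrow> 'a::ab_group_add \<Rightarrow> 'a) \<Rightarrow> ('k \<Rightarrow> 'v::ab_group_add \<Rightarrow> 'v) \<Rightarrow> ('a \<Rightarrow> 'a \<Rightarrow> 'v) \<Rightarrow> bool"
  where "bilin s sV g \<longleftrightarrow> (\<forall>y. lin s sV (\<lambda>x. g x y)) \<and> (\<forall>x. lin s sV (g x))"

lemma bilinI: "(\<And>y. lin s sV (\<lambda>x. g x y)) \<Longrightarrow> (\<And>x. lin s sV (g x)) \<Longrightarrow> bilin s sV g"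
  by (simp add: bilin_def)

lemma bilin1: "bilin s sV g \<Longrightarrow> lin s sV (\<lambda>x. g x y)"
  by (simp add: bilin_def)

lemma bilin2: "bilin s sV g \<Longrightarrow> lin s sV (g x)"
  by (simp add: bilin_def)

definition trilin :: "('k::field \<Rightarrow> 'a::ab_group_add \<Rightarrow> 'a) \<Rightarrow> ('k \<Rightarrow> 'v::ab_group_add \<Rightarrow> 'v) \<Rightarrow> ('a \<Rightarrow> 'a \<Rightarrow> 'a \<Rightarrow> 'v) \<Rightarrow> bool"
  where "trilin s sV g \<longleftrightarrow> (\<forall>z. bilin s sV (\<lambda>x y. g x y z)) \<and> (\<forall>x y. lin s sV (g x y))"

lemma trilinI:
  "(\<And>y z. lin s sV (\<lambda>x. g x y z)) \<Longrightarrow> (\<And>x z. lin s sV (\<lambda>y. g x y z)) \<Longrightarrow> (\<And>x y. lin s sV (g x y)) \<Longrightarrow> trilin s sV g"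
  by (simp add: trilin_def bilin_def)

context hopf_algebra begin

text \<open>A formal sum representing the coproduct of \<open>a\<close>, chosen arbitrarily. Only
  its evaluations by bilinear maps have a meaning independent of the choice.\<close>

definition cop :: "'a \<Rightarrow> ('a \<times> 'a) list"
  where "cop a = (SOME L. D a = (\<Sum>(x, y)\<leftarrow>L. tpure s [x, y]))"

lemma vs: "vector_space s" by (rule vector_space_axioms)

lemma D_cop: "D a = (\<Sum>(x, y)\<leftarrow>cop a. tpure s [x, y])"
proof -
  have "\<exists>L. D a = (\<Sum>(x, y)\<leftarrow>L. tpure s [x, y])"
    using tpower_2_rep[OF vs subspace_UNIV comult_in] by blast
  then show ?thesis unfolding cop_def by (rule someI_ex)
qed

lemma subspaces_UNIV: "\<forall>C\<in>set (replicate n UNIV). module.subspace s C"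
proof -
  show ?thesis by auto
qed

lemma bilin_multilinear_on: "bilin s sV g \<Longrightarrow> multilinear_on s sV [C1, C2] (\<lambda>z. g (z ! 0) (z ! 1))"
  by (intro multilinear_on_2 linear_onI_linear bilin1 bilin2)

lemma bilin_sum_cop:
  assumes g: "bilin s sV g"
    and C: "module.subspace s C1" "module.subspace s C2" and L: "set L \<subseteq> C1 \<times> C2"
  shows "tlift s sV [C1, C2] (\<lambda>z. g (z ! 0) (z ! 1)) (\<Sum>(x, y)\<leftarrow>L. tpure s [x, y]) = (\<Sum>(x, y)\<leftarrow>L. g x y)"
proof -
  have "vector_space sV" using g by (auto simp: bilin_def Vector_Spaces.linear_iff)
  moreover have "\<forall>p\<in>set L. (case p of (x, y) \<Rightarrow> [x, y]) \<in> listset [C1, C2]"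
    using L by (auto simp: set_Cons_def)
  ultimately show ?thesis
    using tlift_sum_list[OF vs _ _ bilin_multilinear_on[OF g, of C1 C2], where L = L and h = "\<lambda>(x, y). [x, y]"] C
    by (simp add: case_prod_unfold)
qed

lemma sweedler_cop:
  assumes g: "bilin s sV g"
  shows "sweedler s sV D g a = (\<Sum>(x, y)\<leftarrow>cop a. g x y)"
proof -
  show ?thesis unfolding sweedler_def by (subst D_cop, rule bilin_sum_cop[OF g]) auto
qed

text \<open>Linearity in \<open>a\<close> cannot be read off the chosen list; it comes from that of
  \<open>D\<close> followed by that of \<open>tlift\<close>.\<close>

lemma lin_cop:
  assumes g: "bilin s sV g"
  shows "lin s sV (\<lambda>a. \<Sum>(x, y)\<leftarrow>cop a. g x y)"
proof -
  have sV: "vector_space sV" using g by (auto simp: bilin_def Vector_Spaces.linear_iff)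
  have "linear_on tscale sV (tspace s [UNIV, UNIV]) (tlift s sV [UNIV, UNIV] (\<lambda>z. g (z ! 0) (z ! 1)))"
    by (rule linear_on_tlift[OF vs sV _ bilin_multilinear_on[OF g]]) auto
  moreover have "D a \<in> tspace s [UNIV, UNIV]" for a
    using comult_in[of a] by (simp add: numeral_2_eq_2)
  ultimately have "lin s sV (sweedler s sV D g)"
    using comult_linear sV unfolding sweedler_def by (simp add: linear_on_def Vector_Spaces.linear_iff)
  then show ?thesis by (simp add: sweedler_cop[OF g, abs_def])
qed

lemma lin_sum_cop:
  "vector_space sV \<Longrightarrow> (\<And>p q. lin s sV (f p q)) \<Longrightarrow> lin s sV (\<lambda>x. \<Sum>(p, q)\<leftarrow>L. f p q x)"
  by (rule lin_sum_list_prod[OF vs])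

lemma lin_arg: "lin s sV g \<Longrightarrow> lin s s f \<Longrightarrow> lin s sV (\<lambda>x. g (f x))"
  by (rule lin_comp)

lemma lin_mult_left: "lin s s f \<Longrightarrow> lin s s (\<lambda>x. f x * c)"
  by (simp add: Vector_Spaces.linear_iff algebra_simps mult_scale_left)

lemma lin_mult_right: "lin s s f \<Longrightarrow> lin s s (\<lambda>x. c * f x)"
  by (simp add: Vector_Spaces.linear_iff algebra_simps mult_scale_right)

lemma lin_S: "lin s s f \<Longrightarrow> lin s s (\<lambda>x. S (f x))"
  by (rule lin_comp[OF _ antipode_linear])

lemma lin_ident: "lin s s (\<lambda>x. x)"
  by (rule lin_id[OF vs])

lemmas lin_rules = lin_mult_left lin_mult_right lin_S lin_ident

text \<open>The coassociativity axiom is an equality in the third tensor power, and the linear map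
  induced by \<open>g\<close> carries it to an equality of sums. The regroupings of Sweedler indices
  below are instances.\<close>

lemma coassoc_cop:
  assumes g: "trilin s sV g"
  shows "(\<Sum>(u, z)\<leftarrow>cop a. \<Sum>(x, y)\<leftarrow>cop u. g x y z) = (\<Sum>(x, u)\<leftarrow>cop a. \<Sum>(y, z)\<leftarrow>cop u. g x y z)"
proof -
  have sV: "vector_space sV" using g by (auto simp: trilin_def Vector_Spaces.linear_iff)
  note T = mlin_tpure[OF vs]
  have b: "bilin s tscale (\<lambda>x y. tpure s (u @ x # y # w))" for u w
    using mlin_append_Cons[OF T, of u] mlin_append_Cons[OF T, of "u @ [x]" for x] by (intro bilinI) auto
  have ti: "tinsert s u (D x) w = (\<Sum>(y, z)\<leftarrow>cop x. tpure s (u @ [y, z] @ w))" for u x w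
  proof -
    have "tinsert s u (D x) w = tlift s tscale [UNIV, UNIV] (\<lambda>z. tpure s (u @ [z ! 0, z ! 1] @ w)) (D x)"
      unfolding tinsert_def by (rule fun_cong[OF tlift_cong]) (auto simp: set_Cons_def)
    also have "\<dots> = sweedler s tscale D (\<lambda>y z. tpure s (u @ [y, z] @ w)) x"
      by (simp add: sweedler_def)
    also have "\<dots> = (\<Sum>(y, z)\<leftarrow>cop x. tpure s (u @ [y, z] @ w))"
      by (rule sweedler_cop) (use b in simp)
    finally show ?thesis .
  qed
  have l1: "bilin s tscale (\<lambda>u z. \<Sum>(x, y)\<leftarrow>cop u. tpure s [x, y, z])"
    using b[of "[]"] mlin_append_Cons[OF T, of "[x, y]" for x y]
    by (intro bilinI lin_cop lin_sum_cop vector_space_tscale) (auto simp: bilin_def)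
  have l2: "bilin s tscale (\<lambda>x u. \<Sum>(y, z)\<leftarrow>cop u. tpure s [x, y, z])"
    using b[of "[x]" for x] mlin_append_Cons[OF T, of "[]"]
    by (intro bilinI lin_cop lin_sum_cop vector_space_tscale) (auto simp: bilin_def)
  have m: "multilinear_on s sV [UNIV, UNIV, UNIV] (\<lambda>z. g (z ! 0) (z ! 1) (z ! 2))"
    using g by (intro multilinear_on_3 linear_onI_linear) (auto simp: trilin_def bilin_def)
  \<comment> \<open>The iterated sums become single sums over words of length three, the form in
    which \<open>tlift\<close> can be evaluated.\<close>
  let ?L = "concat (map (\<lambda>(u, z). map (\<lambda>(x, y). [x, y, z]) (cop u)) (cop a))"
  let ?R = "concat (map (\<lambda>(x, u). map (\<lambda>(y, z). [x, y, z]) (cop u)) (cop a))"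
  have "(\<Sum>(u, z)\<leftarrow>cop a. \<Sum>(x, y)\<leftarrow>cop u. tpure s [x, y, z]) = (\<Sum>(x, u)\<leftarrow>cop a. \<Sum>(y, z)\<leftarrow>cop u. tpure s [x, y, z])"
    using coassoc[of a] by (simp add: ti sweedler_cop[OF l1] sweedler_cop[OF l2])
  then have "(\<Sum>w\<leftarrow>?L. tpure s w) = (\<Sum>w\<leftarrow>?R. tpure s w)"
    by (simp add: sum_list_concat_map comp_def case_prod_unfold)
  moreover have ev: "tlift s sV [UNIV, UNIV, UNIV] (\<lambda>z. g (z ! 0) (z ! 1) (z ! 2)) (\<Sum>w\<leftarrow>L. tpure s w)
      = (\<Sum>w\<leftarrow>L. g (w ! 0) (w ! 1) (w ! 2))" if "\<forall>w\<in>set L. length w = 3" for L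
  proof (rule tlift_sum_list[OF vs sV _ m])
    show "w \<in> listset [UNIV, UNIV, UNIV]" if "w \<in> set L" for w
      using \<open>\<forall>w\<in>set L. length w = 3\<close> that listset_replicate[of w 3 UNIV] by (simp add: numeral_3_eq_3)
  qed simp
  ultimately have "(\<Sum>w\<leftarrow>?L. g (w ! 0) (w ! 1) (w ! 2)) = (\<Sum>w\<leftarrow>?R. g (w ! 0) (w ! 1) (w ! 2))"
    using ev[of ?L] ev[of ?R] by (simp add: split_beta)
  then show ?thesis by (simp add: sum_list_concat_map comp_def case_prod_unfold)
qed

lemma lin_scale_left: "lin s s (\<lambda>x. s (\<epsilon> x) y)"
proof -
  show ?thesis using counit_linear by (simp add: Vector_Spaces.linear_iff scale_left_distrib)
qed

lemma lin_scale_right: "lin s s (\<lambda>y. s c y)"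
proof -
  show ?thesis by (simp add: Vector_Spaces.linear_iff vs scale_right_distrib scale_left_commute)
qed

lemma counit_left_cop:
  assumes g: "lin s sV g"
  shows "(\<Sum>(x, y)\<leftarrow>cop a. g (s (\<epsilon> x) y)) = g a"
proof -
  have "(\<Sum>(x, y)\<leftarrow>cop a. s (\<epsilon> x) y) = a"
    using counit_left[of a] by (simp add: sweedler_cop bilinI lin_scale_left lin_scale_right)
  then show ?thesis using sum_list_additive_prod[of g, OF lin_0[OF g] lin_plus[OF g]] by metis
qed

lemma counit_right_cop:
  assumes g: "lin s sV g"
  shows "(\<Sum>(x, y)\<leftarrow>cop a. g (s (\<epsilon> y) x)) = g a"
proof -
  have "(\<Sum>(x, y)\<leftarrow>cop a. s (\<epsilon> y) x) = a"
    using counit_right[of a] by (simp add: sweedler_cop bilinI lin_scale_left lin_scale_right)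
  then show ?thesis using sum_list_additive_prod[of g, OF lin_0[OF g] lin_plus[OF g]] by metis
qed

lemma antipode_left_cop:
  assumes g: "lin s sV g"
  shows "(\<Sum>(x, y)\<leftarrow>cop a. g (S x * y)) = g (s (\<epsilon> a) 1)"
proof -
  have "(\<Sum>(x, y)\<leftarrow>cop a. S x * y) = s (\<epsilon> a) 1"
    using antipode_left[of a] by (simp add: sweedler_cop bilinI lin_rules)
  then show ?thesis using sum_list_additive_prod[of g, OF lin_0[OF g] lin_plus[OF g]] by metis
qed

lemma antipode_right_cop:
  assumes g: "lin s sV g"
  shows "(\<Sum>(x, y)\<leftarrow>cop a. g (x * S y)) = g (s (\<epsilon> a) 1)"
proof -
  have "(\<Sum>(x, y)\<leftarrow>cop a. x * S y) = s (\<epsilon> a) 1"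
    using antipode_right[of a] by (simp add: sweedler_cop bilinI lin_rules)
  then show ?thesis using sum_list_additive_prod[of g, OF lin_0[OF g] lin_plus[OF g]] by metis
qed

text \<open>The value under a bilinear map depends only on the tensor \<open>D a\<close>, so a
  representative supplied by an axiom, as for \<open>1\<close> or for a product, may replace the
  chosen one.\<close>

lemma cop_eqI:
  assumes g: "bilin s sV g" and eq: "D a = (\<Sum>(x, y)\<leftarrow>L. tpure s [x, y])"
  shows "(\<Sum>(x, y)\<leftarrow>cop a. g x y) = (\<Sum>(x, y)\<leftarrow>L. g x y)"
proof -
  show ?thesis
    unfolding sweedler_cop[OF g, symmetric] sweedler_def eq
    by (rule bilin_sum_cop[OF g subspace_UNIV subspace_UNIV]) simp
qed

lemma cop_one: "bilin s sV g \<Longrightarrow> (\<Sum>(x, y)\<leftarrow>cop 1. g x y) = g 1 1"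
  using cop_eqI[of sV g 1 "[(1, 1)]"] by (simp add: comult_one)

lemma cop_mult:
  assumes g: "bilin s sV g"
  shows "(\<Sum>(x, y)\<leftarrow>cop (a * b). g x y) = (\<Sum>(x, y)\<leftarrow>cop a. \<Sum>(x', y')\<leftarrow>cop b. g (x * x') (y * y'))"
proof -
  note T = mlin_tpure[OF vs]
  have t: "lin s tscale (\<lambda>x. tpure s [x, y])" "lin s tscale (\<lambda>y. tpure s [x, y])" for x y
    using mlin_append_Cons[OF T, of "[]"] mlin_append_Cons[OF T, of "[x]"] by auto
  have "D (a * b) = (\<Sum>(x, y)\<leftarrow>cop a. \<Sum>(x', y')\<leftarrow>cop b. tpure s [x * x', y * y'])"
    unfolding comult_mult
    by (subst sweedler_cop; (subst sweedler_cop)?)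
       (auto intro!: bilinI lin_sum_cop vector_space_tscale lin_arg[OF t(1)] lin_arg[OF t(2)] lin_rules simp: sweedler_cop)
  also have "\<dots> = (\<Sum>(x, y)\<leftarrow>concat (map (\<lambda>(x, y). map (\<lambda>(x', y'). (x * x', y * y')) (cop b)) (cop a)). tpure s [x, y])"
    by (simp add: sum_list_concat_map comp_def case_prod_unfold)
  finally have eq: "D (a * b) = \<dots>" .
  show ?thesis
    by (subst cop_eqI[OF g eq]) (simp add: sum_list_concat_map comp_def case_prod_unfold)
qed

end

lemma sum_list_cong_prod:
  "(\<And>x y. (x, y) \<in> set xs \<Longrightarrow> f x y = g x y) \<Longrightarrow> (\<Sum>(x, y)\<leftarrow>xs. f x y) = (\<Sum>(x, y)\<leftarrow>xs. g x y)"
  by (rule sum_list_cong) auto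

section \<open>Antipode and adjoint action\<close>

context hopf_algebra begin

lemma antipode_one: "S 1 = 1"
  using antipode_left_cop[OF lin_ident, of 1] cop_one[OF bilinI, of s "\<lambda>x y. S x * y"]
  by (simp add: lin_rules counit_one)

text \<open>Uniqueness of convolution inverses: in \<open>?h\<close> the factor
  \<open>S (a1 * b1) * (a2 * b2)\<close> and the factor \<open>(a2 * b2) * S b3 * S a3\<close>
  overlap, and contracting either one leaves the other end.\<close>

lemma antipode_mult: "S (a * b) = S b * S a"
proof -
  let ?h = "\<lambda>a1 a2 a3 b1 b2 b3. S (a1 * b1) * (a2 * b2) * S b3 * S a3"
  have "(\<Sum>(u, a3)\<leftarrow>cop a. \<Sum>(a1, a2)\<leftarrow>cop u. \<Sum>(w, b3)\<leftarrow>cop b. \<Sum>(b1, b2)\<leftarrow>cop w. ?h a1 a2 a3 b1 b2 b3)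
      = (\<Sum>(u, a3)\<leftarrow>cop a. \<Sum>(w, b3)\<leftarrow>cop b. \<Sum>(a1, a2)\<leftarrow>cop u. \<Sum>(b1, b2)\<leftarrow>cop w. ?h a1 a2 a3 b1 b2 b3)"
    by (intro sum_list_cong_prod sum_list_swap_prod)
  also have "\<dots> = (\<Sum>(u, a3)\<leftarrow>cop a. \<Sum>(w, b3)\<leftarrow>cop b. \<Sum>(x, y)\<leftarrow>cop (u * w). S x * y * (S b3 * S a3))"
    by (intro sum_list_cong_prod, subst cop_mult) (auto intro!: bilinI lin_rules simp: mult.assoc)
  also have "\<dots> = (\<Sum>(u, a3)\<leftarrow>cop a. \<Sum>(w, b3)\<leftarrow>cop b. s (\<epsilon> (u * w)) 1 * (S b3 * S a3))"
    by (intro sum_list_cong_prod, subst antipode_left_cop) (auto intro!: lin_rules)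
  also have "\<dots> = (\<Sum>(u, a3)\<leftarrow>cop a. \<Sum>(w, b3)\<leftarrow>cop b. S (s (\<epsilon> w) b3) * S (s (\<epsilon> u) a3))"
    using antipode_linear
    by (intro sum_list_cong_prod) (simp add: counit_mult mult_scale_left mult_scale_right Vector_Spaces.linear_iff mult.commute)
  also have "\<dots> = (\<Sum>(u, a3)\<leftarrow>cop a. S b * S (s (\<epsilon> u) a3))"
    by (intro sum_list_cong_prod, subst counit_left_cop) (auto intro!: lin_rules)
  also have "\<dots> = S b * S a"
    by (subst counit_left_cop) (auto intro!: lin_rules)
  finally have 1: "(\<Sum>(u, a3)\<leftarrow>cop a. \<Sum>(a1, a2)\<leftarrow>cop u. \<Sum>(w, b3)\<leftarrow>cop b. \<Sum>(b1, b2)\<leftarrow>cop w. ?h a1 a2 a3 b1 b2 b3) = S b * S a" .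
  \<comment> \<open>The second evaluation regroups the coproduct of \<open>b\<close> so that
    \<open>b2 * S b3\<close> collapses, after which \<open>a2\<close> and \<open>S a3\<close> are
    adjacent and collapse in turn.\<close>
  have "(\<Sum>(u, a3)\<leftarrow>cop a. \<Sum>(a1, a2)\<leftarrow>cop u. \<Sum>(w, b3)\<leftarrow>cop b. \<Sum>(b1, b2)\<leftarrow>cop w. ?h a1 a2 a3 b1 b2 b3)
      = (\<Sum>(u, a3)\<leftarrow>cop a. \<Sum>(a1, a2)\<leftarrow>cop u. \<Sum>(b1, w)\<leftarrow>cop b. \<Sum>(b2, b3)\<leftarrow>cop w. ?h a1 a2 a3 b1 b2 b3)"
    by (intro sum_list_cong_prod coassoc_cop[where sV = s] trilinI lin_rules)
  also have "\<dots> = (\<Sum>(u, a3)\<leftarrow>cop a. \<Sum>(a1, a2)\<leftarrow>cop u. \<Sum>(b1, w)\<leftarrow>cop b. \<Sum>(b2, b3)\<leftarrow>cop w. S (a1 * b1) * a2 * (b2 * S b3) * S a3)"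
    by (simp add: mult.assoc)
  also have "\<dots> = (\<Sum>(u, a3)\<leftarrow>cop a. \<Sum>(a1, a2)\<leftarrow>cop u. \<Sum>(b1, w)\<leftarrow>cop b. S (a1 * b1) * a2 * s (\<epsilon> w) 1 * S a3)"
    by (intro sum_list_cong_prod, subst antipode_right_cop) (auto intro!: lin_rules)
  also have "\<dots> = (\<Sum>(u, a3)\<leftarrow>cop a. \<Sum>(a1, a2)\<leftarrow>cop u. \<Sum>(b1, w)\<leftarrow>cop b. S (a1 * s (\<epsilon> w) b1) * a2 * S a3)"
    using antipode_linear
    by (intro sum_list_cong_prod) (simp add: mult_scale_left mult_scale_right Vector_Spaces.linear_iff)
  also have "\<dots> = (\<Sum>(u, a3)\<leftarrow>cop a. \<Sum>(a1, a2)\<leftarrow>cop u. S (a1 * b) * a2 * S a3)"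
    by (intro sum_list_cong_prod, subst counit_right_cop) (auto intro!: lin_rules)
  also have "\<dots> = (\<Sum>(a1, u)\<leftarrow>cop a. \<Sum>(a2, a3)\<leftarrow>cop u. S (a1 * b) * a2 * S a3)"
    by (intro coassoc_cop[where sV = s] trilinI lin_rules)
  also have "\<dots> = (\<Sum>(a1, u)\<leftarrow>cop a. \<Sum>(a2, a3)\<leftarrow>cop u. S (a1 * b) * (a2 * S a3))"
    by (simp add: mult.assoc)
  also have "\<dots> = (\<Sum>(a1, u)\<leftarrow>cop a. S (a1 * b) * s (\<epsilon> u) 1)"
    by (intro sum_list_cong_prod, subst antipode_right_cop) (auto intro!: lin_rules)
  also have "\<dots> = (\<Sum>(a1, u)\<leftarrow>cop a. S (s (\<epsilon> u) a1 * b))"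
    using antipode_linear
    by (intro sum_list_cong_prod) (simp add: mult_scale_left mult_scale_right Vector_Spaces.linear_iff)
  also have "\<dots> = S (a * b)"
    by (subst counit_right_cop) (auto intro!: lin_rules)
  finally show ?thesis using 1 by simp
qed

abbreviation ad :: "'a \<Rightarrow> 'a \<Rightarrow> 'a" where "ad \<equiv> adj s D S"

lemma ad_cop: "ad a b = (\<Sum>(x, y)\<leftarrow>cop a. S x * b * y)"
  unfolding adj_def by (intro sweedler_cop bilinI lin_rules)

lemma lin_ad1: "lin s s f \<Longrightarrow> lin s s (\<lambda>x. ad (f x) b)"
  unfolding ad_cop by (rule lin_arg[OF lin_cop]) (intro bilinI lin_rules)

lemma lin_ad2: "lin s s f \<Longrightarrow> lin s s (\<lambda>x. ad a (f x))"
  unfolding ad_cop by (intro lin_sum_cop vs lin_rules)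

lemma lin_image_ad: "lin s sV h \<Longrightarrow> h (ad a b) = (\<Sum>(x, y)\<leftarrow>cop a. h (S x * b * y))"
  unfolding ad_cop by (intro sum_list_additive_prod lin_0 lin_plus)

lemma ad_one_left: "ad 1 b = b"
  unfolding ad_cop by (subst cop_one[where sV = s]) (auto intro!: bilinI lin_rules simp: antipode_one)

lemma ad_one_right: "ad a 1 = s (\<epsilon> a) 1"
  unfolding ad_cop using antipode_left_cop[OF lin_ident] by simp

text \<open>\<open>ad\<close> is a right action because \<open>S\<close> reverses products.\<close>

lemma ad_mult_left: "ad (a * b) c = ad b (ad a c)"
proof -
  have "ad (a * b) c = (\<Sum>(x, y)\<leftarrow>cop a. \<Sum>(x', y')\<leftarrow>cop b. S x' * (S x * c * y) * y')"
    unfolding ad_cop by (subst cop_mult[where sV = s], intro bilinI lin_rules, intro sum_list_cong_prod) (simp add: antipode_mult mult.assoc)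
  also have "\<dots> = (\<Sum>(x', y')\<leftarrow>cop b. \<Sum>(x, y)\<leftarrow>cop a. S x' * (S x * c * y) * y')"
    by (rule sum_list_swap_prod)
  also have "\<dots> = (\<Sum>(x', y')\<leftarrow>cop b. S x' * ad a c * y')"
    by (intro sum_list_cong_prod lin_image_ad[symmetric, where sV = s] lin_rules)
  finally show ?thesis by (simp add: ad_cop[of b])
qed

text \<open>The module algebra property of \<open>ad\<close>: between \<open>ad x b\<close> and
  \<open>ad y c\<close> the inner factors \<open>x2 * S y1\<close> collapse by the antipode. The map
  \<open>h\<close> is carried along because the identity is applied inside larger linear
  expressions.\<close>

lemma ad_mult_right:
  assumes h: "lin s sV h"
  shows "h (ad a (b * c)) = (\<Sum>(x, y)\<leftarrow>cop a. h (ad x b * ad y c))"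
proof -
  have "(\<Sum>(x, y)\<leftarrow>cop a. ad x b * ad y c) = (\<Sum>(x, y)\<leftarrow>cop a. \<Sum>(x1, x2)\<leftarrow>cop x. S x1 * b * x2 * ad y c)"
    by (intro sum_list_cong_prod lin_image_ad[where sV = s] lin_rules)
  also have "\<dots> = (\<Sum>(x1, u)\<leftarrow>cop a. \<Sum>(x2, y)\<leftarrow>cop u. S x1 * b * x2 * ad y c)"
    by (intro coassoc_cop[where sV = s] trilinI lin_ad1 lin_rules)
  also have "\<dots> = (\<Sum>(x1, u)\<leftarrow>cop a. \<Sum>(x2, y)\<leftarrow>cop u. \<Sum>(y1, y2)\<leftarrow>cop y. S x1 * b * x2 * (S y1 * c * y2))"
    by (intro sum_list_cong_prod lin_image_ad[where sV = s] lin_rules)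
  \<comment> \<open>This regrouping makes \<open>x2\<close> and \<open>y1\<close> the two legs of
    one coproduct.\<close>
  also have "\<dots> = (\<Sum>(x1, u)\<leftarrow>cop a. \<Sum>(v, y2)\<leftarrow>cop u. \<Sum>(x2, y1)\<leftarrow>cop v. S x1 * b * x2 * (S y1 * c * y2))"
    by (intro sum_list_cong_prod coassoc_cop[where sV = s, symmetric] trilinI lin_rules)
  also have "\<dots> = (\<Sum>(x1, u)\<leftarrow>cop a. \<Sum>(v, y2)\<leftarrow>cop u. \<Sum>(x2, y1)\<leftarrow>cop v. S x1 * b * (x2 * S y1) * c * y2)"
    by (simp add: mult.assoc)
  also have "\<dots> = (\<Sum>(x1, u)\<leftarrow>cop a. \<Sum>(v, y2)\<leftarrow>cop u. S x1 * b * s (\<epsilon> v) 1 * c * y2)"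
    by (intro sum_list_cong_prod, subst antipode_right_cop) (auto intro!: lin_rules)
  also have "\<dots> = (\<Sum>(x1, u)\<leftarrow>cop a. \<Sum>(v, y2)\<leftarrow>cop u. S x1 * b * c * s (\<epsilon> v) y2)"
    by (simp add: mult_scale_left mult_scale_right)
  also have "\<dots> = (\<Sum>(x1, u)\<leftarrow>cop a. S x1 * b * c * u)"
    by (intro sum_list_cong_prod, subst counit_left_cop) (auto intro!: lin_rules)
  also have "\<dots> = ad a (b * c)" by (simp add: ad_cop mult.assoc)
  finally show ?thesis using sum_list_additive_prod[of h, OF lin_0[OF h] lin_plus[OF h]] by metis
qed


section \<open>The braiding on letters\<close>

text \<open>\<open>\<sigma>(a \<otimes> b)\<close> as a formal sum of pairs.\<close>

definition br :: "'a \<Rightarrow> 'a \<Rightarrow> ('a \<times> 'a) list"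
  where "br a b = map (\<lambda>(x, y). (x, ad y a)) (cop b)"

lemma sum_br: "(\<Sum>(x, y)\<leftarrow>br a b. g x y) = (\<Sum>(x, y)\<leftarrow>cop b. g x (ad y a))"
  by (simp add: br_def comp_def case_prod_unfold)

lemma bilin_ad:
  assumes g: "bilin s sV g" shows "bilin s sV (\<lambda>x y. g x (ad y a))"
  by (intro bilinI lin_arg[OF bilin2[OF g]] lin_ad1 lin_ident bilin1[OF g])

lemma lin_br1:
  assumes g: "bilin s sV g" shows "lin s sV (\<lambda>a. \<Sum>(x, y)\<leftarrow>br a b. g x y)"
  unfolding sum_br using g
  by (intro lin_sum_cop lin_arg[OF bilin2[OF g]] lin_ad2 lin_ident) (auto simp: bilin_def Vector_Spaces.linear_iff)

lemma lin_br2: "bilin s sV g \<Longrightarrow> lin s sV (\<lambda>b. \<Sum>(x, y)\<leftarrow>br a b. g x y)"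
  unfolding sum_br by (intro lin_cop bilin_ad)

text \<open>\<open>ad y 1\<close> is the scalar \<open>\<epsilon> y\<close>, which the counit axiom
  absorbs into the other leg.\<close>

lemma br_one_left:
  assumes g: "bilin s sV g"
  shows "(\<Sum>(x, y)\<leftarrow>br 1 b. g x y) = g b 1"
proof -
  have "(\<Sum>(x, y)\<leftarrow>br 1 b. g x y) = (\<Sum>(x, y)\<leftarrow>cop b. g (s (\<epsilon> y) x) 1)"
    using bilin1[OF g] bilin2[OF g] by (simp add: sum_br ad_one_right Vector_Spaces.linear_iff)
  also have "\<dots> = g b 1" by (rule counit_right_cop[OF bilin1[OF g]])
  finally show ?thesis .
qed

lemma br_one_right: "bilin s sV g \<Longrightarrow> (\<Sum>(x, y)\<leftarrow>br a 1. g x y) = g 1 a"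
  unfolding sum_br by (subst cop_one[OF bilin_ad]) (auto simp: ad_one_left)

text \<open>\<open>\<mu> \<circ> \<sigma> = \<mu>\<close> is what makes the mixed terms of the shuffles cancel.\<close>

lemma br_mult:
  assumes h: "lin s sV h"
  shows "(\<Sum>(x, y)\<leftarrow>br a b. h (x * y)) = h (a * b)"
proof -
  note l = lin_arg[OF h]
  have "(\<Sum>(x, y)\<leftarrow>br a b. h (x * y)) = (\<Sum>(x, u)\<leftarrow>cop b. \<Sum>(y, z)\<leftarrow>cop u. h (x * (S y * a * z)))"
    unfolding sum_br by (intro sum_list_cong_prod lin_image_ad[where sV = sV] l lin_rules)
  \<comment> \<open>Regrouping makes \<open>x\<close> and \<open>y\<close> the two legs of one
    coproduct, so that \<open>x * S y\<close> collapses and leaves \<open>a * b\<close>.\<close>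
  also have "\<dots> = (\<Sum>(u, z)\<leftarrow>cop b. \<Sum>(x, y)\<leftarrow>cop u. h (x * (S y * a * z)))"
    by (intro coassoc_cop[where sV = sV, symmetric] trilinI l lin_rules)
  also have "\<dots> = (\<Sum>(u, z)\<leftarrow>cop b. \<Sum>(x, y)\<leftarrow>cop u. h (x * S y * (a * z)))"
    by (simp add: mult.assoc)
  also have "\<dots> = (\<Sum>(u, z)\<leftarrow>cop b. h (s (\<epsilon> u) 1 * (a * z)))"
    by (intro sum_list_cong_prod antipode_right_cop[where sV = sV] l lin_rules)
  also have "\<dots> = (\<Sum>(u, z)\<leftarrow>cop b. h (a * s (\<epsilon> u) z))"
    by (simp add: mult_scale_left mult_scale_right)
  also have "\<dots> = h (a * b)"
    by (intro counit_left_cop[where sV = sV] l lin_rules)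
  finally show ?thesis .
qed

text \<open>The letter \<open>b\<close> comes from the right and crosses \<open>a'\<close> before
  \<open>a\<close>; that this agrees with crossing the product is the module algebra property of
  \<open>ad\<close> and coassociativity.\<close>

lemma br_mult_left:
  assumes g: "bilin s sV g"
  shows "(\<Sum>(x, y)\<leftarrow>br (a * a') b. g x y) = (\<Sum>(u, z)\<leftarrow>br a' b. \<Sum>(x, y)\<leftarrow>br a u. g x (y * z))"
proof -
  note l = lin_arg[OF bilin2[OF g]] bilin1[OF g]
  have "(\<Sum>(x, y)\<leftarrow>br (a * a') b. g x y) = (\<Sum>(x, u)\<leftarrow>cop b. \<Sum>(y, z)\<leftarrow>cop u. g x (ad y a * ad z a'))"
    unfolding sum_br by (intro sum_list_cong_prod ad_mult_right[where sV = sV] bilin2[OF g])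
  also have "\<dots> = (\<Sum>(u, z)\<leftarrow>cop b. \<Sum>(x, y)\<leftarrow>cop u. g x (ad y a * ad z a'))"
    by (intro coassoc_cop[where sV = sV, symmetric] trilinI l lin_ad1 lin_rules)
  finally show ?thesis by (simp add: sum_br)
qed

text \<open>Multiplicativity of the coproduct gives the product of the left outputs, and
  \<open>ad\<close> being a right action gives the successive crossings with \<open>b\<close> and
  \<open>b'\<close>.\<close>

lemma br_mult_right:
  assumes g: "bilin s sV g"
  shows "(\<Sum>(x, y)\<leftarrow>br a (b * b'). g x y) = (\<Sum>(x, z)\<leftarrow>br a b. \<Sum>(x', y)\<leftarrow>br z b'. g (x * x') y)"
  unfolding sum_br by (subst cop_mult[OF bilin_ad[OF g]]) (simp add: ad_mult_left)

end

text \<open>The sign \<open>(-1) ^ k\<close> without scalars, so that it makes sense in any abelian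
  group, in particular for function-valued cochains.\<close>

definition alt :: "nat \<Rightarrow> 'v::ab_group_add \<Rightarrow> 'v"
  where "alt k v = (if even k then v else - v)"

lemma alt_0 [simp]: "alt 0 v = v" by (simp add: alt_def)
lemma alt_Suc [simp]: "alt (Suc k) v = - alt k v" by (simp add: alt_def)
lemma alt_zero [simp]: "alt k 0 = 0" by (simp add: alt_def)
lemma alt_plus: "alt k (v + v') = alt k v + alt k v'" by (simp add: alt_def)
lemma alt_minus: "alt k (- v) = - alt k v" by (simp add: alt_def)
lemma alt_diff: "alt k (v - v') = alt k v - alt k v'" by (simp add: alt_def)
lemma alt_alt: "alt k (alt j v) = alt (k + j) v" by (simp add: alt_def)
lemma alt_same [simp]: "alt k (alt k v) = v" by (simp add: alt_def)
lemma alt_sum: "alt k (sum f I) = (\<Sum>i\<in>I. alt k (f i))" by (simp add: alt_def sum_negf)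
lemma alt_sum_list: "alt k (\<Sum>(i, j)\<leftarrow>I. f i j) = (\<Sum>(i, j)\<leftarrow>I. alt k (f i j))"
  by (rule sum_list_additive_prod) (auto simp: alt_plus)

lemma alt_scale: "vector_space sV \<Longrightarrow> sV ((-1) ^ k) v = alt k v"
proof -
  assume "vector_space sV"
  then interpret vector_space sV .
  show ?thesis by (simp add: alt_def)
qed

lemma lin_alt: "lin s sV f \<Longrightarrow> lin s sV (\<lambda>x. alt k (f x))"
  by (cases "even k") (auto simp: alt_def lin_uminus)

lemma additive_alt: "h 0 = 0 \<Longrightarrow> (\<And>x y. h (x + y) = h x + h y) \<Longrightarrow> h (alt k v) = alt k (h v)"
  by (metis alt_def add_eq_0_iff add.right_inverse)

lemma additive_sum: "h 0 = 0 \<Longrightarrow> (\<And>x y. h (x + y) = h x + h y) \<Longrightarrow> h (sum f I) = (\<Sum>i\<in>I. h (f i))"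
  by (induction I rule: infinite_finite_induct) auto

lemma sum_list_prod_add:
  fixes f :: "'b \<Rightarrow> 'c \<Rightarrow> 'v::comm_monoid_add"
  shows "(\<Sum>(x, y)\<leftarrow>xs. f x y + g x y) = (\<Sum>(x, y)\<leftarrow>xs. f x y) + (\<Sum>(x, y)\<leftarrow>xs. g x y)"
  by (simp add: case_prod_unfold sum_list_addf)

lemma sum_list_prod_minus:
  fixes f :: "'b \<Rightarrow> 'c \<Rightarrow> 'v::ab_group_add"
  shows "(\<Sum>(x, y)\<leftarrow>xs. - f x y) = - (\<Sum>(x, y)\<leftarrow>xs. f x y)"
  by (induction xs) auto

lemma sum_list_prod_zero: "(\<And>x y. (x, y) \<in> set xs \<Longrightarrow> f x y = 0) \<Longrightarrow> (\<Sum>(x, y)\<leftarrow>xs. f x y) = (0::'v::monoid_add)"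
  by (induction xs) auto

lemma sum_list_prod_sum:
  fixes f :: "'b \<Rightarrow> 'c \<Rightarrow> 'i \<Rightarrow> 'v::comm_monoid_add"
  shows "(\<Sum>(x, y)\<leftarrow>xs. \<Sum>i\<in>I. f x y i) = (\<Sum>i\<in>I. \<Sum>(x, y)\<leftarrow>xs. f x y i)"
  by (induction xs) (auto simp: sum.distrib)


section \<open>The bar differential\<close>

lemma merge_Cons [simp]: "merge (Suc (Suc i)) (x # w) = x # merge (Suc i) w"
  by (simp add: merge_def)

lemma merge_hd [simp]: "merge (Suc 0) (x # y # w) = x * y # w"
  by (simp add: merge_def)

lemma length_merge: "0 < i \<Longrightarrow> i < length w \<Longrightarrow> length (merge i w) = length w - 1"
  by (simp add: merge_def)

lemma merge_append: "merge (Suc (length u)) (u @ x # y # v) = u @ (x * y) # v"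
  by (simp add: merge_def nth_append)

lemma split_at_pair:
  assumes "0 < i" "i < length w"
  obtains u x y v where "w = u @ x # y # v" "i = Suc (length u)"
proof
  show "w = take (i - 1) w @ w ! (i - 1) # w ! i # drop (i + 1) w"
    using assms by (metis Cons_nth_drop_Suc Suc_eq_plus1 Suc_pred' append_take_drop_id less_imp_diff_less)
  show "i = Suc (length (take (i - 1) w))" using assms by simp
qed

text \<open>The inner faces of the Hochschild differential. They involve only the product of
  letters, so one definition serves for coefficients in \<open>M\<close> and in function spaces; the
  outer faces are added in \<open>hdiff\<close>.\<close>

definition bd :: "('a::times list \<Rightarrow> 'v::ab_group_add) \<Rightarrow> 'a list \<Rightarrow> 'v"
  where "bd g w = (\<Sum>i = 1..<length w. alt i (g (merge i w)))"

lemma bd_Nil [simp]: "bd g [] = 0" by (simp add: bd_def)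
lemma bd_single [simp]: "bd g [x] = 0" by (simp add: bd_def)

text \<open>Stripping the first letter shifts the numbering of the remaining faces by one, whence
  the second minus sign.\<close>

lemma bd_Cons2 [simp]: "bd g (x # y # w) = - g (x * y # w) - bd (\<lambda>v. g (x # v)) (y # w)"
proof -
  have "bd g (x # y # w) = (\<Sum>i = Suc 0..<Suc (Suc (length w)). alt i (g (merge i (x # y # w))))"
    by (simp add: bd_def)
  also have "\<dots> = - g (x * y # w) + (\<Sum>i = Suc (Suc 0)..<Suc (Suc (length w)). alt i (g (merge i (x # y # w))))"
    by (subst sum.atLeast_Suc_lessThan) auto
  also have "(\<Sum>i = Suc (Suc 0)..<Suc (Suc (length w)). alt i (g (merge i (x # y # w))))
      = (\<Sum>i = Suc 0..<Suc (length w). alt (Suc i) (g (merge (Suc i) (x # y # w))))"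
    by (subst sum.shift_bounds_Suc_ivl) simp
  also have "\<dots> = - bd (\<lambda>v. g (x # v)) (y # w)"
    unfolding bd_def sum_negf[symmetric]
  proof (rule sum.cong)
    fix i assume "i \<in> {1..<length (y # w)}"
    then obtain j where "i = Suc j" by (cases i) auto
    then show "alt (Suc i) (g (merge (Suc i) (x # y # w))) = - alt i (g (x # merge i (y # w)))" by simp
  qed auto
  finally show ?thesis by simp
qed

lemma bd_cong: "(\<And>v. v \<noteq> [] \<Longrightarrow> Suc (length v) = length w \<Longrightarrow> g v = g' v) \<Longrightarrow> bd g w = bd g' w"
  unfolding bd_def by (intro sum.cong refl arg_cong[where f = "alt _"]) (auto simp: length_merge merge_def)

lemma bd_add: "bd (\<lambda>v. g v + g' v) w = bd g w + bd g' w"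
  by (simp add: bd_def alt_plus sum.distrib)

lemma bd_alt: "bd (\<lambda>v. alt k (g v)) w = alt k (bd g w)"
  by (simp add: bd_def alt_sum alt_alt add.commute)

lemma bd_minus: "bd (\<lambda>v. - g v) w = - bd g w"
  by (simp add: bd_def alt_minus sum_negf)

lemma bd_additive:
  assumes "h 0 = 0" "\<And>x y. h (x + y) = h x + h y"
  shows "h (bd g w) = bd (\<lambda>v. h (g v)) w"
  by (simp add: bd_def additive_sum[of h, OF assms] additive_alt[of h, OF assms])

text \<open>For a function that treats the first letter apart, only the first face multiplies into
  that letter; the others stay in the tail.\<close>

lemma bd_hd_tl: "bd (\<lambda>v. K (hd v) (tl v)) (b # w) = (if w = [] then 0 else - K (b * hd w) (tl w)) - bd (K b) w"
  by (cases w) auto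

lemma bd_snoc: "bd g (w @ [x, y]) = bd (\<lambda>v. g (v @ [y])) (w @ [x]) - alt (length w) (g (w @ [x * y]))"
proof (induction w arbitrary: g)
  case (Cons c w)
  show ?case
  proof (cases w)
    case (Cons d v)
    then show ?thesis using Cons.IH[of "\<lambda>v. g (c # v)"] by simp
  qed simp
qed simp

lemma bd_last_butlast:
  "bd (\<lambda>v. K (butlast v) (last v)) (w @ [b]) =
    bd (\<lambda>v. K v b) w + (if w = [] then 0 else alt (length w) (K (butlast w) (last w * b)))"
proof (cases w rule: rev_exhaust)
  case (snoc v c)
  then show ?thesis by (simp add: bd_snoc)
qed simp

text \<open>With the first letter \<open>x\<close> split off, the double faces that multiply into
  \<open>x\<close> once cancel in pairs, those that do so twice agree by associativity, and the rest
  is the statement for the tail.\<close>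

lemma bd_bd:
  fixes w :: "'a::semigroup_mult list"
  shows "bd (bd g) w = 0"
proof (induction "length w" arbitrary: w g rule: less_induct)
  case less
  consider "w = []" | x where "w = [x]" | x y where "w = [x, y]" | x y z v where "w = x # y # z # v"
    by (metis list.exhaust)
  then show ?case
  proof cases
    case (4 x y z v)
    have "bd (bd g) w = g (x * y * z # v) + bd (\<lambda>v. g (x * y # v)) (z # v) - bd (\<lambda>v. bd g (x # v)) (y # z # v)"
      using 4 by simp
    \<comment> \<open>\<open>hd\<close> and \<open>tl\<close> are harmless, since \<open>bd\<close>
      evaluates its argument at nonempty words only.\<close>
    also have "bd (\<lambda>v. bd g (x # v)) (y # z # v)
        = bd (\<lambda>v. - g (x * hd v # tl v) + - bd (\<lambda>u. g (x # u)) v) (y # z # v)"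
    proof (rule bd_cong)
      fix u :: "'a list" assume "u \<noteq> []" "Suc (length u) = length (y # z # v)"
      then show "bd g (x # u) = - g (x * hd u # tl u) + - bd (\<lambda>u. g (x # u)) u" by (cases u) auto
    qed
    also have "\<dots> = - bd (\<lambda>v. g (x * hd v # tl v)) (y # z # v) - bd (bd (\<lambda>u. g (x # u))) (y # z # v)"
      unfolding bd_add bd_minus by simp
    also have "bd (bd (\<lambda>u. g (x # u))) (y # z # v) = 0"
      using less[of "y # z # v"] 4 by simp
    finally show ?thesis by (simp add: mult.assoc)
  qed auto
qed


section \<open>Letters passing through words\<close>

context hopf_algebra begin

text \<open>\<open>pl bs a\<close> is \<open>\<sigma>\<^sub>1 \<cdots> \<sigma>\<^sub>q(bs \<otimes> a) \<in> A \<otimes> A\<^sup>\<otimes>\<^sup>q\<close>, and \<open>pr as b\<close> is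
  \<open>\<sigma>\<^sub>p \<cdots> \<sigma>\<^sub>1(b \<otimes> as) \<in> A\<^sup>\<otimes>\<^sup>p \<otimes> A\<close>.\<close>

primrec pl :: "'a list \<Rightarrow> 'a \<Rightarrow> ('a \<times> 'a list) list" where
  "pl [] a = [(a, [])]"
| "pl (b # bs) a = concat (map (\<lambda>(x, w). map (\<lambda>(x', y). (x', y # w)) (br b x)) (pl bs a))"

primrec pr :: "'a list \<Rightarrow> 'a \<Rightarrow> ('a list \<times> 'a) list" where
  "pr [] b = [([], b)]"
| "pr (a # as) b = concat (map (\<lambda>(x, y). map (\<lambda>(v, z). (x # v, z)) (pr as y)) (br b a))"

lemma sum_pl_Cons: "(\<Sum>(x, w)\<leftarrow>pl (b # bs) a. g x w) = (\<Sum>(x, w)\<leftarrow>pl bs a. \<Sum>(x', y)\<leftarrow>br b x. g x' (y # w))"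
  by (simp add: sum_list_concat_prod sum_list_concat_map comp_def case_prod_unfold)

lemma sum_pr_Cons: "(\<Sum>(v, z)\<leftarrow>pr (a # as) b. g v z) = (\<Sum>(x, y)\<leftarrow>br b a. \<Sum>(v, z)\<leftarrow>pr as y. g (x # v) z)"
  by (simp add: sum_list_concat_prod sum_list_concat_map comp_def case_prod_unfold)

declare pl.simps(2) [simp del] pr.simps(2) [simp del]

text \<open>\<open>pl\<close> recurses on the front of the word although \<open>a\<close> meets the
  last letter first; this form exposes that first crossing.\<close>

lemma sum_pl_snoc:
  "(\<Sum>(x, w)\<leftarrow>pl (bs @ [b]) a. g x w) = (\<Sum>(u, y)\<leftarrow>br b a. \<Sum>(x, w)\<leftarrow>pl bs u. g x (w @ [y]))"
  by (induction bs arbitrary: g) (simp_all add: sum_pl_Cons)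

lemma sum_pr_snoc:
  "(\<Sum>(v, z)\<leftarrow>pr (as @ [a]) b. g v z) = (\<Sum>(v, y)\<leftarrow>pr as b. \<Sum>(x, z)\<leftarrow>br y a. g (v @ [x]) z)"
  by (induction as arbitrary: g b) (simp_all add: sum_pr_Cons)

lemma length_pl: "(x, w) \<in> set (pl bs a) \<Longrightarrow> length w = length bs"
  by (induction bs arbitrary: x w) (auto simp: pl.simps(2))

lemma length_pr: "(v, z) \<in> set (pr as b) \<Longrightarrow> length v = length as"
proof (induction as arbitrary: v z b)
  case (Cons a as)
  then show ?case by (fastforce simp: pr.simps(2))
qed simp

end

text \<open>Functionals on a letter followed by a word, the shape of the output of
  \<open>pl\<close>; \<open>rmlin\<close> is the mirror image for \<open>pr\<close>.\<close>

definition lmlin :: "('k::field \<Rightarrow> 'a::ab_group_add \<Rightarrow> 'a) \<Rightarrow> ('k \<Rightarrow> 'v::ab_group_add \<Rightarrow> 'v) \<Rightarrow> ('a \<Rightarrow> 'a list \<Rightarrow> 'v) \<Rightarrow> bool"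
  where "lmlin s sV h \<longleftrightarrow> (\<forall>w. lin s sV (\<lambda>x. h x w)) \<and> (\<forall>x. mlin s sV (h x))"

definition rmlin :: "('k::field \<Rightarrow> 'a::ab_group_add \<Rightarrow> 'a) \<Rightarrow> ('k \<Rightarrow> 'v::ab_group_add \<Rightarrow> 'v) \<Rightarrow> ('a list \<Rightarrow> 'a \<Rightarrow> 'v) \<Rightarrow> bool"
  where "rmlin s sV h \<longleftrightarrow> (\<forall>v. lin s sV (h v)) \<and> (\<forall>y. mlin s sV (\<lambda>v. h v y))"

lemma lmlinI: "(\<And>w. lin s sV (\<lambda>x. h x w)) \<Longrightarrow> (\<And>x. mlin s sV (h x)) \<Longrightarrow> lmlin s sV h"
  by (simp add: lmlin_def)

lemma rmlinI: "(\<And>v. lin s sV (h v)) \<Longrightarrow> (\<And>y. mlin s sV (\<lambda>v. h v y)) \<Longrightarrow> rmlin s sV h"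
  by (simp add: rmlin_def)

lemma mlinI: "(\<And>u v. lin s sV (\<lambda>x. g (u @ x # v))) \<Longrightarrow> mlin s sV g"
  by (simp add: mlin_def)

lemma mlin_sum_list_prod:
  "vector_space s \<Longrightarrow> vector_space sV \<Longrightarrow> (\<And>x y. mlin s sV (g x y)) \<Longrightarrow> mlin s sV (\<lambda>w. \<Sum>(x, y)\<leftarrow>L. g x y w)"
  unfolding mlin_def by (intro allI lin_sum_list_prod) auto

lemma lmlin_bilin: "lmlin s sV h \<Longrightarrow> bilin s sV (\<lambda>x y. h x (u @ y # v))"
  by (simp add: lmlin_def bilin_def mlin_def)

lemma lmlin_vs: "lmlin s sV h \<Longrightarrow> vector_space sV"
  by (auto simp: lmlin_def Vector_Spaces.linear_iff)

lemma rmlin_bilin: "rmlin s sV h \<Longrightarrow> bilin s sV (\<lambda>x y. h (u @ x # v) y)"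
  by (simp add: rmlin_def bilin_def mlin_def)

lemma rmlin_vs: "rmlin s sV h \<Longrightarrow> vector_space sV"
  by (auto simp: rmlin_def Vector_Spaces.linear_iff)

context hopf_algebra begin

section \<open>Multilinearity of the two passages\<close>

lemma lmlin_br:
  assumes h: "lmlin s sV h"
  shows "lmlin s sV (\<lambda>x w. \<Sum>(x', y)\<leftarrow>br b x. h x' (y # w))"
  using lmlin_bilin[OF h, of "[]"] h
  by (intro lmlinI lin_br2 mlin_sum_list_prod vs lmlin_vs[OF h] mlin_Cons) (auto simp: lmlin_def)

lemma lin_pl: "lmlin s sV h \<Longrightarrow> lin s sV (\<lambda>a. \<Sum>(x, w)\<leftarrow>pl bs a. h x w)"
proof (induction bs arbitrary: h)
  case Nil
  then show ?case by (simp add: lmlin_def)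
next
  case (Cons b bs)
  show ?case unfolding sum_pl_Cons by (rule Cons.IH[OF lmlin_br[OF Cons.prems]])
qed

lemma mlin_pl:
  assumes "lmlin s sV h"
  shows "mlin s sV (\<lambda>bs. \<Sum>(x, w)\<leftarrow>pl bs a. h x w)"
proof (rule mlinI)
  fix u v
  show "lin s sV (\<lambda>c. \<Sum>(x, w)\<leftarrow>pl (u @ c # v) a. h x w)"
    using assms
  proof (induction u arbitrary: h)
    case Nil
    show ?case using lmlin_bilin[OF Nil, of "[]"] unfolding append_Nil sum_pl_Cons
      by (intro lin_sum_cop lin_br1 lmlin_vs[OF Nil]) auto
  next
    case (Cons b u)
    show ?case unfolding append_Cons sum_pl_Cons by (rule Cons.IH[OF lmlin_br[OF Cons.prems]])
  qed
qed

lemma rmlin_pr_step: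
  assumes h: "rmlin s sV h"
  shows "rmlin s sV (\<lambda>v. h (x # v))"
  using h by (auto simp: rmlin_def intro: mlin_Cons)

lemma lin_pr: "rmlin s sV h \<Longrightarrow> lin s sV (\<lambda>b. \<Sum>(v, z)\<leftarrow>pr as b. h v z)"
proof (induction as arbitrary: h)
  case Nil
  then show ?case by (simp add: rmlin_def)
next
  case (Cons a as)
  have "lin s sV (\<lambda>x. h (x # v) z)" for v z using rmlin_bilin[OF Cons.prems, of "[]"] by (simp add: bilin_def)
  then show ?case unfolding sum_pr_Cons
    by (intro lin_br1 bilinI lin_sum_cop rmlin_vs[OF Cons.prems] Cons.IH rmlin_pr_step[OF Cons.prems])
qed

lemma bilin_pr:
  assumes h: "rmlin s sV h"
  shows "bilin s sV (\<lambda>x y. \<Sum>(v, z)\<leftarrow>pr as y. h (x # v) z)"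
  using rmlin_bilin[OF h, of "[]"]
  by (intro bilinI lin_sum_cop rmlin_vs[OF h] lin_pr rmlin_pr_step[OF h]) (auto simp: bilin_def)

lemma mlin_pr:
  assumes "rmlin s sV h"
  shows "mlin s sV (\<lambda>as. \<Sum>(v, z)\<leftarrow>pr as b. h v z)"
proof (rule mlinI)
  fix u v
  show "lin s sV (\<lambda>c. \<Sum>(x, w)\<leftarrow>pr (u @ c # v) b. h x w)"
    using assms
  proof (induction u arbitrary: h b)
    case Nil
    show ?case unfolding append_Nil sum_pr_Cons by (rule lin_br2[OF bilin_pr[OF Nil]])
  next
    case (Cons a u)
    show ?case unfolding append_Cons sum_pr_Cons
      by (intro lin_sum_cop rmlin_vs[OF Cons.prems] Cons.IH[OF rmlin_pr_step[OF Cons.prems]])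
  qed
qed

text \<open>Iterates \<open>br_mult_right\<close>: the letters left behind by \<open>a\<close> are
  those that \<open>a'\<close> then crosses. This is what makes the passage a left action.\<close>

lemma pl_mult:
  "lmlin s sV h \<Longrightarrow> (\<Sum>(x, w)\<leftarrow>pl bs (a * a'). h x w) = (\<Sum>(x, w)\<leftarrow>pl bs a. \<Sum>(x', w')\<leftarrow>pl w a'. h (x * x') w')"
proof (induction bs arbitrary: h)
  case (Cons b bs)
  have "(\<Sum>(x, w)\<leftarrow>pl (b # bs) (a * a'). h x w)
      = (\<Sum>(x, w)\<leftarrow>pl bs a. \<Sum>(x', w')\<leftarrow>pl w a'. \<Sum>(t, y)\<leftarrow>br b (x * x'). h t (y # w'))"
    unfolding sum_pl_Cons by (rule Cons.IH[OF lmlin_br[OF Cons.prems]])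
  also have "\<dots> = (\<Sum>(x, w)\<leftarrow>pl bs a. \<Sum>(x', w')\<leftarrow>pl w a'. \<Sum>(t, z)\<leftarrow>br b x. \<Sum>(t', y)\<leftarrow>br z x'. h (t * t') (y # w'))"
    using lmlin_bilin[OF Cons.prems, of "[]"] by (intro sum_list_cong_prod br_mult_right) simp
  also have "\<dots> = (\<Sum>(x, w)\<leftarrow>pl bs a. \<Sum>(t, z)\<leftarrow>br b x. \<Sum>(x', w')\<leftarrow>pl w a'. \<Sum>(t', y)\<leftarrow>br z x'. h (t * t') (y # w'))"
    by (intro sum_list_cong_prod sum_list_swap_prod)
  finally show ?case by (simp only: sum_pl_Cons)
qed simp

text \<open>Only the crossings with the two multiplied letters are concerned, and for these the
  claim is \<open>br_mult_left\<close>.\<close>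

lemma pl_merge:
  "lmlin s sV h \<Longrightarrow> (\<Sum>(x, w)\<leftarrow>pl (u @ (b * b') # v) a. h x w) =
    (\<Sum>(x, w)\<leftarrow>pl (u @ b # b' # v) a. h x (merge (Suc (length u)) w))"
proof (induction u arbitrary: h)
  case Nil
  show ?case unfolding append_Nil sum_pl_Cons list.size merge_hd
    using lmlin_bilin[OF Nil, of "[]"] by (intro sum_list_cong_prod br_mult_left) simp
next
  case (Cons c u)
  show ?case unfolding append_Cons sum_pl_Cons list.size
    by (subst Cons.IH[OF lmlin_br[OF Cons.prems]]) simp
qed

text \<open>In \<open>b * b'\<close> the factor \<open>b'\<close> stands next to the word and
  crosses it first; \<open>b\<close> crosses the word that results.\<close>

lemma pr_mult:
  "rmlin s sV h \<Longrightarrow> (\<Sum>(v, z)\<leftarrow>pr as (b * b'). h v z) = (\<Sum>(v, z)\<leftarrow>pr as b'. \<Sum>(v', z')\<leftarrow>pr v b. h v' (z' * z))"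
proof (induction as arbitrary: h b b')
  case (Cons a as)
  note bl = bilin_pr[OF Cons.prems]
  have "(\<Sum>(v, z)\<leftarrow>pr (a # as) (b * b'). h v z)
      = (\<Sum>(u, y')\<leftarrow>br b' a. \<Sum>(x, y)\<leftarrow>br b u. \<Sum>(v, z)\<leftarrow>pr as (y * y'). h (x # v) z)"
    unfolding sum_pr_Cons by (rule br_mult_left[OF bl])
  also have "\<dots> = (\<Sum>(u, y')\<leftarrow>br b' a. \<Sum>(x, y)\<leftarrow>br b u. \<Sum>(v, z)\<leftarrow>pr as y'. \<Sum>(v', z')\<leftarrow>pr v y. h (x # v') (z' * z))"
    by (intro sum_list_cong_prod Cons.IH[OF rmlin_pr_step[OF Cons.prems]])
  also have "\<dots> = (\<Sum>(u, y')\<leftarrow>br b' a. \<Sum>(v, z)\<leftarrow>pr as y'. \<Sum>(x, y)\<leftarrow>br b u. \<Sum>(v', z')\<leftarrow>pr v y. h (x # v') (z' * z))"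
    by (intro sum_list_cong_prod sum_list_swap_prod)
  finally show ?case by (simp only: sum_pr_Cons)
qed simp

lemma pr_merge:
  "rmlin s sV h \<Longrightarrow> (\<Sum>(w, z)\<leftarrow>pr (u @ (a * a') # v) b. h w z) =
    (\<Sum>(w, z)\<leftarrow>pr (u @ a # a' # v) b. h (merge (Suc (length u)) w) z)"
proof (induction u arbitrary: h b)
  case Nil
  note bl = bilin_pr[OF Nil]
  show ?case unfolding append_Nil sum_pr_Cons list.size merge_hd by (rule br_mult_right[OF bl])
next
  case (Cons c u)
  show ?case unfolding append_Cons sum_pr_Cons list.size
    by (intro sum_list_cong_prod, subst Cons.IH[OF rmlin_pr_step[OF Cons.prems]]) simp
qed

text \<open>A passage keeps the length of the word, so both sides have the same faces, and each face
  commutes with it by \<open>pl_merge\<close>.\<close>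

lemma pl_bd:
  assumes "lmlin s sV h"
  shows "(\<Sum>(x, w)\<leftarrow>pl bs a. bd (h x) w) = bd (\<lambda>v. \<Sum>(x, w)\<leftarrow>pl v a. h x w) bs"
proof -
  have "(\<Sum>(x, w)\<leftarrow>pl bs a. bd (h x) w) = (\<Sum>(x, w)\<leftarrow>pl bs a. \<Sum>i = 1..<length bs. alt i (h x (merge i w)))"
    by (intro sum_list_cong_prod) (simp add: bd_def length_pl)
  also have "\<dots> = (\<Sum>i = 1..<length bs. alt i (\<Sum>(x, w)\<leftarrow>pl bs a. h x (merge i w)))"
    by (simp add: sum_list_prod_sum alt_sum_list)
  also have "\<dots> = (\<Sum>i = 1..<length bs. alt i (\<Sum>(x, w)\<leftarrow>pl (merge i bs) a. h x w))"
  proof (intro sum.cong refl arg_cong[where f = "alt _"])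
    fix i assume "i \<in> {1..<length bs}"
    then have "0 < i" "i < length bs" by auto
    then obtain u x y v where "bs = u @ x # y # v" "i = Suc (length u)" by (rule split_at_pair)
    then show "(\<Sum>(x, w)\<leftarrow>pl bs a. h x (merge i w)) = (\<Sum>(x, w)\<leftarrow>pl (merge i bs) a. h x w)"
      using pl_merge[OF assms] by (simp add: merge_append)
  qed
  finally show ?thesis by (simp add: bd_def)
qed

lemma pr_bd:
  assumes "rmlin s sV h"
  shows "(\<Sum>(v, z)\<leftarrow>pr as b. bd (\<lambda>v. h v z) v) = bd (\<lambda>w. \<Sum>(v, z)\<leftarrow>pr w b. h v z) as"
proof -
  have "(\<Sum>(v, z)\<leftarrow>pr as b. bd (\<lambda>v. h v z) v) = (\<Sum>(v, z)\<leftarrow>pr as b. \<Sum>i = 1..<length as. alt i (h (merge i v) z))"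
    by (intro sum_list_cong_prod) (simp add: bd_def length_pr)
  also have "\<dots> = (\<Sum>i = 1..<length as. alt i (\<Sum>(v, z)\<leftarrow>pr as b. h (merge i v) z))"
    by (simp add: sum_list_prod_sum alt_sum_list)
  also have "\<dots> = (\<Sum>i = 1..<length as. alt i (\<Sum>(v, z)\<leftarrow>pr (merge i as) b. h v z))"
  proof (intro sum.cong refl arg_cong[where f = "alt _"])
    fix i assume "i \<in> {1..<length as}"
    then have "0 < i" "i < length as" by auto
    then obtain u x y v where "as = u @ x # y # v" "i = Suc (length u)" by (rule split_at_pair)
    then show "(\<Sum>(v, z)\<leftarrow>pr as b. h (merge i v) z) = (\<Sum>(v, z)\<leftarrow>pr (merge i as) b. h v z)"
      using pr_merge[OF assms] by (simp add: merge_append)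
  qed
  finally show ?thesis by (simp add: bd_def)
qed

lemma pl_one: "lmlin s sV h \<Longrightarrow> (\<Sum>(x, w)\<leftarrow>pl bs 1. h x w) = h 1 bs"
proof (induction bs arbitrary: h)
  case (Cons b bs)
  show ?case unfolding sum_pl_Cons Cons.IH[OF lmlin_br[OF Cons.prems]]
    using br_one_right[OF lmlin_bilin[OF Cons.prems, of "[]" bs]] by simp
qed simp

text \<open>A unit among the crossed letters comes out as a unit again, so \<open>h\<close> ends up
  evaluated at words containing \<open>1\<close>.\<close>

lemma pl_vanish:
  "lmlin s sV h \<Longrightarrow> (\<And>x w. 1 \<in> set w \<Longrightarrow> h x w = 0) \<Longrightarrow> 1 \<in> set bs \<Longrightarrow> (\<Sum>(x, w)\<leftarrow>pl bs a. h x w) = 0"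
proof (induction bs arbitrary: h)
  case (Cons b bs)
  show ?case unfolding sum_pl_Cons
  proof (cases "b = 1")
    case True
    show "(\<Sum>(x, w)\<leftarrow>pl bs a. \<Sum>(x', y)\<leftarrow>br b x. h x' (y # w)) = 0"
      using br_one_left[OF lmlin_bilin[OF Cons.prems(1), of "[]"]] Cons.prems(2) True
      by (subst sum_list_prod_zero) auto
  next
    case False
    then show "(\<Sum>(x, w)\<leftarrow>pl bs a. \<Sum>(x', y)\<leftarrow>br b x. h x' (y # w)) = 0"
      using Cons.prems by (intro Cons.IH[OF lmlin_br]) (auto intro!: sum_list_prod_zero)
  qed
qed simp

lemma pr_one: "rmlin s sV h \<Longrightarrow> (\<Sum>(v, z)\<leftarrow>pr as 1. h v z) = h as 1"
proof (induction as arbitrary: h)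
  case (Cons a as)
  note bl = bilin_pr[OF Cons.prems]
  show ?case unfolding sum_pr_Cons br_one_left[OF bl] by (rule Cons.IH[OF rmlin_pr_step[OF Cons.prems]])
qed simp

lemma pr_vanish:
  "rmlin s sV h \<Longrightarrow> (\<And>v z. 1 \<in> set v \<Longrightarrow> h v z = 0) \<Longrightarrow> 1 \<in> set as \<Longrightarrow> (\<Sum>(v, z)\<leftarrow>pr as b. h v z) = 0"
proof (induction as arbitrary: h b)
  case (Cons a as)
  show ?case unfolding sum_pr_Cons
  proof (cases "a = 1")
    case True
    note bl = bilin_pr[OF Cons.prems(1)]
    show "(\<Sum>(x, y)\<leftarrow>br b a. \<Sum>(v, z)\<leftarrow>pr as y. h (x # v) z) = 0"
      unfolding True br_one_right[OF bl] using Cons.prems(2) by (intro sum_list_prod_zero) simp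
  next
    case False
    then show "(\<Sum>(x, y)\<leftarrow>br b a. \<Sum>(v, z)\<leftarrow>pr as y. h (x # v) z) = 0"
      using Cons.prems by (intro sum_list_prod_zero Cons.IH[OF rmlin_pr_step]) auto
  qed
qed simp

end


section \<open>Shuffles\<close>

text \<open>A shuffle is encoded by its word of origins: \<open>True\<close> stands for a letter of the first factor,
  \<open>False\<close> for one of the second. Its length is the number of pairs \<open>False \<dots> True\<close>.\<close>

definition shuffle_words :: "nat \<Rightarrow> nat \<Rightarrow> bool list set"
  where "shuffle_words q p = {z. count_list z True = q \<and> count_list z False = p}"

primrec inversions :: "bool list \<Rightarrow> nat" where
  "inversions [] = 0"
| "inversions (c # z) = (if c then 0 else count_list z True) + inversions z"

lemma length_count_bool: "length z = count_list z True + count_list z False"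
  by (induction z) auto

lemma finite_shuffle_words: "finite (shuffle_words q p)"
proof (rule finite_subset)
  show "shuffle_words q p \<subseteq> {z. set z \<subseteq> UNIV \<and> length z = q + p}"
    by (auto simp: shuffle_words_def length_count_bool)
qed (rule finite_lists_length_eq, simp)

lemma inversions_snoc: "inversions (z @ [c]) = (if c then count_list z False else 0) + inversions z"
  by (induction z) auto

lemma shuffle_words_0_0: "shuffle_words 0 0 = {[]}"
proof (rule set_eqI)
  show "z \<in> shuffle_words 0 0 \<longleftrightarrow> z \<in> {[]}" for z
    using length_count_bool[of z] by (auto simp: shuffle_words_def)
qed

lemma shuffle_words_Suc_0: "shuffle_words (Suc q) 0 = Cons True ` shuffle_words q 0"
proof (rule set_eqI)
  show "z \<in> shuffle_words (Suc q) 0 \<longleftrightarrow> z \<in> Cons True ` shuffle_words q 0" for z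
    by (cases z) (auto simp: shuffle_words_def image_iff)
qed

lemma shuffle_words_0_Suc: "shuffle_words 0 (Suc p) = Cons False ` shuffle_words 0 p"
proof (rule set_eqI)
  show "z \<in> shuffle_words 0 (Suc p) \<longleftrightarrow> z \<in> Cons False ` shuffle_words 0 p" for z
    by (cases z) (auto simp: shuffle_words_def image_iff)
qed

lemma shuffle_words_Suc_Suc:
  "shuffle_words (Suc q) (Suc p) = Cons True ` shuffle_words q (Suc p) \<union> Cons False ` shuffle_words (Suc q) p"
proof (rule set_eqI)
  show "z \<in> shuffle_words (Suc q) (Suc p) \<longleftrightarrow>
      z \<in> Cons True ` shuffle_words q (Suc p) \<union> Cons False ` shuffle_words (Suc q) p" for z
    by (cases z) (auto simp: shuffle_words_def image_iff)
qed

lemma shuffle_words_Suc_Suc_snoc: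
  "shuffle_words (Suc q) (Suc p) =
    (\<lambda>z. z @ [True]) ` shuffle_words q (Suc p) \<union> (\<lambda>z. z @ [False]) ` shuffle_words (Suc q) p"
proof (rule set_eqI)
  show "z \<in> shuffle_words (Suc q) (Suc p) \<longleftrightarrow>
      z \<in> (\<lambda>z. z @ [True]) ` shuffle_words q (Suc p) \<union> (\<lambda>z. z @ [False]) ` shuffle_words (Suc q) p" for z
    by (cases z rule: rev_cases) (auto simp: shuffle_words_def image_iff)
qed

lemma sum_shuffle_words_Suc_Suc:
  fixes f :: "bool list \<Rightarrow> 'v::comm_monoid_add"
  shows "(\<Sum>z\<in>shuffle_words (Suc q) (Suc p). f z) =
    (\<Sum>z\<in>shuffle_words q (Suc p). f (True # z)) + (\<Sum>z\<in>shuffle_words (Suc q) p. f (False # z))"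
  unfolding shuffle_words_Suc_Suc
  by (subst sum.union_disjoint) (auto simp: finite_shuffle_words sum.reindex)

lemma sum_shuffle_words_Suc_Suc_snoc:
  fixes f :: "bool list \<Rightarrow> 'v::comm_monoid_add"
  shows "(\<Sum>z\<in>shuffle_words (Suc q) (Suc p). f z) =
    (\<Sum>z\<in>shuffle_words q (Suc p). f (z @ [True])) + (\<Sum>z\<in>shuffle_words (Suc q) p. f (z @ [False]))"
  unfolding shuffle_words_Suc_Suc_snoc
  by (subst sum.union_disjoint) (auto simp: finite_shuffle_words sum.reindex inj_on_def)

context hopf_algebra begin

text \<open>\<open>tw z bs as\<close> is the image of \<open>bs \<otimes> as\<close> under the braid lift of the shuffle \<open>z\<close>.\<close>

primrec tw :: "bool list \<Rightarrow> 'a list \<Rightarrow> 'a list \<Rightarrow> 'a list list" where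
  "tw [] bs as = [bs @ as]"
| "tw (c # z) bs as = (if c then map (Cons (hd bs)) (tw z (tl bs) as)
     else concat (map (\<lambda>(x, w). map (Cons x) (tw z w (tl as))) (pl bs (hd as))))"

lemma sum_tw_True: "(\<Sum>v\<leftarrow>tw (True # z) bs as. g v) = (\<Sum>v\<leftarrow>tw z (tl bs) as. g (hd bs # v))"
  by (simp add: comp_def)

lemma sum_tw_False:
  "(\<Sum>v\<leftarrow>tw (False # z) bs as. g v) = (\<Sum>(x, w)\<leftarrow>pl bs (hd as). \<Sum>v\<leftarrow>tw z w (tl as). g (x # v))"
  by (simp add: sum_list_concat_map comp_def case_prod_unfold)

declare tw.simps(2) [simp del]

lemma length_tw:
  "z \<in> shuffle_words (length bs) (length as) \<Longrightarrow> v \<in> set (tw z bs as) \<Longrightarrow> length v = length bs + length as"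
proof (induction z arbitrary: bs as v)
  case Nil
  then show ?case by (simp add: shuffle_words_def)
next
  case (Cons c z)
  show ?case
  proof (cases c)
    case True
    then obtain b bs' where bs: "bs = b # bs'" "z \<in> shuffle_words (length bs') (length as)"
      using Cons.prems by (cases bs) (auto simp: shuffle_words_def)
    then obtain u where u: "v = b # u" "u \<in> set (tw z bs' as)"
      using True Cons.prems by (auto simp: tw.simps(2))
    show ?thesis using Cons.IH[OF bs(2) u(2)] bs(1) u(1) by simp
  next
    case False
    then obtain a as' where as: "as = a # as'" "z \<in> shuffle_words (length bs) (length as')"
      using Cons.prems by (cases as) (auto simp: shuffle_words_def)
    then obtain x w u where *: "(x, w) \<in> set (pl bs a)" "u \<in> set (tw z w as')" "v = x # u"
      using False Cons.prems by (auto simp: tw.simps(2))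
    then have "length w = length bs" by (simp add: length_pl)
    then have "length u = length w + length as'" using as * by (intro Cons.IH) auto
    then show ?thesis using * as \<open>length w = length bs\<close> by simp
  qed
qed

lemma sum_tw_snoc_False:
  "(\<Sum>v\<leftarrow>tw (z @ [False]) bs (as @ [a]). g v) = (\<Sum>v\<leftarrow>tw z bs as. g (v @ [a]))"
  if "z \<in> shuffle_words (length bs) (length as)"
  using that
proof (induction z arbitrary: bs as g)
  case Nil
  then show ?case by (simp add: shuffle_words_def tw.simps(2))
next
  case (Cons c z)
  show ?case
  proof (cases c)
    case True
    then obtain b bs' where "bs = b # bs'" "z \<in> shuffle_words (length bs') (length as)"
      using Cons.prems by (cases bs) (auto simp: shuffle_words_def)
    then show ?thesis using True Cons.IH[of bs' as] by (simp add: sum_tw_True)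
  next
    case False
    then obtain a' as' where as: "as = a' # as'" "z \<in> shuffle_words (length bs) (length as')"
      using Cons.prems by (cases as) (auto simp: shuffle_words_def)
    have "(\<Sum>(x, w)\<leftarrow>pl bs a'. \<Sum>v\<leftarrow>tw (z @ [False]) w (as' @ [a]). g (x # v))
        = (\<Sum>(x, w)\<leftarrow>pl bs a'. \<Sum>v\<leftarrow>tw z w as'. g (x # v @ [a]))"
      using as by (intro sum_list_cong_prod) (simp add: Cons.IH length_pl)
    then show ?thesis using False as by (simp add: sum_tw_False)
  qed
qed

text \<open>\<open>tw\<close> is built from the left; this describes it from the right. Each letter
  of \<open>as\<close> moving left over the end of the first word crosses \<open>b\<close> before
  anything else, and collecting these crossings gives the passage of \<open>b\<close> through
  \<open>as\<close>.\<close>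

lemma sum_tw_snoc_True:
  fixes g :: "'a list \<Rightarrow> 'v::comm_monoid_add"
  assumes "z \<in> shuffle_words (length bs) (length as)"
  shows "(\<Sum>v\<leftarrow>tw (z @ [True]) (bs @ [b]) as. g v) = (\<Sum>(v, y)\<leftarrow>pr as b. \<Sum>w\<leftarrow>tw z bs v. g (w @ [y]))"
  using assms
proof (induction z arbitrary: bs as b g)
  case Nil
  then show ?case by (simp add: shuffle_words_def tw.simps(2))
next
  case (Cons c z)
  show ?case
  proof (cases c)
    case True
    then obtain b' bs' where "bs = b' # bs'" "z \<in> shuffle_words (length bs') (length as)"
      using Cons.prems by (cases bs) (auto simp: shuffle_words_def)
    then show ?thesis using True Cons.IH[of bs' as] by (simp add: sum_tw_True)
  next
    case False
    then obtain a as' where as: "as = a # as'" "z \<in> shuffle_words (length bs) (length as')"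
      using Cons.prems by (cases as) (auto simp: shuffle_words_def)
    have "(\<Sum>(x, w)\<leftarrow>pl (bs @ [b]) a. \<Sum>v\<leftarrow>tw (z @ [True]) w as'. g (x # v))
        = (\<Sum>(u, y)\<leftarrow>br b a. \<Sum>(x, w)\<leftarrow>pl bs u. \<Sum>v\<leftarrow>tw (z @ [True]) (w @ [y]) as'. g (x # v))"
      by (rule sum_pl_snoc)
    also have "\<dots> = (\<Sum>(u, y)\<leftarrow>br b a. \<Sum>(x, w)\<leftarrow>pl bs u. \<Sum>(v, y')\<leftarrow>pr as' y. \<Sum>w'\<leftarrow>tw z w v. g (x # w' @ [y']))"
      using as by (intro sum_list_cong_prod) (simp add: Cons.IH length_pl)
    \<comment> \<open>The crossings of \<open>bs\<close> with \<open>u\<close> and those of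
      \<open>as'\<close> with \<open>y\<close> concern different letters, so the two sums are
      independent.\<close>
    also have "\<dots> = (\<Sum>(u, y)\<leftarrow>br b a. \<Sum>(v, y')\<leftarrow>pr as' y. \<Sum>(x, w)\<leftarrow>pl bs u. \<Sum>w'\<leftarrow>tw z w v. g (x # w' @ [y']))"
      by (rule sum_list_cong_prod, rule sum_list_swap_prod)
    finally show ?thesis using False as by (simp add: sum_tw_False sum_pr_Cons)
  qed
qed

text \<open>The transposed shuffle product: \<open>sh g bs as = g(\<phi>\<^sub>\<sigma>(bs \<otimes> as))\<close>.\<close>

definition sh :: "('a list \<Rightarrow> 'v::ab_group_add) \<Rightarrow> 'a list \<Rightarrow> 'a list \<Rightarrow> 'v"
  where "sh g bs as = (\<Sum>z\<in>shuffle_words (length bs) (length as). alt (inversions z) (\<Sum>v\<leftarrow>tw z bs as. g v))"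

lemma sh_Nil_Nil [simp]: "sh g [] [] = g []"
  by (simp add: sh_def shuffle_words_0_0)

text \<open>The second summand collects the shuffles whose first letter comes from \<open>a\<close>;
  moving it over \<open>b # bs\<close> creates \<open>Suc (length bs)\<close> inversions, which is
  the sign.\<close>

lemma sh_Cons_Cons:
  "sh g (b # bs) (a # as) = sh (\<lambda>w. g (b # w)) bs (a # as) +
    alt (Suc (length bs)) (\<Sum>(x, w)\<leftarrow>pl (b # bs) a. sh (\<lambda>v. g (x # v)) w as)"
proof -
  have "(\<Sum>z\<in>shuffle_words (Suc (length bs)) (length as). alt (inversions (False # z)) (\<Sum>v\<leftarrow>tw (False # z) (b # bs) (a # as). g v))
      = alt (Suc (length bs)) (\<Sum>z\<in>shuffle_words (Suc (length bs)) (length as).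
          alt (inversions z) (\<Sum>(x, w)\<leftarrow>pl (b # bs) a. \<Sum>v\<leftarrow>tw z w as. g (x # v)))"
    by (simp only: alt_sum alt_alt, intro sum.cong refl) (simp add: shuffle_words_def sum_tw_False)
  also have "\<dots> = alt (Suc (length bs)) (\<Sum>(x, w)\<leftarrow>pl (b # bs) a. \<Sum>z\<in>shuffle_words (Suc (length bs)) (length as).
          alt (inversions z) (\<Sum>v\<leftarrow>tw z w as. g (x # v)))"
    by (simp only: alt_sum_list sum_list_prod_sum)
  also have "\<dots> = alt (Suc (length bs)) (\<Sum>(x, w)\<leftarrow>pl (b # bs) a. sh (\<lambda>v. g (x # v)) w as)"
    by (intro arg_cong[where f = "alt _"] sum_list_cong_prod) (simp add: sh_def length_pl)
  finally show ?thesis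
    unfolding sh_def list.size add_0_right add_Suc_right
    by (simp add: sum_shuffle_words_Suc_Suc sum_tw_True)
qed

lemma sh_Nil2: "sh g bs [] = g bs"
proof (induction bs arbitrary: g)
  case (Cons b bs)
  have "sh g (b # bs) [] = sh (\<lambda>w. g (b # w)) bs []"
    by (simp add: sh_def shuffle_words_Suc_0 sum.reindex sum_tw_True)
  then show ?case using Cons by simp
qed simp

lemma sh_Nil1: "sh g [] as = g as"
proof (induction as arbitrary: g)
  case (Cons a as)
  have "sh g [] (a # as) = sh (\<lambda>w. g (a # w)) [] as"
    by (simp add: sh_def shuffle_words_0_Suc sum.reindex sum_tw_False)
      (intro sum.cong refl, simp add: shuffle_words_def)
  then show ?case using Cons by simp
qed simp

text \<open>The recursion seen from the last letter: if it comes from \<open>b\<close>, then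
  \<open>b\<close> has crossed all of \<open>as @ [a]\<close>, at the cost of
  \<open>Suc (length as)\<close> inversions.\<close>

lemma sh_snoc_snoc:
  "sh g (bs @ [b]) (as @ [a]) = sh (\<lambda>w. g (w @ [a])) (bs @ [b]) as +
    alt (Suc (length as)) (\<Sum>(v, y)\<leftarrow>pr (as @ [a]) b. sh (\<lambda>w. g (w @ [y])) bs v)"
proof -
  have "(\<Sum>z\<in>shuffle_words (length bs) (Suc (length as)). alt (inversions (z @ [True])) (\<Sum>v\<leftarrow>tw (z @ [True]) (bs @ [b]) (as @ [a]). g v))
      = alt (Suc (length as)) (\<Sum>z\<in>shuffle_words (length bs) (Suc (length as)).
          alt (inversions z) (\<Sum>(v, y)\<leftarrow>pr (as @ [a]) b. \<Sum>w\<leftarrow>tw z bs v. g (w @ [y])))"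
    by (simp only: alt_sum alt_alt, intro sum.cong refl, subst sum_tw_snoc_True)
      (simp_all add: shuffle_words_def inversions_snoc)
  also have "\<dots> = alt (Suc (length as)) (\<Sum>(v, y)\<leftarrow>pr (as @ [a]) b. \<Sum>z\<in>shuffle_words (length bs) (Suc (length as)).
          alt (inversions z) (\<Sum>w\<leftarrow>tw z bs v. g (w @ [y])))"
    by (simp only: alt_sum_list sum_list_prod_sum)
  also have "\<dots> = alt (Suc (length as)) (\<Sum>(v, y)\<leftarrow>pr (as @ [a]) b. sh (\<lambda>w. g (w @ [y])) bs v)"
    by (intro arg_cong[where f = "alt _"] sum_list_cong_prod) (simp add: sh_def length_pr)
  finally have 1: "(\<Sum>z\<in>shuffle_words (length bs) (Suc (length as)). alt (inversions (z @ [True])) (\<Sum>v\<leftarrow>tw (z @ [True]) (bs @ [b]) (as @ [a]). g v)) = \<dots>" .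
  have 2: "(\<Sum>z\<in>shuffle_words (Suc (length bs)) (length as). alt (inversions (z @ [False])) (\<Sum>v\<leftarrow>tw (z @ [False]) (bs @ [b]) (as @ [a]). g v))
      = sh (\<lambda>w. g (w @ [a])) (bs @ [b]) as"
    unfolding sh_def length_append list.size
    by (simp, intro sum.cong refl, subst sum_tw_snoc_False) (simp_all add: inversions_snoc)
  show ?thesis unfolding 1[symmetric] 2[symmetric]
    by (simp add: sh_def sum_shuffle_words_Suc_Suc_snoc add.commute)
qed

lemma sh_cong: "(\<And>w. length w = length bs + length as \<Longrightarrow> g w = g' w) \<Longrightarrow> sh g bs as = sh g' bs as"
  unfolding sh_def by (intro sum.cong refl arg_cong[where f = "alt _"] sum_list_cong) (blast dest: length_tw)

lemma sh_add: "sh (\<lambda>w. g w + g' w) bs as = sh g bs as + sh g' bs as"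
  by (simp add: sh_def sum_list_addf alt_plus sum.distrib)

lemma sh_additive:
  assumes "h 0 = 0" "\<And>x y. h (x + y) = h x + h y"
  shows "sh (\<lambda>w. h (g w)) bs as = h (sh g bs as)"
  by (simp add: sh_def additive_sum[of h, OF assms] additive_alt[of h, OF assms] sum_list_additive[of h, OF assms])

lemma sh_minus: "sh (\<lambda>w. - g w) bs as = - sh g bs as"
  by (rule sh_additive) auto

lemma sh_alt: "sh (\<lambda>w. alt k (g w)) bs as = alt k (sh g bs as)"
  by (rule sh_additive) (auto simp: alt_plus)

text \<open>A form of the recursion in which \<open>bs\<close> may be empty, as it stands for what
  remains behind a first letter; \<open>sh_left'\<close> does the same for
  \<open>as\<close>.\<close>

lemma sh_left:
  "sh g bs (a # as) = (if bs = [] then 0 else sh (\<lambda>w. g (hd bs # w)) (tl bs) (a # as)) +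
    alt (length bs) (\<Sum>(x, w)\<leftarrow>pl bs a. sh (\<lambda>v. g (x # v)) w as)"
proof (cases bs)
  case (Cons b bs')
  then show ?thesis using sh_Cons_Cons[of g b bs' a as] by simp
qed (simp add: sh_Nil1)

lemma sh_left':
  "sh g (b # bs) as = sh (\<lambda>w. g (b # w)) bs as +
    (if as = [] then 0 else alt (Suc (length bs)) (\<Sum>(x, w)\<leftarrow>pl (b # bs) (hd as). sh (\<lambda>v. g (x # v)) w (tl as)))"
proof (cases as)
  case (Cons a as')
  then show ?thesis using sh_Cons_Cons[of g b bs a as'] by simp
qed (simp add: sh_Nil2)

text \<open>The induction works for every \<open>z\<close>, whatever its letter counts: once
  \<open>z\<close> is exhausted, \<open>tw\<close> returns the remaining \<open>bs @ as\<close>,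
  which still depends multilinearly on both words.\<close>

lemma mlin_tw_left: "mlin s sV g \<Longrightarrow> mlin s sV (\<lambda>bs. \<Sum>v\<leftarrow>tw z bs as. g v)"
proof (induction z arbitrary: g as)
  case Nil
  then show ?case by (simp add: mlin_snoc)
next
  case (Cons c z)
  have sV: "vector_space sV" using mlin_hd[OF Cons.prems] by (simp add: Vector_Spaces.linear_iff)
  show ?case
  proof (cases c)
    case True
    show ?thesis
    proof (rule mlinI)
      fix u v
      show "lin s sV (\<lambda>x. \<Sum>w\<leftarrow>tw (c # z) (u @ x # v) as. g w)"
        using mlin_append_Cons[OF Cons.IH[OF mlin_Cons[OF Cons.prems]]]
        by (cases u) (auto simp: True sum_tw_True intro!: lin_sum_list vs sV mlin_hd Cons.prems)
    qed
  next
    case False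
    have "lmlin s sV (\<lambda>x w. \<Sum>v\<leftarrow>tw z w (tl as). g (x # v))"
      by (intro lmlinI lin_sum_list vs sV mlin_hd Cons.IH mlin_Cons Cons.prems)
    from mlin_pl[OF this] False show ?thesis by (simp add: sum_tw_False)
  qed
qed

lemma mlin_tw_right: "mlin s sV g \<Longrightarrow> mlin s sV (\<lambda>as. \<Sum>v\<leftarrow>tw z bs as. g v)"
proof (induction z arbitrary: g bs)
  case Nil
  then show ?case by (simp add: mlin_append)
next
  case (Cons c z)
  have sV: "vector_space sV" using mlin_hd[OF Cons.prems] by (simp add: Vector_Spaces.linear_iff)
  show ?case
  proof (cases c)
    case True
    then show ?thesis using Cons.IH[OF mlin_Cons[OF Cons.prems]] by (simp add: sum_tw_True)
  next
    case False
    have l: "lmlin s sV (\<lambda>x w. \<Sum>v\<leftarrow>tw z w as. g (x # v))" for as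
      by (intro lmlinI lin_sum_list vs sV mlin_hd mlin_tw_left mlin_Cons Cons.prems)
    show ?thesis
    proof (rule mlinI)
      fix u v
      show "lin s sV (\<lambda>y. \<Sum>w\<leftarrow>tw (c # z) bs (u @ y # v). g w)"
      proof (cases u)
        case Nil
        show ?thesis unfolding Nil using False lin_pl[OF l] by (simp add: sum_tw_False)
      next
        case (Cons a u')
        show ?thesis unfolding Cons
          using False mlin_append_Cons[OF Cons.IH[OF mlin_Cons[OF Cons.prems]]]
          by (auto simp: sum_tw_False intro!: lin_sum_list_prod vs sV)
      qed
    qed
  qed
qed

lemma mlin_sh_left:
  assumes "mlin s sV g" shows "mlin s sV (\<lambda>bs. sh g bs as)"
proof (rule mlinI)
  fix u v
  have "vector_space sV" using mlin_hd[OF assms] by (simp add: Vector_Spaces.linear_iff)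
  then show "lin s sV (\<lambda>x. sh g (u @ x # v) as)" unfolding sh_def length_append list.size
    by (intro lin_sum vs lin_alt mlin_append_Cons[OF mlin_tw_left[OF assms]])
qed

lemma mlin_sh_right:
  assumes "mlin s sV g" shows "mlin s sV (\<lambda>as. sh g bs as)"
proof (rule mlinI)
  fix u v
  have "vector_space sV" using mlin_hd[OF assms] by (simp add: Vector_Spaces.linear_iff)
  then show "lin s sV (\<lambda>x. sh g bs (u @ x # v))" unfolding sh_def length_append list.size
    by (intro lin_sum vs lin_alt mlin_append_Cons[OF mlin_tw_right[OF assms]])
qed

lemma lin_sh_Cons:
  assumes "mlin s sV g" shows "lin s sV (\<lambda>x. sh (\<lambda>v. g (x # v)) bs as)"
proof -
  have "vector_space sV" using mlin_hd[OF assms] by (simp add: Vector_Spaces.linear_iff)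
  then show ?thesis unfolding sh_def
    by (intro lin_sum vs lin_alt lin_sum_list mlin_hd assms)
qed

lemma lmlin_sh: "mlin s sV g \<Longrightarrow> lmlin s sV (\<lambda>x w. sh (\<lambda>v. g (x # v)) w as)"
  by (intro lmlinI lin_sh_Cons mlin_sh_left mlin_Cons)

text \<open>Crossing a unit is a plain exchange, so the unit survives in every word of the
  shuffle.\<close>

lemma sh_vanish:
  "mlin s sV g \<Longrightarrow> (\<And>w. 1 \<in> set w \<Longrightarrow> g w = 0) \<Longrightarrow> 1 \<in> set bs \<union> set as \<Longrightarrow> sh g bs as = 0"
proof (induction as arbitrary: g bs)
  case Nil
  then show ?case by (simp add: sh_Nil2)
next
  case outer: (Cons a as)
  show ?case using outer.prems
  proof (induction bs arbitrary: g)
    case Nil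
    then show ?case by (simp add: sh_Nil1)
  next
    case (Cons b bs)
    have "sh (\<lambda>w. g (b # w)) bs (a # as) = 0"
    proof (cases "b = 1")
      case True
      then show ?thesis using Cons.prems(2) by (simp add: sh_def)
    next
      case False
      then show ?thesis using Cons.prems by (intro Cons.IH mlin_Cons) auto
    qed
    moreover have "(\<Sum>(x, w)\<leftarrow>pl (b # bs) a. sh (\<lambda>v. g (x # v)) w as) = 0"
    proof (cases "1 \<in> set as")
      case True
      then show ?thesis
        using Cons.prems(2) by (intro sum_list_prod_zero outer.IH mlin_Cons Cons.prems(1)) auto
    next
      case no: False
      show ?thesis
      proof (cases "a = 1")
        case True
        \<comment> \<open>The unit \<open>a\<close> passes to the front and leaves
          \<open>b # bs\<close> as it is, so \<open>g\<close> is evaluated at words starting with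
          \<open>1\<close>.\<close>
        then show ?thesis using pl_one[OF lmlin_sh[OF Cons.prems(1)]] Cons.prems(2) by (simp add: sh_def)
      next
        case False
        then have "1 \<in> set (b # bs)" using no Cons.prems(3) by auto
        then show ?thesis
          by (rule pl_vanish[OF lmlin_sh[OF Cons.prems(1)], rotated]) (auto intro!: outer.IH mlin_Cons Cons.prems)
      qed
    qed
    ultimately show ?case by (simp add: sh_Cons_Cons)
  qed
qed

end


section \<open>The shuffle product and the bar differential\<close>

context hopf_algebra begin

text \<open>The names sort the faces of a shuffled word: \<open>P1\<close> to \<open>P4\<close> come
  from those that avoid its first letter, \<open>X1\<close> and \<open>X2\<close> from those that
  multiply its first two letters. In \<open>Y1\<close> and \<open>Y2\<close> both of these come from
  the same factor, in \<open>Z\<close> one comes from each.\<close>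

lemma sh_bd:
  "mlin s sV g \<Longrightarrow> sh (bd g) bs as = bd (\<lambda>v. sh g v as) bs + alt (length bs) (bd (\<lambda>v. sh g bs v) as)"
proof (induction as arbitrary: g bs)
  case Nil
  then show ?case by (simp add: sh_Nil2)
next
  case outer: (Cons a as)
  show ?case using outer.prems
  proof (induction bs arbitrary: g)
    case Nil
    then show ?case by (simp add: sh_Nil1)
  next
    case (Cons b bs)
    note g = Cons.prems
    let ?n = "length bs" and ?q = "Suc (length bs)"
    let ?sh = "\<lambda>x. sh (\<lambda>w. g (x # w))"
    define P1 where "P1 = bd (\<lambda>v. ?sh b v (a # as)) bs"
    define P2 where "P2 = bd (\<lambda>v. ?sh b bs v) (a # as)"
    define P3 where "P3 = (\<Sum>(x, w)\<leftarrow>pl (b # bs) a. bd (\<lambda>v. ?sh x v as) w)"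
    define P4 where "P4 = (\<Sum>(x, w)\<leftarrow>pl (b # bs) a. bd (\<lambda>v. ?sh x w v) as)"
    define X1 where "X1 = sh (\<lambda>w. g (b * hd w # tl w)) bs (a # as)"
    define X2 where "X2 = (\<Sum>(x, w)\<leftarrow>pl (b # bs) a. sh (\<lambda>v. g (x * hd v # tl v)) w as)"
    define Y1 where "Y1 = (if bs = [] then 0 else ?sh (b * hd bs) (tl bs) (a # as))"
    define Y2 where "Y2 = (if as = [] then 0 else \<Sum>(x, w)\<leftarrow>pl (b # bs) (a * hd as). ?sh x w (tl as))"
    \<comment> \<open>\<open>b\<close> times the image of \<open>a\<close> once \<open>a\<close> has
      crossed \<open>bs\<close>; whether it also crosses \<open>b\<close> is invisible after the
      multiplication.\<close>
    define Z where "Z = (\<Sum>(x, w)\<leftarrow>pl bs a. ?sh (b * x) w as)"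
    have bd_hd: "bd g (x # w) = - g (x * hd w # tl w) + - bd (\<lambda>v. g (x # v)) w" if "w \<noteq> []" for x w
      using that by (cases w) auto
    have E1: "sh (\<lambda>w. bd g (b # w)) bs (a # as) = - X1 - (P1 + alt ?n P2)"
    proof -
      have "sh (\<lambda>w. bd g (b # w)) bs (a # as)
          = sh (\<lambda>w. - g (b * hd w # tl w) + - bd (\<lambda>v. g (b # v)) w) bs (a # as)"
        by (rule sh_cong, rule bd_hd) auto
      also have "\<dots> = - X1 - sh (bd (\<lambda>v. g (b # v))) bs (a # as)"
        by (simp only: sh_add sh_minus X1_def diff_conv_add_uminus)
      finally show ?thesis using Cons.IH[OF mlin_Cons[OF g]] by (simp add: P1_def P2_def)
    qed
    have E2: "(\<Sum>(x, w)\<leftarrow>pl (b # bs) a. sh (\<lambda>v. bd g (x # v)) w as) = - X2 - (P3 + alt ?q P4)"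
    proof -
      have "(\<Sum>(x, w)\<leftarrow>pl (b # bs) a. sh (\<lambda>v. bd g (x # v)) w as)
          = (\<Sum>(x, w)\<leftarrow>pl (b # bs) a. - sh (\<lambda>v. g (x * hd v # tl v)) w as +
              - (bd (\<lambda>v. ?sh x v as) w + alt ?q (bd (\<lambda>v. ?sh x w v) as)))"
      proof (rule sum_list_cong_prod)
        fix x w assume "(x, w) \<in> set (pl (b # bs) a)"
        then have w: "length w = ?q" using length_pl by fastforce
        have "sh (\<lambda>v. bd g (x # v)) w as = sh (\<lambda>v. - g (x * hd v # tl v) + - bd (\<lambda>u. g (x # u)) v) w as"
          by (rule sh_cong, rule bd_hd) (use w in auto)
        also have "\<dots> = - sh (\<lambda>v. g (x * hd v # tl v)) w as + - sh (bd (\<lambda>u. g (x # u))) w as"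
          by (simp only: sh_add sh_minus)
        finally show "sh (\<lambda>v. bd g (x # v)) w as = - sh (\<lambda>v. g (x * hd v # tl v)) w as +
              - (bd (\<lambda>v. ?sh x v as) w + alt ?q (bd (\<lambda>v. ?sh x w v) as))"
          using outer.IH[OF mlin_Cons[OF g]] w by simp
      qed
      then show ?thesis
        by (simp only: sum_list_prod_add sum_list_prod_minus alt_sum_list[symmetric] P3_def P4_def X2_def diff_conv_add_uminus)
    qed
    have R1: "bd (\<lambda>v. sh g v (a # as)) (b # bs) = - Y1 - P1 + alt ?n P3"
    proof -
      have "bd (\<lambda>v. sh g v (a # as)) (b # bs)
          = bd (\<lambda>v. ?sh (hd v) (tl v) (a # as) + alt ?n (\<Sum>(x, w)\<leftarrow>pl v a. ?sh x w as)) (b # bs)"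
      proof (rule bd_cong)
        fix v :: "'a list" assume "v \<noteq> []" "Suc (length v) = length (b # bs)"
        then show "sh g v (a # as) = ?sh (hd v) (tl v) (a # as) + alt ?n (\<Sum>(x, w)\<leftarrow>pl v a. ?sh x w as)"
          by (simp add: sh_left[of g v a as])
      qed
      \<comment> \<open>The faces of \<open>b # bs\<close> commute with the passage of
        \<open>a\<close>, which identifies the second term as \<open>P3\<close>.\<close>
      also have "\<dots> = bd (\<lambda>v. ?sh (hd v) (tl v) (a # as)) (b # bs) + alt ?n P3"
        by (simp only: bd_add bd_alt P3_def pl_bd[OF lmlin_sh[OF g]])
      finally show ?thesis
        using bd_hd_tl[of "\<lambda>c u. ?sh c u (a # as)" b bs] by (simp add: Y1_def P1_def)
    qed
    have R2: "bd (\<lambda>v. sh g (b # bs) v) (a # as) = P2 + alt ?q (- Y2 - P4)"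
    proof -
      let ?K = "\<lambda>c u. \<Sum>(x, w)\<leftarrow>pl (b # bs) c. ?sh x w u"
      have "bd (\<lambda>v. sh g (b # bs) v) (a # as) = bd (\<lambda>v. ?sh b bs v + alt ?q (?K (hd v) (tl v))) (a # as)"
        by (rule bd_cong) (simp add: sh_left'[of g b bs])
      also have "\<dots> = P2 + alt ?q (bd (\<lambda>v. ?K (hd v) (tl v)) (a # as))"
        by (simp only: bd_add bd_alt P2_def)
      also have "bd (\<lambda>v. ?K (hd v) (tl v)) (a # as) = - Y2 - bd (?K a) as"
        using bd_hd_tl[of ?K a as] by (simp add: Y2_def)
      also have "bd (?K a) as = P4"
        by (simp add: P4_def bd_def alt_sum_list sum_list_prod_sum)
      finally show ?thesis .
    qed
    \<comment> \<open>The letter following \<open>b\<close> is the next one of \<open>bs\<close>,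
      giving \<open>Y1\<close>, or the image of \<open>a\<close>, giving \<open>Z\<close>.\<close>
    have X1: "X1 = Y1 + alt ?n Z"
      unfolding X1_def Y1_def Z_def using sh_left[of "\<lambda>w. g (b * hd w # tl w)" bs a as] by simp
    have X2: "X2 = Z + alt ?q Y2"
    proof -
      have step: "sh (\<lambda>v. g (x * hd v # tl v)) w as = ?sh (x * hd w) (tl w) as +
          (if as = [] then 0 else alt ?q (\<Sum>(x', w')\<leftarrow>pl w (hd as). ?sh (x * x') w' (tl as)))"
        if "length w = ?q" for x w
        using that sh_left'[of "\<lambda>v. g (x * hd v # tl v)" "hd w" "tl w" as] by (cases w) auto
      have "X2 = (\<Sum>(x, w)\<leftarrow>pl (b # bs) a. ?sh (x * hd w) (tl w) as) +
          (\<Sum>(x, w)\<leftarrow>pl (b # bs) a. if as = [] then 0 else alt ?q (\<Sum>(x', w')\<leftarrow>pl w (hd as). ?sh (x * x') w' (tl as)))"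
        unfolding X2_def sum_list_prod_add[symmetric]
        by (rule sum_list_cong_prod, rule step) (use length_pl in fastforce)
      \<comment> \<open>The last crossing in the passage of \<open>a\<close> is the one with
        \<open>b\<close>; as its two outputs are multiplied, \<open>br_mult\<close> undoes
        it.\<close>
      also have "(\<Sum>(x, w)\<leftarrow>pl (b # bs) a. ?sh (x * hd w) (tl w) as) = Z"
        unfolding Z_def sum_pl_Cons list.sel by (intro sum_list_cong_prod br_mult[where sV = sV] lin_sh_Cons[OF g])
      also have "(\<Sum>(x, w)\<leftarrow>pl (b # bs) a. if as = [] then 0 else alt ?q (\<Sum>(x', w')\<leftarrow>pl w (hd as). ?sh (x * x') w' (tl as)))
          = alt ?q Y2"
      proof (cases "as = []")
        case True
        then show ?thesis by (simp add: Y2_def sum_list_prod_zero del: alt_Suc)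
      next
        case False
        \<comment> \<open>Two letters of the second word that pass in succession pass as their
          product, by \<open>pl_mult\<close>.\<close>
        then show ?thesis
          by (simp only: Y2_def if_False pl_mult[OF lmlin_sh[OF g]] alt_sum_list)
      qed
      finally show ?thesis .
    qed
    \<comment> \<open>\<open>Z\<close> enters with sign \<open>- alt ?n\<close> through
      \<open>X1\<close> and with \<open>- alt ?q\<close> through \<open>X2\<close>; since
      \<open>?q\<close> is \<open>Suc ?n\<close>, it cancels.\<close>
    show ?case unfolding sh_Cons_Cons E1 E2 list.size add_0_right add_Suc_right R1 R2 X1 X2
      by (simp add: alt_plus alt_minus alt_diff)
  qed
qed

end


section \<open>Hochschild differentials\<close>

text \<open>\<open>L\<close> and \<open>R\<close> are arbitrary because the coefficients will be
  \<open>M\<close> and also spaces of functions of the other word. At the empty word there is no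
  cochain of lower degree to differentiate, hence the value \<open>0\<close>.\<close>

definition hdiff :: "('a::ring_1 \<Rightarrow> 'n \<Rightarrow> 'n) \<Rightarrow> ('n \<Rightarrow> 'a \<Rightarrow> 'n) \<Rightarrow> ('a list \<Rightarrow> 'n) \<Rightarrow> 'a list \<Rightarrow> 'n::ab_group_add"
  where "hdiff L R g w =
    (if w = [] then 0 else L (hd w) (g (tl w)) + bd g w + alt (length w) (R (g (butlast w)) (last w)))"

text \<open>The two faces adjacent to the unit cancel, and the others keep it and vanish. At an end
  of a longer word only one adjacent face exists, and it survives.\<close>

lemma bd_one:
  fixes g :: "'a::ring_1 list \<Rightarrow> 'v::ab_group_add"
  assumes "\<And>w. 1 \<in> set w \<Longrightarrow> g w = 0"
  shows "bd g (u @ 1 # v) =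
    (if u = [] \<and> v \<noteq> [] then - g v else if u \<noteq> [] \<and> v = [] then alt (length u) (g u) else 0)"
  using assms
proof (induction u arbitrary: g)
  case Nil
  then have "bd (\<lambda>w. g (1 # w)) v = 0" by (simp add: bd_def)
  then show ?case by (cases v) auto
next
  case (Cons c u)
  have "bd (\<lambda>v. g (c # v)) (u @ 1 # v) = (if u = [] \<and> v \<noteq> [] then - g (c # v) else if u \<noteq> [] \<and> v = [] then alt (length u) (g (c # u)) else 0)"
    using Cons.prems by (intro Cons.IH) auto
  then show ?case using Cons.prems by (cases u) auto
qed

text \<open>Unit and associativity laws are asked for on a set \<open>N\<close>, because for the
  actions built from the braiding they hold as identities evaluated on multilinear
  functions.\<close>

locale bimodule_action =
  fixes N :: "'n::ab_group_add set" and L :: "'a::ring_1 \<Rightarrow> 'n \<Rightarrow> 'n" and R :: "'n \<Rightarrow> 'a \<Rightarrow> 'n"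
  assumes zero: "0 \<in> N" and add: "m \<in> N \<Longrightarrow> m' \<in> N \<Longrightarrow> m + m' \<in> N" and minus: "m \<in> N \<Longrightarrow> - m \<in> N"
    and L_closed: "m \<in> N \<Longrightarrow> L a m \<in> N" and R_closed: "m \<in> N \<Longrightarrow> R m a \<in> N"
    and L_add: "L a (m + m') = L a m + L a m'" and R_add: "R (m + m') a = R m a + R m' a"
    and L_one: "m \<in> N \<Longrightarrow> L 1 m = m" and R_one: "m \<in> N \<Longrightarrow> R m 1 = m"
    and L_mult: "m \<in> N \<Longrightarrow> L (a * b) m = L a (L b m)" and R_mult: "m \<in> N \<Longrightarrow> R m (a * b) = R (R m a) b"
    and L_R: "m \<in> N \<Longrightarrow> R (L a m) b = L a (R m b)"
begin

lemma L_zero: "L a 0 = 0" using L_add[of a 0 0] by simp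
lemma R_zero: "R 0 a = 0" using R_add[of 0 0 a] by simp

lemma alt_closed: "m \<in> N \<Longrightarrow> alt k m \<in> N" by (simp add: alt_def minus)

lemma sum_closed: "(\<And>i. i \<in> I \<Longrightarrow> f i \<in> N) \<Longrightarrow> sum f I \<in> N"
  by (induction I rule: infinite_finite_induct) (auto simp: zero add)

lemma hdiff_closed: "(\<And>w. g w \<in> N) \<Longrightarrow> hdiff L R g w \<in> N"
  unfolding hdiff_def bd_def by (auto intro!: zero add alt_closed sum_closed L_closed R_closed)

lemma L_bd: "L a (bd g w) = bd (\<lambda>v. L a (g v)) w"
  by (rule bd_additive) (auto simp: L_zero L_add)

lemma R_bd: "R (bd g w) a = bd (\<lambda>v. R (g v) a) w"
  by (rule bd_additive[of "\<lambda>m. R m a"]) (auto simp: R_zero R_add)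

lemma L_alt: "L a (alt k m) = alt k (L a m)"
  by (rule additive_alt) (auto simp: L_zero L_add)

lemma R_alt: "R (alt k m) a = alt k (R m a)"
  by (rule additive_alt[of "\<lambda>m. R m a"]) (auto simp: R_zero R_add)

lemma hdiff_hdiff:
  assumes g: "\<And>w. g w \<in> N"
  shows "hdiff L R (hdiff L R g) w = 0"
proof -
  consider "w = []" | a where "w = [a]" | a b v where "w = a # b # v" by (metis list.exhaust)
  then show ?thesis
  proof cases
    case (3 a b v)
    define u where "u = b # v"
    define t where "t = butlast w"
    define z where "z = last w"
    \<comment> \<open>The word is read both as \<open>a # u\<close> and as \<open>t @ [z]\<close>:
      the left action removes \<open>a\<close>, the right action removes \<open>z\<close>, and the
      two readings share the middle.\<close>
    have w: "w = a # u" "w = t @ [z]" "u \<noteq> []" "t \<noteq> []" "w \<noteq> []" using 3 by (auto simp: u_def t_def z_def)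
    have len: "length u = length t" using w(1,2) by (metis length_Cons length_append_singleton nat.inject)
    have tu: "hd t = a" "tl t = butlast u" "last u = z" using w by (cases t; force)+
    \<comment> \<open>Every word at which \<open>bd\<close> evaluates has length
      \<open>length t\<close>, so the sign of the right term is constant and can be pulled
      out.\<close>
    have "bd (hdiff L R g) w
        = bd (\<lambda>v. L (hd v) (g (tl v)) + bd g v + alt (length t) (R (g (butlast v)) (last v))) w"
      using w(2) by (intro bd_cong) (simp add: hdiff_def)
    also have "\<dots> = bd (\<lambda>v. L (hd v) (g (tl v))) (a # u) + alt (length t) (bd (\<lambda>v. R (g (butlast v)) (last v)) (t @ [z]))"
      unfolding w(1)[symmetric] w(2)[symmetric] by (simp only: bd_add bd_alt bd_bd add_0_right)
    also have "bd (\<lambda>v. L (hd v) (g (tl v))) (a # u) = - L a (L (hd u) (g (tl u))) - L a (bd g u)"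
      using bd_hd_tl[of "\<lambda>c v. L c (g v)" a u] w(3) by (simp add: L_mult g L_bd)
    also have "bd (\<lambda>v. R (g (butlast v)) (last v)) (t @ [z]) = R (bd g t) z + alt (length t) (R (R (g (butlast t)) (last t)) z)"
      using bd_last_butlast[of "\<lambda>v c. R (g v) c" t z] w(4) by (simp add: R_mult g R_bd)
    finally have m: "bd (hdiff L R g) w = - L a (L (hd u) (g (tl u))) - L a (bd g u)
        + alt (length t) (R (bd g t) z + alt (length t) (R (R (g (butlast t)) (last t)) z))" .
    have "hdiff L R (hdiff L R g) w = L a (hdiff L R g u) + bd (hdiff L R g) w + alt (length w) (R (hdiff L R g t) z)"
      using w(5) by (simp add: hdiff_def[of L R "hdiff L R g"] t_def z_def u_def 3)
    also have "L a (hdiff L R g u) = L a (L (hd u) (g (tl u))) + L a (bd g u) + alt (length t) (L a (R (g (butlast u)) z))"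
      using w(3) by (simp add: hdiff_def L_add L_alt tu len)
    also have "R (hdiff L R g t) z = L a (R (g (butlast u)) z) + R (bd g t) z + alt (length t) (R (R (g (butlast t)) (last t)) z)"
      using w(4) by (simp add: hdiff_def R_add R_alt tu L_R g)
    also have "length w = Suc (length t)" using w(2) by simp
    finally show ?thesis unfolding m by (simp add: alt_plus)
  qed (auto simp: hdiff_def L_zero R_zero)
qed

text \<open>A unit at an end of a longer word leaves one inner face, which cancels the outer term
  acting by \<open>1\<close>; for the one-letter word the two outer terms cancel each other.\<close>

lemma hdiff_vanish:
  assumes g: "\<And>w. g w \<in> N" and van: "\<And>w. 1 \<in> set w \<Longrightarrow> g w = 0" and w: "1 \<in> set w"
  shows "hdiff L R g w = 0"
proof -
  obtain u v where uv: "w = u @ 1 # v" using w by (meson split_list)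
  have bd: "bd g w = (if u = [] \<and> v \<noteq> [] then - g v else if u \<noteq> [] \<and> v = [] then alt (length u) (g u) else 0)"
    unfolding uv by (rule bd_one[OF van])
  show ?thesis
  proof (cases u)
    case Nil
    then show ?thesis unfolding hdiff_def bd using uv
      by (cases v) (auto simp: van L_one R_one g R_zero)
  next
    case (Cons c u')
    then show ?thesis unfolding hdiff_def bd using uv
      by (cases "v = []") (auto simp: van L_zero R_zero R_one g butlast_append)
  qed
qed

end

lemma lin_bd_Cons:
  "vector_space s \<Longrightarrow> mlin s sV g \<Longrightarrow> lin s sV (\<lambda>x. bd (\<lambda>v. g (x # v)) w)"
  unfolding bd_def by (intro lin_sum lin_alt mlin_hd) (auto dest: mlin_hd simp: Vector_Spaces.linear_iff)

lemma lin_diff: "lin s sV f \<Longrightarrow> lin s sV g \<Longrightarrow> lin s sV (\<lambda>x. f x - g x)"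
  using lin_add[OF _ lin_uminus, of s sV f g] by simp

context hopf_algebra begin

text \<open>Only the faces next to the varying letter change it, and they do so by a multiplication,
  which is linear.\<close>

lemma mlin_bd:
  assumes "mlin s sV g" shows "mlin s sV (bd g)"
proof (rule mlinI)
  fix u v
  show "lin s sV (\<lambda>x. bd g (u @ x # v))" using assms
  proof (induction u arbitrary: g)
    case Nil
    then have sV: "vector_space sV" using mlin_hd[OF Nil] by (simp add: Vector_Spaces.linear_iff)
    show ?case
    proof (cases v)
      case Nil
      then show ?thesis by (simp add: lin_zero[OF vs sV])
    next
      case (Cons y v')
      then show ?thesis
        by (auto intro!: lin_diff lin_uminus lin_bd_Cons vs Nil lin_arg[OF mlin_hd[OF Nil]] lin_rules)
    qed
  next
    case (Cons c u)
    show ?case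
    proof (cases u)
      case Nil
      then show ?thesis using Cons.IH[OF mlin_Cons[OF Cons.prems]]
        by (auto intro!: lin_diff lin_uminus lin_arg[OF mlin_hd[OF Cons.prems]] lin_rules)
    next
      case (Cons d u')
      then show ?thesis using Cons.IH[OF mlin_Cons[OF Cons.prems]] mlin_append_Cons[OF Cons.prems, of "(c * d) # u'"]
        by (auto intro!: lin_diff lin_uminus)
    qed
  qed
qed

text \<open>The outer terms are left abstract so as to cover coefficients in \<open>M\<close> as
  well as the double complex, where the acting letter first crosses the other word.\<close>

lemma mlin_hdiff_terms:
  assumes T1: "lmlin s sV T1" and g: "mlin s sV g" and T2: "rmlin s sV T2"
  shows "mlin s sV (\<lambda>w. if w = [] then 0 else T1 (hd w) (tl w) + bd g w + alt (length w) (T2 (butlast w) (last w)))"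
proof (rule mlinI)
  fix u v
  have "lin s sV (\<lambda>x. T1 (hd (u @ x # v)) (tl (u @ x # v)))"
    using T1 by (cases u) (auto simp: lmlin_def mlin_def)
  moreover have "lin s sV (\<lambda>x. T2 (butlast (u @ x # v)) (last (u @ x # v)))"
  proof (cases v rule: rev_cases)
    case Nil
    then show ?thesis using T2 by (simp add: rmlin_def)
  next
    case (snoc v' c)
    then show ?thesis using T2 by (simp add: rmlin_def mlin_def butlast_append)
  qed
  ultimately show "lin s sV (\<lambda>x. if u @ x # v = [] then 0 else T1 (hd (u @ x # v)) (tl (u @ x # v)) + bd g (u @ x # v) +
      alt (length (u @ x # v)) (T2 (butlast (u @ x # v)) (last (u @ x # v))))"
    unfolding length_append list.size
    by (simp del: alt_Suc add: lin_add lin_alt mlin_append_Cons[OF mlin_bd[OF g]])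
qed

end

lemma alt_absorb: "alt (j + (j + k)) v = alt k v"
  by (simp add: alt_def)


section \<open>The double complex on words\<close>

locale hopf_bimodule = hopf_algebra s D \<epsilon> S + M: bimodule sM s l r
  for s :: "'k::field \<Rightarrow> 'a::ring_1 \<Rightarrow> 'a" and D \<epsilon> S
    and sM :: "'k \<Rightarrow> 'm::ab_group_add \<Rightarrow> 'm" and l :: "'a \<Rightarrow> 'm \<Rightarrow> 'm" and r :: "'m \<Rightarrow> 'a \<Rightarrow> 'm"
begin

lemma vsM: "vector_space sM" by (rule M.vector_space_axioms)

lemma l_add: "l a (m + m') = l a m + l a m'" by (rule lin_plus[OF M.left_linear(1)])
lemma r_add: "r (m + m') a = r m a + r m' a" by (rule lin_plus[OF M.right_linear(1)])
lemma l_zero: "l a 0 = 0" by (rule lin_0[OF M.left_linear(1)])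
lemma r_zero: "r 0 a = 0" by (rule lin_0[OF M.right_linear(1)])
lemma l_alt: "l a (alt k m) = alt k (l a m)" by (rule additive_alt) (auto simp: l_add l_zero)
lemma r_alt: "r (alt k m) a = alt k (r m a)"
  by (rule additive_alt[of "\<lambda>m. r m a"]) (auto simp: r_add r_zero)
lemma l_sum: "l a (\<Sum>(x, w)\<leftarrow>L. f x w) = (\<Sum>(x, w)\<leftarrow>L. l a (f x w))"
  by (rule sum_list_additive_prod) (auto simp: l_add l_zero)
lemma r_sum: "r (\<Sum>(x, w)\<leftarrow>L. f x w) a = (\<Sum>(x, w)\<leftarrow>L. r (f x w) a)"
  by (rule sum_list_additive_prod[of "\<lambda>m. r m a"]) (auto simp: r_add r_zero)
lemma l_bd: "l a (bd g w) = bd (\<lambda>v. l a (g v)) w"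
  by (rule bd_additive) (auto simp: l_add l_zero)
lemma r_bd: "r (bd g w) a = bd (\<lambda>v. r (g v) a) w"
  by (rule bd_additive[of "\<lambda>m. r m a"]) (auto simp: r_add r_zero)

lemma lin_l: "lin s sM f \<Longrightarrow> lin s sM (\<lambda>x. l a (f x))" by (rule lin_comp[OF _ M.left_linear(1)])
lemma lin_r: "lin s sM f \<Longrightarrow> lin s sM (\<lambda>x. r (f x) a)" by (rule lin_comp[OF _ M.right_linear(1)])
lemma mlin_l: "mlin s sM g \<Longrightarrow> mlin s sM (\<lambda>w. l a (g w))" by (simp add: mlin_def lin_l)
lemma mlin_r: "mlin s sM g \<Longrightarrow> mlin s sM (\<lambda>w. r (g w) a)" by (simp add: mlin_def lin_r)
lemma lmlin_l: "mlin s sM g \<Longrightarrow> lmlin s sM (\<lambda>x w. l x (g w))"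
  by (simp add: lmlin_def mlin_l M.left_linear)
lemma rmlin_r: "mlin s sM g \<Longrightarrow> rmlin s sM (\<lambda>w x. r (g w) x)"
  by (simp add: rmlin_def mlin_r M.right_linear)

lemma bimodule_action_M: "bimodule_action UNIV l r"
  by unfold_locales
    (auto simp: l_add r_add M.left_one M.right_one M.left_mult M.right_mult M.left_right)

lemma mlin_zero: "mlin s sM (\<lambda>w. 0)" by (simp add: mlin_def lin_zero vs vsM)
lemma mlin_add: "mlin s sM g \<Longrightarrow> mlin s sM g' \<Longrightarrow> mlin s sM (\<lambda>w. g w + g' w)"
  by (simp add: mlin_def lin_add)
lemma mlin_uminus: "mlin s sM g \<Longrightarrow> mlin s sM (\<lambda>w. - g w)"
  by (simp add: mlin_def lin_uminus)

definition normalized :: "('a list \<Rightarrow> 'm) set"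
  where "normalized = {h. mlin s sM h \<and> (\<forall>w. 1 \<in> set w \<longrightarrow> h w = 0)}"

text \<open>The bimodule structures on \<open>Hom(T(H), M)\<close> and \<open>Hom(T(A), M)\<close> for which the two components of
  \<open>\<rho>\<close> are, up to sign, Hochschild differentials.\<close>

definition LA :: "'a \<Rightarrow> ('a list \<Rightarrow> 'm) \<Rightarrow> 'a list \<Rightarrow> 'm"
  where "LA a h = (\<lambda>bs. \<Sum>(x, w)\<leftarrow>pl bs a. l x (h w))"

definition RA :: "('a list \<Rightarrow> 'm) \<Rightarrow> 'a \<Rightarrow> 'a list \<Rightarrow> 'm"
  where "RA h a = (\<lambda>bs. r (h bs) a)"

definition LH :: "'a \<Rightarrow> ('a list \<Rightarrow> 'm) \<Rightarrow> 'a list \<Rightarrow> 'm"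
  where "LH b h = (\<lambda>as. l b (h as))"

definition RH :: "('a list \<Rightarrow> 'm) \<Rightarrow> 'a \<Rightarrow> 'a list \<Rightarrow> 'm"
  where "RH h b = (\<lambda>as. \<Sum>(v, z)\<leftarrow>pr as b. r (h v) z)"

lemma normalized_zero: "0 \<in> normalized"
  by (simp add: normalized_def zero_fun_def mlin_zero)

lemma normalized_add: "h \<in> normalized \<Longrightarrow> h' \<in> normalized \<Longrightarrow> h + h' \<in> normalized"
  by (simp add: normalized_def plus_fun_def mlin_add)

lemma normalized_minus: "h \<in> normalized \<Longrightarrow> - h \<in> normalized"
  by (simp add: normalized_def fun_Compl_def mlin_uminus)

lemma bimodule_action_A: "bimodule_action normalized LA RA"
proof
  fix m m' :: "'a list \<Rightarrow> 'm" and a b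
  show "LA a (m + m') = LA a m + LA a m'"
    by (simp add: LA_def l_add sum_list_prod_add fun_eq_iff)
  show "RA (m + m') a = RA m a + RA m' a"
    by (simp add: RA_def r_add fun_eq_iff)
  assume m: "m \<in> normalized"
  then have ml: "lmlin s sM (\<lambda>x w. l x (m w))" by (simp add: normalized_def lmlin_l)
  show "LA a m \<in> normalized"
    using mlin_pl[OF ml] pl_vanish[OF ml] m by (auto simp: normalized_def LA_def l_zero)
  show "RA m a \<in> normalized"
    using m by (simp add: normalized_def RA_def mlin_r r_zero)
  show "LA 1 m = m" by (simp add: LA_def pl_one[OF ml] M.left_one)
  show "RA m 1 = m" by (simp add: RA_def M.right_one)
  \<comment> \<open>\<open>a\<close> crosses the whole word and acts outermost, then
    \<open>b\<close> crosses the word left behind: the order given by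
    \<open>pl_mult\<close>.\<close>
  show "LA (a * b) m = LA a (LA b m)"
    by (simp add: LA_def pl_mult[OF ml] M.left_mult l_sum)
  show "RA m (a * b) = RA (RA m a) b" by (simp add: RA_def M.right_mult)
  show "RA (LA a m) b = LA a (RA m b)" by (simp add: LA_def RA_def r_sum M.left_right)
qed (simp_all add: normalized_zero normalized_add normalized_minus)

lemma bimodule_action_H: "bimodule_action normalized LH RH"
proof
  fix m m' :: "'a list \<Rightarrow> 'm" and a b
  show "LH a (m + m') = LH a m + LH a m'"
    by (simp add: LH_def l_add fun_eq_iff)
  show "RH (m + m') a = RH m a + RH m' a"
    by (simp add: RH_def r_add sum_list_prod_add fun_eq_iff)
  assume m: "m \<in> normalized"
  then have ml: "rmlin s sM (\<lambda>v z. r (m v) z)" by (simp add: normalized_def rmlin_r)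
  show "LH a m \<in> normalized"
    using m by (simp add: normalized_def LH_def mlin_l l_zero)
  show "RH m a \<in> normalized"
    using mlin_pr[OF ml] pr_vanish[OF ml] m by (auto simp: normalized_def RH_def r_zero)
  show "LH 1 m = m" by (simp add: LH_def M.left_one)
  show "RH m 1 = m" by (simp add: RH_def pr_one[OF ml] M.right_one)
  show "LH (a * b) m = LH a (LH b m)" by (simp add: LH_def M.left_mult)
  show "RH m (a * b) = RH (RH m a) b"
    by (simp add: RH_def pr_mult[OF ml] M.right_mult r_sum)
  show "RH (LH a m) b = LH a (RH m b)" by (simp add: LH_def RH_def l_sum M.left_right)
qed (simp_all add: normalized_zero normalized_add normalized_minus)

text \<open>The first component of \<open>\<rho>\<close> on words, without its sign
  \<open>(-1) ^ q\<close> and with the second word over all of \<open>A\<close>. The word of the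
  first factor of the double complex comes first, opposite to the order in
  \<open>sh\<close>.\<close>

definition dA :: "('a list \<Rightarrow> 'a list \<Rightarrow> 'm) \<Rightarrow> 'a list \<Rightarrow> 'a list \<Rightarrow> 'm"
  where "dA g as bs = (if as = [] then 0 else
    (\<Sum>(x, w)\<leftarrow>pl bs (hd as). l x (g (tl as) w)) + bd (\<lambda>v. g v bs) as + alt (length as) (r (g (butlast as) bs) (last as)))"

definition dH :: "('a list \<Rightarrow> 'a list \<Rightarrow> 'm) \<Rightarrow> 'a list \<Rightarrow> 'a list \<Rightarrow> 'm"
  where "dH g as bs = (if bs = [] then 0 else
    l (hd bs) (g as (tl bs)) + bd (g as) bs + alt (length bs) (\<Sum>(v, z)\<leftarrow>pr as (last bs). r (g v (butlast bs)) z))"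

text \<open>The sign, taken from the length of the second word, turns the commuting differentials
  \<open>dA\<close> and \<open>dH\<close> into anticommuting ones.\<close>

definition total_diff :: "('a list \<Rightarrow> 'a list \<Rightarrow> 'm) \<Rightarrow> 'a list \<Rightarrow> 'a list \<Rightarrow> 'm"
  where "total_diff g as bs = alt (length bs) (dA g as bs) + dH g as bs"

lemma bd_apply: "bd g w x = bd (\<lambda>v. g v x) w"
  by (rule bd_additive[of "\<lambda>h. h x"]) auto

lemma alt_apply: "alt k f x = alt k (f x)"
  by (simp add: alt_def)

lemma dA_hdiff: "dA g as = hdiff LA RA g as"
  by (simp add: fun_eq_iff dA_def hdiff_def LA_def RA_def bd_apply alt_apply)

lemma dH_hdiff: "(\<lambda>as. dH g as bs) = hdiff LH RH (\<lambda>bs as. g as bs) bs"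
  by (simp add: fun_eq_iff dH_def hdiff_def LH_def RH_def bd_apply alt_apply)

definition binormalized :: "('a list \<Rightarrow> 'a list \<Rightarrow> 'm) \<Rightarrow> bool"
  where "binormalized g \<longleftrightarrow> (\<forall>as. g as \<in> normalized) \<and> (\<forall>bs. (\<lambda>as. g as bs) \<in> normalized)"

text \<open>Multilinearity in the first word comes from the shape of the differential; in the second
  it is the closure of the coefficient space \<open>normalized\<close> under
  \<open>hdiff LA RA\<close>.\<close>

lemma binormalized_dA:
  assumes g: "binormalized g" shows "binormalized (dA g)"
proof -
  interpret bimodule_action normalized LA RA by (rule bimodule_action_A)
  have g1: "g as \<in> normalized" for as using g by (simp add: binormalized_def)
  have g2: "mlin s sM (\<lambda>as. g as bs)" for bs using g by (simp add: binormalized_def normalized_def)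
  have g3: "mlin s sM (g as)" for as using g1 by (simp add: normalized_def)
  have van: "g as = 0" if "1 \<in> set as" for as
    using g that by (auto simp: binormalized_def normalized_def fun_eq_iff)
  have "lmlin s sM (\<lambda>a v. \<Sum>(x, w)\<leftarrow>pl bs a. l x (g v w))" for bs
    by (intro lmlinI lin_pl lmlin_l g3 mlin_sum_list_prod vs vsM mlin_l g2)
  from mlin_hdiff_terms[OF this g2 rmlin_r[OF g2]] have "mlin s sM (\<lambda>as. dA g as bs)" for bs
    by (simp add: dA_def)
  moreover have "dA g as bs = 0" if "1 \<in> set as" for as bs
    using hdiff_vanish[of g as, OF g1 van that] by (simp add: dA_hdiff)
  moreover have "dA g as \<in> normalized" for as
    using hdiff_closed[of g, OF g1] by (simp add: dA_hdiff)
  ultimately show ?thesis by (simp add: binormalized_def normalized_def)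
qed

lemma binormalized_dH:
  assumes g: "binormalized g" shows "binormalized (dH g)"
proof -
  interpret bimodule_action normalized LH RH by (rule bimodule_action_H)
  have g1: "(\<lambda>as. g as bs) \<in> normalized" for bs using g by (simp add: binormalized_def)
  have g2: "mlin s sM (g as)" for as using g by (simp add: binormalized_def normalized_def)
  have g3: "mlin s sM (\<lambda>as. g as bs)" for bs using g1 by (simp add: normalized_def)
  have van: "(\<lambda>as. g as bs) = 0" if "1 \<in> set bs" for bs
    using g that by (auto simp: binormalized_def normalized_def fun_eq_iff)
  have "rmlin s sM (\<lambda>w b. \<Sum>(v, z)\<leftarrow>pr as b. r (g v w) z)" for as
    by (intro rmlinI lin_pr rmlin_r g3 mlin_sum_list_prod vs vsM mlin_r g2)
  from mlin_hdiff_terms[OF lmlin_l[OF g2] g2 this] have "mlin s sM (dH g as)" for as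
    by (simp add: dH_def[abs_def])
  moreover have "dH g as bs = 0" if "1 \<in> set bs" for as bs
    using hdiff_vanish[of "\<lambda>bs as. g as bs" bs, OF g1 van that] dH_hdiff[of g bs]
    by (metis zero_fun_def)
  moreover have "(\<lambda>as. dH g as bs) \<in> normalized" for bs
    using hdiff_closed[of "\<lambda>bs as. g as bs", OF g1] by (simp add: dH_hdiff)
  ultimately show ?thesis by (simp add: binormalized_def normalized_def)
qed

lemma binormalized_add: "binormalized g \<Longrightarrow> binormalized g' \<Longrightarrow> binormalized (\<lambda>as bs. g as bs + g' as bs)"
  by (simp add: binormalized_def normalized_def mlin_add)

lemma binormalized_alt:
  assumes "binormalized g" shows "binormalized (\<lambda>as bs. alt (length bs) (g as bs))"
  using assms unfolding binormalized_def normalized_def mlin_def length_append list.size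
  by (simp del: alt_Suc add: lin_alt)

lemma binormalized_total_diff: "binormalized g \<Longrightarrow> binormalized (total_diff g)"
  unfolding total_diff_def[abs_def]
  by (intro binormalized_add binormalized_alt[of "dA g"] binormalized_dA binormalized_dH)

lemma dA_dA: "binormalized g \<Longrightarrow> dA (dA g) as bs = 0"
proof -
  interpret bimodule_action normalized LA RA by (rule bimodule_action_A)
  assume "binormalized g"
  then have "hdiff LA RA (hdiff LA RA g) as = 0" by (intro hdiff_hdiff) (simp add: binormalized_def)
  moreover have "dA (dA g) as = hdiff LA RA (hdiff LA RA g) as"
    by (simp add: dA_hdiff[abs_def])
  ultimately show ?thesis by simp
qed

lemma dH_dH: "binormalized g \<Longrightarrow> dH (dH g) as bs = 0"
proof -
  interpret bimodule_action normalized LH RH by (rule bimodule_action_H)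
  assume "binormalized g"
  then have "hdiff LH RH (hdiff LH RH (\<lambda>bs as. g as bs)) bs = 0"
    by (intro hdiff_hdiff) (simp add: binormalized_def)
  moreover have "(\<lambda>as. dH (dH g) as bs) = hdiff LH RH (hdiff LH RH (\<lambda>bs as. g as bs)) bs"
    unfolding dH_hdiff[of "dH g"] unfolding dH_hdiff ..
  ultimately show ?thesis by (metis zero_fun_def)
qed

lemma dA_add: "dA (\<lambda>as bs. g as bs + g' as bs) as bs = dA g as bs + dA g' as bs"
  by (simp add: dA_def l_add r_add bd_add alt_plus sum_list_prod_add)

lemma dH_add: "dH (\<lambda>as bs. g as bs + g' as bs) as bs = dH g as bs + dH g' as bs"
  by (simp add: dH_def l_add r_add bd_add alt_plus sum_list_prod_add)

lemma dA_alt: "dA (\<lambda>as bs. alt (length bs) (g as bs)) as bs = alt (length bs) (dA g as bs)"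
proof -
  have "(\<Sum>(x, w)\<leftarrow>pl bs a. l x (alt (length w) (h w))) = alt (length bs) (\<Sum>(x, w)\<leftarrow>pl bs a. l x (h w))" for a h
    unfolding alt_sum_list by (intro sum_list_cong_prod) (simp add: length_pl l_alt)
  then show ?thesis by (simp add: dA_def alt_plus bd_alt r_alt alt_alt add.commute)
qed

text \<open>\<open>dH\<close> evaluates its argument at a second word shorter by one letter, whence
  the extra sign; \<open>dA\<close> keeps that length.\<close>

lemma dH_alt: "dH (\<lambda>as bs. alt (length bs) (g as bs)) as bs = - alt (length bs) (dH g as bs)"
proof (cases bs rule: rev_cases)
  case (snoc w b)
  have "bd (\<lambda>v. alt (length v) (g as v)) bs = bd (\<lambda>v. alt (length w) (g as v)) bs"
    by (rule bd_cong) (simp add: snoc)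
  moreover have "length (tl bs) = length w" by (simp add: snoc)
  ultimately show ?thesis using snoc
    by (simp add: dH_def alt_plus alt_minus bd_alt l_alt r_alt alt_alt alt_sum_list sum_list_prod_minus alt_diff)
qed (simp add: dH_def)

text \<open>Each differential has a left, a middle and a right term, and the nine pairs commute
  separately. In \<open>11\<close> and \<open>33\<close> both letters act on \<open>M\<close> from
  the same side and \<open>br_mult\<close> is needed; \<open>12\<close> and \<open>23\<close> slide
  faces through a passage; \<open>31\<close> is the bimodule law.\<close>

lemma dA_dH: "binormalized g \<Longrightarrow> dA (dH g) as bs = dH (dA g) as bs"
proof -
  assume g: "binormalized g"
  have g1: "mlin s sM (g as)" for as using g by (simp add: binormalized_def normalized_def)
  have g2: "mlin s sM (\<lambda>as. g as bs)" for bs using g by (simp add: binormalized_def normalized_def)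
  consider "as = []" | "bs = []" | "as \<noteq> []" "bs \<noteq> []" by blast
  then show ?thesis
  proof cases
    case 1
    then show ?thesis by (simp add: dA_def dH_def bd_def l_zero r_zero)
  next
    case 2
    then show ?thesis by (simp add: dA_def dH_def bd_def l_zero r_zero)
  next
    case 3
    obtain a as1 where as1: "as = a # as1" using 3 by (cases as) auto
    obtain as2 a' where as2: "as = as2 @ [a']" using 3 by (cases as rule: rev_cases) auto
    obtain b bs1 where bs1: "bs = b # bs1" using 3 by (cases bs) auto
    obtain bs2 b' where bs2: "bs = bs2 @ [b']" using 3 by (cases bs rule: rev_cases) auto
    let ?lA = "\<lambda>g as bs. \<Sum>(x, w)\<leftarrow>pl bs (hd as). l x (g (tl as) w)"
    let ?mA = "\<lambda>g as bs. bd (\<lambda>v. g v bs) as"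
    let ?kA = "\<lambda>g as bs. r (g (butlast as) bs) (last as)"
    let ?lH = "\<lambda>g as bs. l (hd bs) (g as (tl bs))"
    let ?mH = "\<lambda>g as bs. bd (g as) bs"
    let ?kH = "\<lambda>g as bs. \<Sum>(v, z)\<leftarrow>pr as (last bs). r (g v (butlast bs)) z"
    have 11: "?lA (?lH g) as bs = ?lH (?lA g) as bs"
    proof -
      have "?lA (?lH g) as bs = (\<Sum>(x, w)\<leftarrow>pl bs1 a. \<Sum>(x', y)\<leftarrow>br b x. l (x' * y) (g as1 w))"
        unfolding as1 bs1 sum_pl_Cons by (simp add: M.left_mult)
      \<comment> \<open>The crossing of \<open>a\<close> with \<open>b\<close> is the last one of
        the passage, and its two outputs act as a product.\<close>
      also have "\<dots> = (\<Sum>(x, w)\<leftarrow>pl bs1 a. l (b * x) (g as1 w))"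
        by (intro sum_list_cong_prod br_mult[where sV = sM] M.left_linear)
      finally show ?thesis by (simp add: as1 bs1 M.left_mult l_sum)
    qed
    have 12: "?lA (?mH g) as bs = ?mH (?lA g) as bs"
      using pl_bd[OF lmlin_l[OF g1]] by (simp add: l_bd)
    \<comment> \<open>Here \<open>a\<close> meets \<open>b'\<close> first of all; once this crossing
      is split off, \<open>u\<close> passes through \<open>bs2\<close> and \<open>y\<close> through
      \<open>as1\<close> independently.\<close>
    have 13: "?lA (?kH g) as bs = ?kH (?lA g) as bs"
    proof -
      have "?lA (?kH g) as bs
          = (\<Sum>(u, y)\<leftarrow>br b' a. \<Sum>(x, w)\<leftarrow>pl bs2 u. \<Sum>(v, z)\<leftarrow>pr as1 y. l x (r (g v w) z))"
        unfolding as1 bs2 list.sel sum_pl_snoc by (simp add: l_sum)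
      also have "\<dots> = (\<Sum>(u, y)\<leftarrow>br b' a. \<Sum>(v, z)\<leftarrow>pr as1 y. \<Sum>(x, w)\<leftarrow>pl bs2 u. l x (r (g v w) z))"
        by (rule sum_list_cong_prod, rule sum_list_swap_prod)
      also have "\<dots> = ?kH (?lA g) as bs"
        unfolding as1 bs2 last_snoc butlast_snoc sum_pr_Cons list.sel r_sum M.left_right ..
      finally show ?thesis .
    qed
    have 21: "?mA (?lH g) as bs = ?lH (?mA g) as bs" by (simp add: l_bd)
    have 22: "?mA (?mH g) as bs = ?mH (?mA g) as bs"
      unfolding bd_def alt_sum alt_alt by (subst sum.swap) (simp add: add.commute)
    have 23: "?mA (?kH g) as bs = ?kH (?mA g) as bs"
      using pr_bd[OF rmlin_r[OF g2]] by (simp add: r_bd)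
    have 31: "?kA (?lH g) as bs = ?lH (?kA g) as bs" by (simp add: M.left_right)
    have 32: "?kA (?mH g) as bs = ?mH (?kA g) as bs" by (simp add: r_bd)
    have 33: "?kA (?kH g) as bs = ?kH (?kA g) as bs"
    proof -
      have "?kH (?kA g) as bs = (\<Sum>(v, y)\<leftarrow>pr as2 b'. \<Sum>(x, z)\<leftarrow>br y a'. r (g v bs2) (x * z))"
        unfolding as2 bs2 last_snoc butlast_snoc sum_pr_snoc by (simp add: M.right_mult)
      also have "\<dots> = (\<Sum>(v, y)\<leftarrow>pr as2 b'. r (g v bs2) (y * a'))"
        by (intro sum_list_cong_prod br_mult[where sV = sM] M.right_linear)
      finally show ?thesis by (simp add: as2 bs2 M.right_mult r_sum)
    qed
    have A: "dA f as bs = ?lA f as bs + ?mA f as bs + alt (length as) (?kA f as bs)" for f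
      using 3 by (simp add: dA_def)
    have H: "dH f as bs = ?lH f as bs + ?mH f as bs + alt (length bs) (?kH f as bs)" for f
      using 3 by (simp add: dH_def)
    have "dA (dH g) as bs =
        ?lA (?lH g) as bs + ?lA (?mH g) as bs + alt (length bs) (?lA (?kH g) as bs) +
        (?mA (?lH g) as bs + ?mA (?mH g) as bs + alt (length bs) (?mA (?kH g) as bs)) +
        alt (length as) (?kA (?lH g) as bs + ?kA (?mH g) as bs + alt (length bs) (?kA (?kH g) as bs))"
    proof -
      \<comment> \<open>A word left by the passage has the length of \<open>bs\<close>, so it is
        nonempty and \<open>dH\<close> has the same sign in every summand.\<close>
      have "?lA (dH g) as bs = (\<Sum>(x, w)\<leftarrow>pl bs (hd as).
          l x (?lH g (tl as) w) + l x (?mH g (tl as) w) + alt (length bs) (l x (?kH g (tl as) w)))"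
      proof (rule sum_list_cong_prod)
        fix x w assume "(x, w) \<in> set (pl bs (hd as))"
        then have "length w = length bs" by (rule length_pl)
        moreover from this have "w \<noteq> []" using 3 by auto
        ultimately show "l x (dH g (tl as) w) =
            l x (?lH g (tl as) w) + l x (?mH g (tl as) w) + alt (length bs) (l x (?kH g (tl as) w))"
          by (simp add: dH_def l_add l_alt)
      qed
      then have "?lA (dH g) as bs = ?lA (?lH g) as bs + ?lA (?mH g) as bs + alt (length bs) (?lA (?kH g) as bs)"
        by (simp only: sum_list_prod_add alt_sum_list)
      moreover have "?mA (dH g) as bs = ?mA (?lH g) as bs + ?mA (?mH g) as bs + alt (length bs) (?mA (?kH g) as bs)"
        using 3 by (simp add: dH_def bd_add bd_alt)
      moreover have "?kA (dH g) as bs = ?kA (?lH g) as bs + ?kA (?mH g) as bs + alt (length bs) (?kA (?kH g) as bs)"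
        using 3 by (simp add: dH_def r_add r_alt)
      ultimately show ?thesis unfolding A by simp
    qed
    moreover have "dH (dA g) as bs =
        ?lH (?lA g) as bs + ?lH (?mA g) as bs + alt (length as) (?lH (?kA g) as bs) +
        (?mH (?lA g) as bs + ?mH (?mA g) as bs + alt (length as) (?mH (?kA g) as bs)) +
        alt (length bs) (?kH (?lA g) as bs + ?kH (?mA g) as bs + alt (length as) (?kH (?kA g) as bs))"
    proof -
      have "?kH (dA g) as bs = (\<Sum>(v, z)\<leftarrow>pr as (last bs).
          r (?lA g v (butlast bs)) z + r (?mA g v (butlast bs)) z + alt (length as) (r (?kA g v (butlast bs)) z))"
      proof (rule sum_list_cong_prod)
        fix v z assume "(v, z) \<in> set (pr as (last bs))"
        then have "length v = length as" by (rule length_pr)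
        moreover from this have "v \<noteq> []" using 3 by auto
        ultimately show "r (dA g v (butlast bs)) z =
            r (?lA g v (butlast bs)) z + r (?mA g v (butlast bs)) z + alt (length as) (r (?kA g v (butlast bs)) z)"
          by (simp add: dA_def r_add r_alt)
      qed
      then have "?kH (dA g) as bs = ?kH (?lA g) as bs + ?kH (?mA g) as bs + alt (length as) (?kH (?kA g) as bs)"
        by (simp only: sum_list_prod_add alt_sum_list)
      moreover have "?mH (dA g) as bs = ?mH (?lA g) as bs + ?mH (?mA g) as bs + alt (length as) (?mH (?kA g) as bs)"
        using 3 by (simp add: dA_def[abs_def] bd_add bd_alt)
      moreover have "?lH (dA g) as bs = ?lH (?lA g) as bs + ?lH (?mA g) as bs + alt (length as) (?lH (?kA g) as bs)"
        using 3 by (simp add: dA_def l_add l_alt)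
      ultimately show ?thesis unfolding H by simp
    qed
    ultimately show ?thesis
      unfolding 11 12 13 21 22 23 31 32 33
      by (simp add: alt_plus alt_alt add.commute add.left_commute add.assoc)
  qed
qed

lemma total_diff_total_diff:
  assumes g: "binormalized g" shows "total_diff (total_diff g) as bs = 0"
proof -
  have "dA (total_diff g) as bs = alt (length bs) (dA (dA g) as bs) + dA (dH g) as bs"
    unfolding total_diff_def[abs_def] by (simp add: dA_add dA_alt)
  moreover have "dH (total_diff g) as bs = - alt (length bs) (dH (dA g) as bs) + dH (dH g) as bs"
    unfolding total_diff_def[abs_def] by (simp add: dH_add dH_alt)
  ultimately show ?thesis
    by (simp add: total_diff_def[of "total_diff g"] dA_dA[OF g] dH_dH[OF g] dA_dH[OF g])
qed

lemma total_diff_add: "total_diff (\<lambda>as bs. g as bs + g' as bs) as bs = total_diff g as bs + total_diff g' as bs"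
  by (simp add: total_diff_def dA_add dH_add alt_plus)

lemma scale_bd: "sM c (bd f w) = bd (\<lambda>v. sM c (f v)) w"
  by (rule bd_additive) (auto simp: M.scale_right_distrib)

lemma scale_alt: "sM c (alt k m) = alt k (sM c m)"
  by (rule additive_alt) (auto simp: M.scale_right_distrib)

lemma l_scale: "l a (sM c m) = sM c (l a m)"
  using M.left_linear(1) by (simp add: Vector_Spaces.linear_iff)

lemma r_scale: "r (sM c m) a = sM c (r m a)"
  using M.right_linear(1) by (simp add: Vector_Spaces.linear_iff)

lemma scale_sum_list: "sM c (\<Sum>(x, w)\<leftarrow>L. f x w) = (\<Sum>(x, w)\<leftarrow>L. sM c (f x w))"
  by (rule sum_list_additive_prod) (auto simp: M.scale_right_distrib)

lemma total_diff_scale: "total_diff (\<lambda>as bs. sM c (g as bs)) as bs = sM c (total_diff g as bs)"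
  by (simp add: total_diff_def dA_def dH_def l_scale r_scale scale_sum_list scale_bd scale_alt M.scale_right_distrib)

lemma binormalized_sh:
  assumes "f \<in> normalized" shows "binormalized (\<lambda>as bs. sh f bs as)"
  using assms sh_vanish[of sM f]
  by (auto simp: binormalized_def normalized_def mlin_sh_left mlin_sh_right)

text \<open>The signs match as follows: the right Hochschild term has exponent
  \<open>length bs + length as\<close>; when the last letter comes from \<open>bs\<close>, its
  crossings contribute \<open>length as\<close> again, and \<open>length bs\<close> is left, as in
  \<open>dH\<close>.\<close>

lemma sh_hdiff:
  assumes f: "mlin s sM f"
  shows "sh (hdiff l r f) bs as = total_diff (\<lambda>as bs. sh f bs as) as bs"
proof (cases "as = [] \<and> bs = []")
  case True
  then show ?thesis by (simp add: hdiff_def total_diff_def dA_def dH_def)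
next
  case False
  have "sh (hdiff l r f) bs as = sh (\<lambda>w. l (hd w) (f (tl w)) + bd f w +
      alt (length bs + length as) (r (f (butlast w)) (last w))) bs as"
    using False by (intro sh_cong) (auto simp: hdiff_def)
  also have "\<dots> = sh (\<lambda>w. l (hd w) (f (tl w))) bs as + sh (bd f) bs as +
      alt (length bs + length as) (sh (\<lambda>w. r (f (butlast w)) (last w)) bs as)"
    by (simp only: sh_add sh_alt)
  also have "sh (\<lambda>w. l (hd w) (f (tl w))) bs as = (if bs = [] then 0 else l (hd bs) (sh f (tl bs) as)) +
      (if as = [] then 0 else alt (length bs) (\<Sum>(x, w)\<leftarrow>pl bs (hd as). l x (sh f w (tl as))))"
  proof -
    have sl: "sh (\<lambda>w. l x (f w)) bs as = l x (sh f bs as)" for x bs as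
      by (rule sh_additive) (auto simp: l_add l_zero)
    show ?thesis
    proof (cases bs)
      case Nil
      then show ?thesis using False sh_left[of "\<lambda>w. l (hd w) (f (tl w))" "[]" "hd as" "tl as"] by (simp add: sl)
    next
      case (Cons b bs')
      then show ?thesis using sh_left'[of "\<lambda>w. l (hd w) (f (tl w))" b bs' as] by (simp add: sl)
    qed
  qed
  also have "sh (\<lambda>w. r (f (butlast w)) (last w)) bs as = (if as = [] then 0 else r (sh f bs (butlast as)) (last as)) +
      (if bs = [] then 0 else alt (length as) (\<Sum>(v, z)\<leftarrow>pr as (last bs). r (sh f (butlast bs) v) z))"
  proof -
    have sr: "sh (\<lambda>w. r (f w) x) bs as = r (sh f bs as) x" for x bs as
      by (rule sh_additive[of "\<lambda>m. r m x"]) (auto simp: r_add r_zero)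
    show ?thesis
    proof (cases bs rule: rev_cases)
      case Nil
      then show ?thesis using False by (simp add: sh_Nil1)
    next
      case bs: (snoc bs' b)
      show ?thesis
      proof (cases as rule: rev_cases)
        case Nil
        then show ?thesis using bs by (simp add: sh_Nil2)
      next
        case (snoc as' a)
        then show ?thesis using bs by (simp add: sh_snoc_snoc sr)
      qed
    qed
  qed
  finally show ?thesis
    unfolding sh_bd[OF f] total_diff_def dA_def dH_def
    by (simp add: alt_absorb alt_plus alt_alt add.commute add.left_commute add.assoc)
qed

end


section \<open>Reduced decompositions of shuffles\<close>

definition swap_at :: "nat \<Rightarrow> 'b list \<Rightarrow> 'b list"
  where "swap_at i z = z[i - 1 := z ! i, i := z ! (i - 1)]"

lemma swap_at_append: "swap_at (Suc (length u)) (u @ c # d # v) = u @ d # c # v"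
  by (simp add: swap_at_def nth_append list_update_append)

lemma length_swap_at [simp]: "length (swap_at i z) = length z"
  by (simp add: swap_at_def)

lemma length_foldr_swap_at [simp]: "length (foldr swap_at is z) = length z"
  by (induction "is") auto

lemma inversions_append: "inversions (u @ v) = inversions u + inversions v + count_list u False * count_list v True"
  by (induction u) (auto simp: algebra_simps)

lemma inversions_swap: "inversions (u @ False # True # v) = Suc (inversions (u @ True # False # v))"
  by (simp add: inversions_append)

text \<open>An adjacent swap affects only the pair it exchanges. Along a decomposition this bounds
  the inversions by its length, hence reduced words from below.\<close>

lemma inversions_swap_at:
  assumes "0 < i" "i < length z"
  shows "inversions (swap_at i z) \<le> Suc (inversions z)"
proof -
  obtain u c d v where "z = u @ c # d # v" "i = Suc (length u)" using assms by (rule split_at_pair)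
  then show ?thesis by (cases c; cases d) (auto simp: swap_at_append inversions_append)
qed

definition sorted_word :: "nat \<Rightarrow> nat \<Rightarrow> bool list"
  where "sorted_word q p = replicate q True @ replicate p False"

lemma count_list_replicate: "count_list (replicate n x) y = (if x = y then n else 0)"
  by (induction n) auto

lemma inversions_replicate: "inversions (replicate n c) = 0"
  by (induction n) (auto simp: count_list_replicate)

lemma inversions_sorted_word: "inversions (sorted_word q p) = 0"
  by (simp add: sorted_word_def inversions_append inversions_replicate count_list_replicate)

lemma length_sorted_word: "length (sorted_word q p) = q + p"
  by (simp add: sorted_word_def)

lemma inversions_foldr_swap_at:
  "set is \<subseteq> {1..<q + p} \<Longrightarrow> inversions (foldr swap_at is (sorted_word q p)) \<le> length is"
proof (induction "is")
  case (Cons i "is")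
  then have "inversions (swap_at i (foldr swap_at is (sorted_word q p))) \<le> Suc (inversions (foldr swap_at is (sorted_word q p)))"
    by (intro inversions_swap_at) (auto simp: length_sorted_word)
  then show ?case using Cons by simp
qed (simp add: inversions_sorted_word)

lemma sorted_word_unique:
  assumes "\<And>u v. z \<noteq> u @ False # True # v"
  shows "z = sorted_word (count_list z True) (count_list z False)"
  using assms
proof (induction z)
  case (Cons c z)
  have "z \<noteq> u @ False # True # v" for u v using Cons.prems[of "c # u" v] by simp
  then have IH: "z = sorted_word (count_list z True) (count_list z False)" by (rule Cons.IH)
  show ?case
  proof (cases c)
    case True
    then show ?thesis by (subst IH) (simp add: sorted_word_def)
  next
    case False
    have "count_list z True = 0"
    proof (rule ccontr)
      assume "count_list z True \<noteq> 0"
      then obtain k where "count_list z True = Suc k" using not0_implies_Suc by blast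
      then have "z = True # replicate k True @ replicate (count_list z False) False"
        by (subst IH) (simp add: sorted_word_def)
      then show False using Cons.prems[of "[]"] False by auto
    qed
    then show ?thesis using IH False by (simp add: sorted_word_def)
  qed
qed (simp add: sorted_word_def)

definition perm_of :: "nat list \<Rightarrow> nat \<Rightarrow> nat"
  where "perm_of is = foldr (\<lambda>i f. transpose i (i + 1) \<circ> f) is id"

lemma perm_of_Nil [simp]: "perm_of [] = id"
  by (simp add: perm_of_def)

lemma perm_of_Cons [simp]: "perm_of (i # is) = transpose i (i + 1) \<circ> perm_of is"
  by (simp add: perm_of_def)

lemma decomposition_perm_of: "decomposition n w is \<longleftrightarrow> set is \<subseteq> {1..<n} \<and> w = perm_of is"
  by (simp only: decomposition_def perm_of_def)

text \<open>The inverse appears because \<open>w\<close> sends a position to its target: the entry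
  for \<open>k\<close> tells whether the letter arriving at \<open>k\<close> is one of the first
  \<open>q\<close>.\<close>

definition origins :: "nat \<Rightarrow> nat \<Rightarrow> (nat \<Rightarrow> nat) \<Rightarrow> bool list"
  where "origins q n w = map (\<lambda>k. inv w k \<le> q) [1..<Suc n]"

lemma length_origins: "length (origins q n w) = n"
  by (simp add: origins_def del: upt_Suc)

lemma bij_perm_of: "bij (perm_of is)"
proof (induction "is")
  case (Cons i "is")
  then show ?case unfolding perm_of_Cons by (intro bij_comp) auto
qed (simp add: bij_id[unfolded id_def] id_def)

text \<open>Composing with an adjacent transposition on the left exchanges two neighbouring targets,
  hence two neighbouring entries.\<close>

lemma origins_perm_of:
  "set is \<subseteq> {1..<q + p} \<Longrightarrow> origins q (q + p) (perm_of is) = foldr swap_at is (sorted_word q p)"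
proof (induction "is")
  case Nil
  show ?case
    by (auto simp: origins_def sorted_word_def nth_append intro!: nth_equalityI simp del: upt_Suc split: if_splits)
next
  case (Cons i "is")
  then have i: "0 < i" "i < q + p" by auto
  have inv: "inv (perm_of (i # is)) k = inv (perm_of is) (transpose i (i + 1) k)" for k
    using o_inv_distrib[of "transpose i (i + 1)" "perm_of is"] bij_perm_of by (simp add: fun_eq_iff)
  have "origins q (q + p) (perm_of (i # is)) = swap_at i (origins q (q + p) (perm_of is))"
  proof (rule nth_equalityI)
    fix j assume "j < length (origins q (q + p) (perm_of (i # is)))"
    then have j: "j < q + p" by (simp add: origins_def del: upt_Suc)
    show "origins q (q + p) (perm_of (i # is)) ! j = swap_at i (origins q (q + p) (perm_of is)) ! j"
      unfolding origins_def inv using i j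
      by (auto simp: swap_at_def nth_list_update transpose_def simp del: upt_Suc)
  qed (simp add: origins_def)
  also have "\<dots> = foldr swap_at (i # is) (sorted_word q p)" using Cons by simp
  finally show ?case .
qed

lemma perm_of_permutes: "set is \<subseteq> {1..<n} \<Longrightarrow> perm_of is permutes {1..n}"
proof (induction "is")
  case (Cons i "is")
  then have "transpose i (i + 1) permutes {1..n}" by (intro permutes_swap_id) auto
  then show ?case unfolding perm_of_Cons using Cons by (intro permutes_compose) auto
qed (simp add: permutes_id)

text \<open>Replacing an adjacent \<open>False\<close>, \<open>True\<close> by \<open>True\<close>,
  \<open>False\<close> lowers the inversions by one, and one transposition undoes it; so a
  decomposition as short as the inversions allow can be built inside the shuffles.\<close>

lemma shuffle_perm_exists:
  "z \<in> shuffle_words q p \<Longrightarrow> \<exists>is. set is \<subseteq> {1..<q + p} \<and> length is = inversions z \<and>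
    foldr swap_at is (sorted_word q p) = z \<and> perm_of is \<in> shuffle_perms q (q + p)"
proof (induction "inversions z" arbitrary: z rule: less_induct)
  case less
  show ?case
  proof (cases "\<exists>u v. z = u @ False # True # v")
    case False
    then have "z = sorted_word (count_list z True) (count_list z False)" by (intro sorted_word_unique) auto
    then have "z = sorted_word q p" using less.prems by (simp add: shuffle_words_def)
    then show ?thesis
      by (intro exI[of _ "[]"]) (auto simp: inversions_sorted_word shuffle_perms_def permutes_id strict_mono_on_def)
  next
    case True
    then obtain u v where z: "z = u @ False # True # v" by blast
    let ?z = "u @ True # False # v" and ?i = "Suc (length u)"
    have zs: "?z \<in> shuffle_words q p" using less.prems by (simp add: z shuffle_words_def)
    then obtain "is" where "is": "set is \<subseteq> {1..<q + p}" "length is = inversions ?z"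
        "foldr swap_at is (sorted_word q p) = ?z" and w: "perm_of is \<in> shuffle_perms q (q + p)"
      using less.hyps[of ?z] by (auto simp: z inversions_swap)
    have len: "length z = q + p" using less.prems length_count_bool[of z] by (simp add: shuffle_words_def)
    then have i: "?i < q + p" by (simp add: z)
    let ?w = "perm_of is"
    have o: "origins q (q + p) ?w = ?z" using origins_perm_of[OF "is"(1)] "is"(3) by simp
    have nth: "origins q (q + p) ?w ! k = (inv ?w (Suc k) \<le> q)" if "k < q + p" for k
      using that by (simp add: origins_def del: upt_Suc)
    have "inv ?w ?i \<le> q" "\<not> inv ?w (Suc ?i) \<le> q"
      using nth[of "length u"] nth[of ?i] i by (simp_all add: o nth_append)
    \<comment> \<open>The letters arriving at \<open>?i\<close> and \<open>Suc ?i\<close> come from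
      different blocks, so exchanging their targets disturbs no order inside a block.\<close>
    then have 1: "j \<le> q" if "?w j = ?i" for j using that bij_perm_of[of "is"] by (metis bij_inv_eq_iff)
    have 2: "\<not> j \<le> q" if "?w j = Suc ?i" for j
      using that bij_perm_of[of "is"] \<open>\<not> inv ?w (Suc ?i) \<le> q\<close> by (metis bij_inv_eq_iff)
    have sm: "strict_mono_on {1..q} ?w" "strict_mono_on {q + 1..q + p} ?w"
      using w by (auto simp: shuffle_perms_def)
    have tr: "transpose ?i (?i + 1) x < transpose ?i (?i + 1) y" if "x < y" "\<not> (x = ?i \<and> y = Suc ?i)" for x y
      using that by (auto simp: transpose_def)
    have "perm_of (?i # is) \<in> shuffle_perms q (q + p)"
      unfolding shuffle_perms_def mem_Collect_eq
    proof (intro conjI)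
      show "perm_of (?i # is) permutes {1..q + p}" using i "is"(1) by (intro perm_of_permutes) auto
      show "strict_mono_on {1..q} (perm_of (?i # is))"
      proof (rule strict_mono_onI)
        fix j k assume "j \<in> {1..q}" "k \<in> {1..q}" "j < k"
        then have "?w j < ?w k" "\<not> (?w j = ?i \<and> ?w k = Suc ?i)"
          using sm(1) 2[of k] by (auto simp: strict_mono_on_def)
        then show "perm_of (?i # is) j < perm_of (?i # is) k" using tr by simp
      qed
      show "strict_mono_on {q + 1..q + p} (perm_of (?i # is))"
      proof (rule strict_mono_onI)
        fix j k assume "j \<in> {q + 1..q + p}" "k \<in> {q + 1..q + p}" "j < k"
        then have "?w j < ?w k" "\<not> (?w j = ?i \<and> ?w k = Suc ?i)"
          using sm(2) 1[of j] by (auto simp: strict_mono_on_def)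
        then show "perm_of (?i # is) j < perm_of (?i # is) k" using tr by simp
      qed
    qed
    then show ?thesis
      using "is" i by (intro exI[of _ "?i # is"]) (auto simp: z inversions_swap swap_at_append)
  qed
qed

text \<open>A strictly increasing function on an interval lists its image in order.\<close>

lemma strict_mono_on_image_eq:
  fixes f g :: "nat \<Rightarrow> nat"
  assumes "strict_mono_on {a..b} f" "strict_mono_on {a..b} g" "f ` {a..b} = g ` {a..b}" "x \<in> {a..b}"
  shows "f x = g x"
proof -
  have sd: "sorted (map h [a..<Suc b]) \<and> distinct (map h [a..<Suc b])" if "strict_mono_on {a..b} h" for h :: "nat \<Rightarrow> nat"
  proof -
    have "sorted_wrt (<) (map h [a..<Suc b])"
      by (auto simp: sorted_wrt_iff_nth_less simp del: upt_Suc intro!: strict_mono_onD[OF that])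
    then show ?thesis by (simp add: strict_sorted_iff del: upt_Suc)
  qed
  have "map f [a..<Suc b] = map g [a..<Suc b]"
    using sd[OF assms(1)] sd[OF assms(2)] assms(3)
    by (intro sorted_distinct_set_unique) (auto simp: atLeastLessThanSuc_atLeastAtMost simp del: upt_Suc)
  then show ?thesis using assms(4) by (simp add: atLeastLessThanSuc_atLeastAtMost del: upt_Suc)
qed

lemma image_origins:
  assumes "w permutes {1..q + p}"
  shows "w ` {1..q} = {k \<in> {1..q + p}. origins q (q + p) w ! (k - 1)}"
proof -
  have o: "origins q (q + p) w ! (k - 1) = (inv w k \<le> q)" if "k \<in> {1..q + p}" for k
    using that by (auto simp: origins_def simp del: upt_Suc)
  show ?thesis
  proof (intro equalityI subsetI)
    fix k assume "k \<in> w ` {1..q}"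
    then obtain j where j: "j \<in> {1..q}" "k = w j" by auto
    moreover have "k \<in> {1..q + p}" using j permutes_in_image[OF assms] by auto
    moreover have "inv w k = j" using j permutes_inverses(2)[OF assms] by simp
    ultimately show "k \<in> {k \<in> {1..q + p}. origins q (q + p) w ! (k - 1)}" using o by auto
  next
    fix k assume k: "k \<in> {k \<in> {1..q + p}. origins q (q + p) w ! (k - 1)}"
    then have "inv w k \<in> {1..q}" using o permutes_in_image[OF permutes_inv[OF assms], of k] by auto
    moreover have "k = w (inv w k)" using permutes_inverses(1)[OF assms] by simp
    ultimately show "k \<in> w ` {1..q}" by blast
  qed
qed

text \<open>The word of origins determines the image of each block, and a shuffle is increasing on
  both blocks.\<close>

lemma inj_on_origins: "inj_on (origins q (q + p)) (shuffle_perms q (q + p))"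
proof (rule inj_onI, rule ext)
  fix w w' x
  assume w: "w \<in> shuffle_perms q (q + p)" and w': "w' \<in> shuffle_perms q (q + p)"
    and eq: "origins q (q + p) w = origins q (q + p) w'"
  have pw: "w permutes {1..q + p}" "w' permutes {1..q + p}" using w w' by (auto simp: shuffle_perms_def)
  have im: "w ` {1..q} = w' ` {1..q}" using image_origins[OF pw(1)] image_origins[OF pw(2)] eq by simp
  have split: "{q + 1..q + p} = {1..q + p} - {1..q}" by auto
  have "v ` {q + 1..q + p} = {1..q + p} - v ` {1..q}" if "v permutes {1..q + p}" for v
    unfolding split using permutes_image[OF that] permutes_inj[OF that] by (simp add: image_set_diff)
  then have im2: "w ` {q + 1..q + p} = w' ` {q + 1..q + p}" using pw im by simp
  consider "x \<in> {1..q}" | "x \<in> {q + 1..q + p}" | "x \<notin> {1..q + p}" by fastforce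
  then show "w x = w' x"
  proof cases
    case 1
    then show ?thesis using w w' im by (intro strict_mono_on_image_eq) (auto simp: shuffle_perms_def)
  next
    case 2
    then show ?thesis using w w' im2 by (intro strict_mono_on_image_eq) (auto simp: shuffle_perms_def)
  next
    case 3
    then show ?thesis using pw by (metis permutes_not_in)
  qed
qed

lemma origins_shuffle_word:
  assumes "w permutes {1..q + p}"
  shows "origins q (q + p) w \<in> shuffle_words q p"
proof -
  have cnt: "count_list (map P xs) True = length (filter P xs)" for P :: "nat \<Rightarrow> bool" and xs
    by (induction xs) auto
  have "{k \<in> {1..q + p}. inv w k \<le> q} = w ` {1..q}"
    unfolding image_origins[OF assms] by (auto simp: origins_def simp del: upt_Suc)
  then have "card {k \<in> {1..q + p}. inv w k \<le> q} = q"
    using card_image[of w "{1..q}"] permutes_inj_on[OF assms] by simp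
  then have T: "count_list (origins q (q + p) w) True = q"
    unfolding origins_def cnt
    by (subst distinct_length_filter)
       (auto simp: atLeastLessThanSuc_atLeastAtMost Int_def conj_commute simp del: upt_Suc)
  then show ?thesis
    using length_count_bool[of "origins q (q + p) w"] by (simp add: shuffle_words_def length_origins)
qed

lemma bij_betw_origins: "bij_betw (origins q (q + p)) (shuffle_perms q (q + p)) (shuffle_words q p)"
  unfolding bij_betw_def
proof (intro conjI inj_on_origins equalityI subsetI)
  fix z assume "z \<in> origins q (q + p) ` shuffle_perms q (q + p)"
  then show "z \<in> shuffle_words q p" by (auto simp: shuffle_perms_def intro: origins_shuffle_word)
next
  fix z assume "z \<in> shuffle_words q p"
  then obtain "is" where "is": "set is \<subseteq> {1..<q + p}" "foldr swap_at is (sorted_word q p) = z"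
    "perm_of is \<in> shuffle_perms q (q + p)"
    using shuffle_perm_exists by blast
  show "z \<in> origins q (q + p) ` shuffle_perms q (q + p)"
    by (rule image_eqI[OF _ "is"(3)]) (use origins_perm_of[OF "is"(1)] "is"(2) in simp)
qed

text \<open>The lower bound by inversions and the decomposition from
  \<open>shuffle_perm_exists\<close> fix the length of every reduced word, in particular of the one
  picked by \<open>SOME\<close>.\<close>

lemma reduced_word_shuffle:
  assumes w: "w \<in> shuffle_perms q (q + p)"
  shows "set (reduced_word (q + p) w) \<subseteq> {1..<q + p}"
    and "foldr swap_at (reduced_word (q + p) w) (sorted_word q p) = origins q (q + p) w"
    and "length (reduced_word (q + p) w) = inversions (origins q (q + p) w)"
proof -
  let ?z = "origins q (q + p) w"
  have "?z \<in> shuffle_words q p" using w by (auto simp: shuffle_perms_def intro: origins_shuffle_word)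
  then obtain "is" where "is": "set is \<subseteq> {1..<q + p}" "length is = inversions ?z"
    "foldr swap_at is (sorted_word q p) = ?z" "perm_of is \<in> shuffle_perms q (q + p)"
    using shuffle_perm_exists by blast
  have "perm_of is = w"
    by (rule inj_onD[OF inj_on_origins _ "is"(4) w]) (use origins_perm_of[OF "is"(1)] "is"(3) in simp)
  then have d: "decomposition (q + p) w is" using "is"(1) by (simp add: decomposition_perm_of)
  have le: "inversions ?z \<le> length js" if "decomposition (q + p) w js" for js
    using that inversions_foldr_swap_at[of js q p] origins_perm_of[of js q p] by (simp add: decomposition_perm_of)
  have "reduced_decomposition (q + p) w is" using d le "is"(2) by (simp add: reduced_decomposition_def)
  then have r: "reduced_decomposition (q + p) w (reduced_word (q + p) w)"
    unfolding reduced_word_def by (rule someI)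
  then have rd: "decomposition (q + p) w (reduced_word (q + p) w)"
    and "length (reduced_word (q + p) w) \<le> length is" using d by (auto simp: reduced_decomposition_def)
  then show "length (reduced_word (q + p) w) = inversions ?z" using le[OF rd] "is"(2) by simp
  show "set (reduced_word (q + p) w) \<subseteq> {1..<q + p}" using rd by (simp add: decomposition_perm_of)
  then show "foldr swap_at (reduced_word (q + p) w) (sorted_word q p) = ?z"
    using origins_perm_of[of "reduced_word (q + p) w" q p] rd by (simp add: decomposition_perm_of)
qed


section \<open>Braid words on pure tensors\<close>

lemma linear_on_sum_scale:
  fixes sU :: "'k::field \<Rightarrow> 'u::ab_group_add \<Rightarrow> 'u" and sV :: "'k \<Rightarrow> 'v::ab_group_add \<Rightarrow> 'v"
  assumes f: "linear_on sU sV U f" and U: "module.subspace sU U" and sU: "vector_space sU" and sV: "vector_space sV"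
    and I: "finite I" and h: "\<And>i. i \<in> I \<Longrightarrow> h i \<in> U"
  shows "f (\<Sum>i\<in>I. sU (c i) (h i)) = (\<Sum>i\<in>I. sV (c i) (f (h i)))"
proof -
  interpret U: vector_space sU by (rule sU)
  have "f (\<Sum>i\<in>I. sU (c i) (h i)) = (\<Sum>i\<in>I. sV (c i) (f (h i))) \<and> (\<Sum>i\<in>I. sU (c i) (h i)) \<in> U"
    using I h
  proof (induction I rule: finite_induct)
    case empty
    then show ?case using linear_on_zero[OF f U sU sV] U.subspace_0[OF U] by simp
  next
    case (insert i I)
    then show ?case using f U.subspace_add[OF U] U.subspace_scale[OF U] by (simp add: linear_on_def)
  qed
  then show ?thesis by blast
qed

context hopf_algebra begin

definition braid_step :: "nat \<Rightarrow> 'a list \<Rightarrow> 'a list list"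
  where "braid_step i w = map (\<lambda>(x, y). take (i - 1) w @ [x, y] @ drop (i + 1) w) (br (w ! (i - 1)) (w ! i))"

text \<open>As in \<open>braid_word\<close>, the head of the index list acts last.\<close>

primrec braid_steps :: "nat list \<Rightarrow> 'a list \<Rightarrow> 'a list list" where
  "braid_steps [] w = [w]"
| "braid_steps (i # is) w = concat (map (braid_step i) (braid_steps is w))"

lemma sum_braid_step: "(\<Sum>v\<leftarrow>braid_step (Suc (length u)) (u @ a # b # t). g v) = (\<Sum>(x, y)\<leftarrow>br a b. g (u @ x # y # t))"
  by (simp add: braid_step_def nth_append comp_def case_prod_unfold)

lemma braid_step_Cons: "braid_step (Suc (Suc i)) (b # v) = map (Cons b) (braid_step (Suc i) v)"
  by (simp add: braid_step_def comp_def case_prod_unfold)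

lemma sum_braid_steps_Cons: "(\<Sum>v\<leftarrow>braid_steps (i # is) w. g v) = (\<Sum>u\<leftarrow>braid_steps is w. \<Sum>v\<leftarrow>braid_step i u. g v)"
  by (simp add: sum_list_concat_map)

lemma sum_braid_steps_append: "(\<Sum>v\<leftarrow>braid_steps (is @ js) w. g v) = (\<Sum>u\<leftarrow>braid_steps js w. \<Sum>v\<leftarrow>braid_steps is u. g v)"
  by (induction "is" arbitrary: g) (simp_all add: sum_list_concat_map)

lemma length_braid_step: "0 < i \<Longrightarrow> i < length w \<Longrightarrow> v \<in> set (braid_step i w) \<Longrightarrow> length v = length w"
  by (auto simp: braid_step_def)

lemma length_braid_steps: "set is \<subseteq> {1..<length w} \<Longrightarrow> v \<in> set (braid_steps is w) \<Longrightarrow> length v = length w"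
proof (induction "is" arbitrary: v)
  case (Cons i "is")
  from Cons.prems(2) obtain u where u: "u \<in> set (braid_steps is w)" "v \<in> set (braid_step i u)" by auto
  have "length u = length w" using Cons.prems(1) u(1) by (intro Cons.IH) auto
  then show ?case using u(2) Cons.prems(1) length_braid_step[of i u v] by simp
qed simp

text \<open>Acting from the largest index down, the braidings carry \<open>a\<close> leftwards over
  \<open>bs\<close>. The prefix \<open>u\<close> provides the offset of the indices in the
  induction.\<close>

lemma sum_braid_steps_upt:
  "(\<Sum>v\<leftarrow>braid_steps [Suc (length u)..<Suc (length u + length bs)] (u @ bs @ a # t). g v) =
    (\<Sum>(x, w)\<leftarrow>pl bs a. g (u @ x # w @ t))"
proof (induction bs arbitrary: u g)
  case (Cons b bs)
  have "[Suc (length u)..<Suc (length u + length (b # bs))]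
      = Suc (length u) # [Suc (length (u @ [b]))..<Suc (length (u @ [b]) + length bs)]"
    by (subst upt_conv_Cons) auto
  then have "(\<Sum>v\<leftarrow>braid_steps [Suc (length u)..<Suc (length u + length (b # bs))] (u @ (b # bs) @ a # t). g v)
      = (\<Sum>v\<leftarrow>braid_steps [Suc (length (u @ [b]))..<Suc (length (u @ [b]) + length bs)] ((u @ [b]) @ bs @ a # t).
          \<Sum>v'\<leftarrow>braid_step (Suc (length u)) v. g v')"
    unfolding sum_braid_steps_Cons[symmetric] by (simp del: upt_Suc braid_steps.simps)
  also have "\<dots> = (\<Sum>(x, w)\<leftarrow>pl bs a. \<Sum>v'\<leftarrow>braid_step (Suc (length u)) ((u @ [b]) @ x # w @ t). g v')"
    by (rule Cons.IH)
  also have "\<dots> = (\<Sum>(x, w)\<leftarrow>pl (b # bs) a. g (u @ x # w @ t))"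
    unfolding sum_pl_Cons using sum_braid_step[of g u b] by simp
  finally show ?case .
qed simp

text \<open>The reversed list acts from the smallest index up and carries \<open>b\<close>
  rightwards over \<open>as\<close>.\<close>

lemma sum_braid_steps_rev_upt:
  "(\<Sum>v\<leftarrow>braid_steps (rev [Suc (length u)..<Suc (length u + length as)]) (u @ b # as @ t). g v) =
    (\<Sum>(v, y)\<leftarrow>pr as b. g (u @ v @ y # t))"
proof (induction as arbitrary: u b)
  case (Cons a as)
  have "rev [Suc (length u)..<Suc (length u + length (a # as))]
      = rev [Suc (length (u @ [a]))..<Suc (length (u @ [a]) + length as)] @ [Suc (length u)]"
    by (subst upt_conv_Cons) auto
  then have "(\<Sum>v\<leftarrow>braid_steps (rev [Suc (length u)..<Suc (length u + length (a # as))]) (u @ b # (a # as) @ t). g v)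
      = (\<Sum>w\<leftarrow>braid_step (Suc (length u)) (u @ b # a # as @ t).
          \<Sum>v\<leftarrow>braid_steps (rev [Suc (length (u @ [a]))..<Suc (length (u @ [a]) + length as)]) w. g v)"
    by (simp add: sum_braid_steps_append del: upt_Suc)
  also have "\<dots> = (\<Sum>(x, y)\<leftarrow>br b a. \<Sum>v\<leftarrow>braid_steps (rev [Suc (length (u @ [x]))..<Suc (length (u @ [x]) + length as)]) ((u @ [x]) @ y # as @ t). g v)"
    unfolding sum_braid_step by (simp del: upt_Suc)
  also have "\<dots> = (\<Sum>(x, y)\<leftarrow>br b a. \<Sum>(v, z)\<leftarrow>pr as y. g ((u @ [x]) @ v @ z # t))"
    by (intro sum_list_cong_prod Cons.IH)
  finally show ?case by (simp add: sum_pr_Cons)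
qed simp

text \<open>Reduced words of a shuffle differ by far commutations only: independence of the chosen reduced
  word comes down to this exchange step.\<close>

lemma sum_tw_swap:
  fixes g :: "'a list \<Rightarrow> 'v::comm_monoid_add"
  shows "u @ False # True # t \<in> shuffle_words (length bs) (length as) \<Longrightarrow>
    (\<Sum>v\<leftarrow>tw (u @ False # True # t) bs as. g v) =
    (\<Sum>v\<leftarrow>tw (u @ True # False # t) bs as. \<Sum>v'\<leftarrow>braid_step (Suc (length u)) v. g v')"
proof (induction u arbitrary: bs as g)
  case Nil
  then obtain b bs' where bs: "bs = b # bs'" by (cases bs) (auto simp: shuffle_words_def)
  have b1: "(\<Sum>v'\<leftarrow>braid_step (Suc 0) (b # x # v). g v') = (\<Sum>(x', y)\<leftarrow>br b x. g (x' # y # v))" for x v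
    using sum_braid_step[of g "[]" b x v] by simp
  have "(\<Sum>v\<leftarrow>tw (False # True # t) bs as. g v)
      = (\<Sum>(x, w)\<leftarrow>pl bs' (hd as). \<Sum>(x', y)\<leftarrow>br b x. \<Sum>v\<leftarrow>tw t w (tl as). g (x' # y # v))"
    unfolding bs sum_tw_False sum_tw_True sum_pl_Cons list.sel ..
  \<comment> \<open>The rest of the shuffle does not see the crossing of \<open>b\<close> and
    \<open>x\<close>, which may thus be performed last, as a braiding of the first two
    letters.\<close>
  also have "\<dots> = (\<Sum>(x, w)\<leftarrow>pl bs' (hd as). \<Sum>v\<leftarrow>tw t w (tl as). \<Sum>(x', y)\<leftarrow>br b x. g (x' # y # v))"
    by (intro sum_list_cong_prod) (simp only: case_prod_unfold sum_list_swap[of _ "tw _ _ _"])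
  finally show ?case by (simp add: bs sum_tw_False sum_tw_True b1)
next
  case (Cons c u)
  show ?case
  proof (cases c)
    case True
    then obtain b bs' where "bs = b # bs'" "u @ False # True # t \<in> shuffle_words (length bs') (length as)"
      using Cons.prems by (cases bs) (auto simp: shuffle_words_def)
    then show ?thesis using True Cons.IH[of bs' as] by (simp add: sum_tw_True braid_step_Cons comp_def)
  next
    case False
    then obtain a as' where as: "as = a # as'" "u @ False # True # t \<in> shuffle_words (length bs) (length as')"
      using Cons.prems by (cases as) (auto simp: shuffle_words_def)
    have "(\<Sum>(x, w)\<leftarrow>pl bs a. \<Sum>v\<leftarrow>tw (u @ False # True # t) w as'. g (x # v))
        = (\<Sum>(x, w)\<leftarrow>pl bs a. \<Sum>v\<leftarrow>tw (u @ True # False # t) w as'. \<Sum>v'\<leftarrow>braid_step (Suc (length u)) v. g (x # v'))"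
      using as by (intro sum_list_cong_prod Cons.IH) (simp add: length_pl)
    then show ?thesis using False as by (simp add: sum_tw_False braid_step_Cons comp_def)
  qed
qed

lemma sum_tw_sorted_word: "(\<Sum>v\<leftarrow>tw (sorted_word (length bs) (length as)) bs as. g v) = g (bs @ as)"
proof (induction bs arbitrary: g)
  case Nil
  have "(\<Sum>v\<leftarrow>tw (replicate (length as) False) [] as. g v) = g as"
    by (induction as arbitrary: g) (simp_all add: sum_tw_False)
  then show ?case by (simp add: sorted_word_def)
next
  case (Cons b bs)
  then show ?case by (simp add: sorted_word_def sum_tw_True)
qed

lemma foldr_swap_at_shuffle_word:
  "set is \<subseteq> {1..<q + p} \<Longrightarrow> foldr swap_at is (sorted_word q p) \<in> shuffle_words q p"
  using origins_perm_of[of "is" q p] origins_shuffle_word[OF perm_of_permutes] by metis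

text \<open>When there are as many steps as inversions, every step must raise their number, so it
  turns an adjacent \<open>True\<close>, \<open>False\<close> into \<open>False\<close>,
  \<open>True\<close>: the situation of \<open>sum_tw_swap\<close>.\<close>

lemma sum_braid_steps_reduced:
  fixes g :: "'a list \<Rightarrow> 'v::comm_monoid_add"
  assumes "set is \<subseteq> {1..<length bs + length as}"
    and "length is = inversions (foldr swap_at is (sorted_word (length bs) (length as)))"
  shows "(\<Sum>v\<leftarrow>braid_steps is (bs @ as). g v) = (\<Sum>v\<leftarrow>tw (foldr swap_at is (sorted_word (length bs) (length as))) bs as. g v)"
  using assms
proof (induction "is" arbitrary: g)
  case Nil
  then show ?case by (simp add: sum_tw_sorted_word)
next
  case (Cons i "is")
  let ?z = "foldr swap_at is (sorted_word (length bs) (length as))"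
  have "is": "set is \<subseteq> {1..<length bs + length as}" "0 < i" "i < length bs + length as" using Cons.prems by auto
  then have "0 < i" "i < length ?z" by (auto simp: length_sorted_word)
  then obtain u c d t where z: "?z = u @ c # d # t" and i: "i = Suc (length u)" by (rule split_at_pair)
  have le: "inversions ?z \<le> length is" by (rule inversions_foldr_swap_at[OF "is"(1)])
  have sw: "foldr swap_at (i # is) (sorted_word (length bs) (length as)) = u @ d # c # t"
    by (simp add: z i swap_at_append)
  have eq: "Suc (length is) = inversions (u @ d # c # t)" using Cons.prems(2) unfolding sw by simp
  have "c \<and> \<not> d" using eq le unfolding z by (cases c; cases d) (auto simp: inversions_append)
  then have c: "c = True" "d = False" by auto
  then have len: "length is = inversions ?z" using eq by (simp add: z inversions_swap)
  have "(\<Sum>v\<leftarrow>braid_steps (i # is) (bs @ as). g v) = (\<Sum>v\<leftarrow>tw ?z bs as. \<Sum>v'\<leftarrow>braid_step i v. g v')"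
    unfolding sum_braid_steps_Cons by (rule Cons.IH[OF "is"(1) len])
  also have "\<dots> = (\<Sum>v\<leftarrow>tw (u @ False # True # t) bs as. g v)"
    unfolding z c i using foldr_swap_at_shuffle_word[OF Cons.prems(1)] sw c
    by (intro sum_tw_swap[symmetric]) auto
  finally show ?case unfolding sw c .
qed

section \<open>From formal sums back to tensors\<close>

abbreviation wor :: "('k, 'a) tensor \<Rightarrow> ('k, 'a) tensor" where "wor \<equiv> woronowicz s D S"

lemma bilin_tpure: "bilin s tscale (\<lambda>x y. tpure s (u @ x # y # v))"
  using mlin_append_Cons[OF mlin_tpure[OF vs], of u] mlin_append_Cons[OF mlin_tpure[OF vs], of "u @ [x]" for x]
  by (intro bilinI) auto

lemma woronowicz_tpure: "wor (tpure s [a, b]) = (\<Sum>(x, y)\<leftarrow>br a b. tpure s [x, y])"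
proof -
  have b: "bilin s tscale (\<lambda>x y. tpure s [x, y])" using bilin_tpure[of "[]" "[]"] by simp
  have sw: "sweedler s tscale D (\<lambda>x y. tpure s [x, ad y a]) b = (\<Sum>(x, y)\<leftarrow>br a b. tpure s [x, y])" for a b
    unfolding sum_br by (rule sweedler_cop[OF bilin_ad[OF b]])
  have bb: "bilin s tscale (\<lambda>a b. \<Sum>(x, y)\<leftarrow>br a b. tpure s [x, y])"
    by (intro bilinI lin_br1 lin_br2 b)
  show ?thesis unfolding woronowicz_def sw
    by (subst tlift_tpure[OF vs vector_space_tscale _ bilin_multilinear_on[OF bb]]) (auto simp: set_Cons_def)
qed

lemma tinsert_sum: "tinsert s u (\<Sum>(x, y)\<leftarrow>L. tpure s [x, y]) v = (\<Sum>(x, y)\<leftarrow>L. tpure s (u @ x # y # v))"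
proof -
  have "tinsert s u (\<Sum>(x, y)\<leftarrow>L. tpure s [x, y]) v
      = tlift s tscale [UNIV, UNIV] (\<lambda>z. tpure s (u @ z ! 0 # z ! 1 # v)) (\<Sum>(x, y)\<leftarrow>L. tpure s [x, y])"
    unfolding tinsert_def by (rule fun_cong[OF tlift_cong]) (auto simp: set_Cons_def)
  also have "\<dots> = (\<Sum>(x, y)\<leftarrow>L. tpure s (u @ x # y # v))"
    by (rule bilin_sum_cop[OF bilin_tpure]) auto
  finally show ?thesis .
qed

lemma braid_at_term:
  "tinsert s (take (i - 1) w) (wor (tpure s [w ! (i - 1), w ! i])) (drop (i + 1) w) = (\<Sum>v\<leftarrow>braid_step i w. tpure s v)"
  unfolding woronowicz_tpure tinsert_sum by (simp add: braid_step_def comp_def case_prod_unfold)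

text \<open>Stated in a fixed degree, since \<open>braid_step i\<close> is meaningful only on words
  that reach both positions. The cases follow the place of the varying slot relative to the two
  braided ones.\<close>

lemma multilinear_on_braid_step:
  assumes i: "0 < i" "i < n"
  shows "multilinear_on s tscale (replicate n UNIV) (\<lambda>w. \<Sum>v\<leftarrow>braid_step i w. tpure s v)"
  unfolding multilinear_on_def
proof (intro ballI allI impI)
  fix w :: "'a list" and j assume "w \<in> listset (replicate n UNIV)" "j < length (replicate n (UNIV :: 'a set))"
  then have len: "length w = n" and j: "j < n" by (auto simp: listset_replicate)
  have "i < length w" using i len by simp
  with i(1) obtain u a b t where w: "w = u @ a # b # t" and iu: "i = Suc (length u)" by (rule split_at_pair)
  note T = mlin_append_Cons[OF mlin_tpure[OF vs]]
  have "lin s tscale (\<lambda>x. \<Sum>v\<leftarrow>braid_step i (w[j := x]). tpure s v)"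
  proof -
    consider "j < length u" | "j = length u" | "j = Suc (length u)" | "j > Suc (length u)" by linarith
    then show ?thesis
    proof cases
      case 1
      then have "w[j := x] = u[j := x] @ a # b # t" for x by (simp add: w list_update_append)
      moreover have "(\<Sum>v\<leftarrow>braid_step i (u[j := x] @ a # b # t). tpure s v) = (\<Sum>(y, z)\<leftarrow>br a b. tpure s (u[j := x] @ y # z # t))" for x
        using sum_braid_step[of "tpure s" "u[j := x]" a b t] by (simp add: iu)
      moreover have "u[j := x] = take j u @ x # drop (Suc j) u" for x using 1 by (simp add: upd_conv_take_nth_drop)
      ultimately show ?thesis using T[of "take j u"]
        by (simp add: lin_sum_cop vector_space_tscale)
    next
      case 2
      then have "(\<Sum>v\<leftarrow>braid_step i (w[j := x]). tpure s v) = (\<Sum>(y, z)\<leftarrow>br x b. tpure s (u @ y # z # t))" for x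
        using sum_braid_step[of "tpure s" u x b t] by (simp add: w iu)
      then show ?thesis using lin_br1[OF bilin_tpure] by simp
    next
      case 3
      then have "(\<Sum>v\<leftarrow>braid_step i (w[j := x]). tpure s v) = (\<Sum>(y, z)\<leftarrow>br a x. tpure s (u @ y # z # t))" for x
        using sum_braid_step[of "tpure s" u a x t] by (simp add: w iu list_update_append)
      then show ?thesis using lin_br2[OF bilin_tpure] by simp
    next
      case 4
      define k where "k = j - Suc (Suc (length u))"
      have k: "k < length t" "j = Suc (Suc (length u)) + k" using 4 j len by (auto simp: k_def w)
      have "w[j := x] = u @ a # b # t[k := x]" for x
        by (simp add: w k(2) list_update_append)
      moreover have "(\<Sum>v\<leftarrow>braid_step i (u @ a # b # t[k := x]). tpure s v) = (\<Sum>(y, z)\<leftarrow>br a b. tpure s (u @ y # z # t[k := x]))" for x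
        using sum_braid_step[of "tpure s" u a b "t[k := x]"] by (simp add: iu)
      moreover have "t[k := x] = take k t @ x # drop (Suc k) t" for x using k by (simp add: upd_conv_take_nth_drop)
      ultimately show ?thesis using T[of "u @ y # z # take k t" for y z]
        by (simp add: lin_sum_cop vector_space_tscale)
    qed
  qed
  then show "linear_on s tscale (replicate n UNIV ! j) (\<lambda>x. \<Sum>v\<leftarrow>braid_step i (w[j := x]). tpure s v)"
    by (rule linear_onI_linear)
qed

lemma braid_at_tpure:
  assumes i: "0 < i" "i < n" and L: "\<And>w. w \<in> set L \<Longrightarrow> length w = n"
  shows "braid_at s wor n i (\<Sum>w\<leftarrow>L. tpure s w) = (\<Sum>w\<leftarrow>L. \<Sum>v\<leftarrow>braid_step i w. tpure s v)"
  unfolding braid_at_def braid_at_term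
  by (rule tlift_sum_list[OF vs vector_space_tscale subspaces_UNIV multilinear_on_braid_step[OF i], where h = "\<lambda>w. w"])
     (simp add: listset_replicate L)

lemma braid_word_tpure:
  assumes "set is \<subseteq> {1..<n}" "length w = n"
  shows "braid_word s wor n is (tpure s w) = (\<Sum>v\<leftarrow>braid_steps is w. tpure s v)"
  using assms
proof (induction "is")
  case Nil
  then show ?case by (simp add: braid_word_def)
next
  case (Cons i "is")
  have "braid_word s wor n (i # is) (tpure s w) = braid_at s wor n i (braid_word s wor n is (tpure s w))"
    by (simp add: braid_word_def)
  also have "\<dots> = (\<Sum>u\<leftarrow>braid_steps is w. \<Sum>v\<leftarrow>braid_step i u. tpure s v)"
  proof -
    have "set is \<subseteq> {1..<n}" using Cons.prems(1) by simp
    then have IH: "braid_word s wor n is (tpure s w) = (\<Sum>u\<leftarrow>braid_steps is w. tpure s u)"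
      using Cons.IH Cons.prems(2) by blast
    have len: "length u = n" if "u \<in> set (braid_steps is w)" for u
      using length_braid_steps[OF _ that] \<open>set is \<subseteq> {1..<n}\<close> Cons.prems(2) by blast
    show ?thesis unfolding IH by (rule braid_at_tpure) (use Cons.prems(1) len in auto)
  qed
  finally show ?case by (simp only: sum_braid_steps_Cons)
qed

text \<open>Linearity moves \<open>f\<close> inside, each reduced word becomes a \<open>tw\<close>,
  and permutations are reindexed by their words of origins. \<open>g\<close> is kept apart from
  \<open>f\<close> so that it can be chosen multilinear on words of every length.\<close>

lemma qshuffle_tpure:
  fixes sV :: "'k \<Rightarrow> 'v::ab_group_add \<Rightarrow> 'v"
  assumes sV: "vector_space sV" and n: "n = length bs + length as" and f: "linear_on tscale sV (tpower s UNIV n) f"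
    and g: "\<And>w. length w = n \<Longrightarrow> g w = f (tpure s w)"
  shows "f (qshuffle s wor (length bs) (length as) (tpure s (bs @ as))) = sh g bs as"
proof -
  let ?q = "length bs" and ?p = "length as"
  note sub = subspace_tspace[of s "replicate n UNIV"]
  let ?P = "shuffle_perms ?q (?q + ?p)"
  have tp: "tpure s v \<in> tpower s UNIV n" if "length v = n" for v
    using that by (intro tpure_in_tspace) (simp add: listset_replicate)
  have fin: "finite ?P" using bij_betw_finite[OF bij_betw_origins] finite_shuffle_words by blast
  let ?t = "\<lambda>w. braid_word s wor (?q + ?p) (reduced_word (?q + ?p) w) (tpure s (bs @ as))"
  have t: "f (?t w) = (\<Sum>v\<leftarrow>tw (origins ?q (?q + ?p) w) bs as. g v) \<and> ?t w \<in> tpower s UNIV n" if w: "w \<in> ?P" for w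
  proof -
    note rw = reduced_word_shuffle[OF w]
    have bt: "?t w = (\<Sum>v\<leftarrow>braid_steps (reduced_word (?q + ?p) w) (bs @ as). tpure s v)"
      using rw(1) by (intro braid_word_tpure) auto
    have len: "length v = n" if "v \<in> set (braid_steps (reduced_word (?q + ?p) w) (bs @ as))" for v
      using length_braid_steps[OF _ that] rw(1) n by simp
    have "f (?t w) = (\<Sum>v\<leftarrow>braid_steps (reduced_word (?q + ?p) w) (bs @ as). f (tpure s v))"
      unfolding bt by (intro linear_on_sum_list(1)[OF f sub vector_space_tscale sV] tp len)
    also have "\<dots> = (\<Sum>v\<leftarrow>braid_steps (reduced_word (?q + ?p) w) (bs @ as). g v)"
      by (intro sum_list_cong g[symmetric] len)
    also have "\<dots> = (\<Sum>v\<leftarrow>tw (origins ?q (?q + ?p) w) bs as. g v)"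
      using sum_braid_steps_reduced[of "reduced_word (?q + ?p) w" bs as g] rw by simp
    finally have "f (?t w) = (\<Sum>v\<leftarrow>tw (origins ?q (?q + ?p) w) bs as. g v)" .
    moreover have "?t w \<in> tpower s UNIV n"
      unfolding bt by (intro linear_on_sum_list(2)[OF f sub vector_space_tscale sV] tp len)
    ultimately show ?thesis ..
  qed
  have "f (qshuffle s wor ?q ?p (tpure s (bs @ as)))
      = (\<Sum>w\<in>?P. sV ((-1) ^ length (reduced_word (?q + ?p) w)) (f (?t w)))"
    unfolding qshuffle_def using t by (intro linear_on_sum_scale[OF f sub vector_space_tscale sV fin]) auto
  also have "\<dots> = (\<Sum>w\<in>?P. alt (inversions (origins ?q (?q + ?p) w)) (\<Sum>v\<leftarrow>tw (origins ?q (?q + ?p) w) bs as. g v))"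
    using t reduced_word_shuffle(3) by (intro sum.cong) (simp_all add: alt_scale[OF sV])
  also have "\<dots> = sh g bs as"
    unfolding sh_def by (rule sum.reindex_bij_betw[OF bij_betw_origins, of "\<lambda>z. alt (inversions z) (\<Sum>v\<leftarrow>tw z bs as. g v)"])
  finally show ?thesis .
qed

end


section \<open>Normalized cochains\<close>

lemma linear_on_tspace_eq:
  fixes s :: "'k::field \<Rightarrow> 'a::ab_group_add \<Rightarrow> 'a" and sV :: "'k \<Rightarrow> 'v::ab_group_add \<Rightarrow> 'v"
  assumes sV: "vector_space sV" and f: "linear_on tscale sV (tspace s Cs) f" and f': "linear_on tscale sV (tspace s Cs) f'"
    and eq: "\<And>w. w \<in> listset Cs \<Longrightarrow> f (tpure s w) = f' (tpure s w)" and t: "t \<in> tspace s Cs"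
  shows "f t = f' t"
proof -
  interpret T: vector_space "tscale :: 'k \<Rightarrow> ('k, 'a) tensor \<Rightarrow> _" by (rule vector_space_tscale)
  note sub = subspace_tspace[of s Cs]
  note z = linear_on_zero[OF _ sub vector_space_tscale sV]
  have "T.subspace {t \<in> tspace s Cs. f t = f' t}"
    using f f' z[OF f] z[OF f'] sub
    by (intro T.subspaceI) (auto simp: linear_on_def T.subspace_0 T.subspace_add T.subspace_scale)
  moreover have "tpure s ` listset Cs \<subseteq> {t \<in> tspace s Cs. f t = f' t}"
    using eq tpure_in_tspace by auto
  ultimately have "tspace s Cs \<subseteq> {t \<in> tspace s Cs. f t = f' t}"
    unfolding tspace_def by (rule T.span_minimal[rotated])
  then show ?thesis using t by auto
qed

lemma linear_on_tspace_closed: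
  fixes s :: "'k::field \<Rightarrow> 'a::ab_group_add \<Rightarrow> 'a" and sV :: "'k \<Rightarrow> 'v::ab_group_add \<Rightarrow> 'v"
  assumes sV: "vector_space sV" and f: "linear_on tscale sV (tspace s Cs) f" and V: "module.subspace sV V"
    and mem: "\<And>w. w \<in> listset Cs \<Longrightarrow> f (tpure s w) \<in> V" and t: "t \<in> tspace s Cs"
  shows "f t \<in> V"
proof -
  interpret T: vector_space "tscale :: 'k \<Rightarrow> ('k, 'a) tensor \<Rightarrow> _" by (rule vector_space_tscale)
  interpret V: vector_space sV by (rule sV)
  note sub = subspace_tspace[of s Cs]
  note z = linear_on_zero[OF f sub vector_space_tscale sV]
  have "T.subspace {t \<in> tspace s Cs. f t \<in> V}"
    using f z sub V
    by (intro T.subspaceI) (auto simp: linear_on_def T.subspace_0 T.subspace_add T.subspace_scale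
        V.subspace_0 V.subspace_add V.subspace_scale)
  moreover have "tpure s ` listset Cs \<subseteq> {t \<in> tspace s Cs. f t \<in> V}"
    using mem tpure_in_tspace by auto
  ultimately have "tspace s Cs \<subseteq> {t \<in> tspace s Cs. f t \<in> V}"
    unfolding tspace_def by (rule T.span_minimal[rotated])
  then show ?thesis using t by auto
qed

lemma Hom_N_eqI:
  fixes s :: "'k::field \<Rightarrow> 'a::ring_1 \<Rightarrow> 'a" and sV :: "'k \<Rightarrow> 'v::ab_group_add \<Rightarrow> 'v"
  assumes "vector_space sV" "f \<in> Hom_N s C n sV V" "f' \<in> Hom_N s C n sV V"
    and "\<And>w. length w = n \<Longrightarrow> set w \<subseteq> C \<Longrightarrow> f (tpure s w) = f' (tpure s w)"
  shows "f = f'"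
proof
  fix t
  show "f t = f' t"
    using assms linear_on_tspace_eq[of sV s "replicate n C" f f' t]
    by (cases "t \<in> tpower s C n") (auto simp: Hom_N_def listset_replicate)
qed

lemma tlift_Hom_N:
  fixes s :: "'k::field \<Rightarrow> 'a::ring_1 \<Rightarrow> 'a" and sV :: "'k \<Rightarrow> 'v::ab_group_add \<Rightarrow> 'v"
  assumes s: "vector_space s" and sV: "vector_space sV" and C: "module.subspace s C" and V: "module.subspace sV V"
    and g: "mlin s sV g" and mem: "\<And>w. length w = n \<Longrightarrow> set w \<subseteq> C \<Longrightarrow> g w \<in> V"
    and van: "\<And>w. length w = n \<Longrightarrow> set w \<subseteq> C \<Longrightarrow> 1 \<in> set w \<Longrightarrow> g w = 0"
  shows "tlift s sV (replicate n C) g \<in> Hom_N s C n sV V"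
    and "length w = n \<Longrightarrow> set w \<subseteq> C \<Longrightarrow> tlift s sV (replicate n C) g (tpure s w) = g w"
proof -
  have Cs: "\<forall>C'\<in>set (replicate n C). module.subspace s C'" using C by simp
  note m = mlin_multilinear_on[OF g, of "replicate n C"]
  note lin = linear_on_tlift[OF s sV Cs m]
  have ev: "tlift s sV (replicate n C) g (tpure s w) = g w" if "w \<in> listset (replicate n C)" for w
    using tlift_tpure[OF s sV Cs m that] .
  then show "length w = n \<Longrightarrow> set w \<subseteq> C \<Longrightarrow> tlift s sV (replicate n C) g (tpure s w) = g w"
    by (simp add: listset_replicate)
  have "tlift s sV (replicate n C) g t \<in> V" if "t \<in> tpower s C n" for t
    by (rule linear_on_tspace_closed[OF sV lin V _ that]) (simp add: ev mem listset_replicate)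
  then show "tlift s sV (replicate n C) g \<in> Hom_N s C n sV V"
    using lin by (auto simp: Hom_N_def ev van listset_replicate) (simp add: tlift_def)
qed

lemma subspace_Hom_N:
  fixes s :: "'k::field \<Rightarrow> 'a::ring_1 \<Rightarrow> 'a" and sV :: "'k \<Rightarrow> 'v::ab_group_add \<Rightarrow> 'v"
  assumes sV: "vector_space sV" and V: "module.subspace sV V"
  shows "module.subspace (fscale sV) (Hom_N s C n sV V)"
proof -
  interpret V: vector_space sV by (rule sV)
  interpret F: vector_space "fscale sV :: 'k \<Rightarrow> (('k, 'a) tensor \<Rightarrow> 'v) \<Rightarrow> _" by (rule vector_space_fscale[OF sV])
  show ?thesis
    by (intro F.subspaceI)
      (auto simp: Hom_N_def linear_on_def fscale_def V.subspace_0[OF V] V.subspace_add[OF V] V.subspace_scale[OF V]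
        V.scale_right_distrib V.scale_left_commute algebra_simps)
qed

text \<open>\<open>Q\<close> will be the identity for slots in \<open>A\<close> and the projection
  onto \<open>H\<close> for slots in \<open>H\<close>.\<close>

lemma lin_tpure_slot:
  assumes s: "vector_space s" and sV: "vector_space sV" and f: "linear_on tscale sV (tpower s C n) f"
    and Q: "lin s s Q" "\<And>x. Q x \<in> C" and n: "Suc (length u + length v) = n"
  shows "lin s sV (\<lambda>x. f (tpure s (map Q (u @ x # v))))"
proof -
  have "lin s tscale (\<lambda>x. tpure s (map Q u @ Q x # map Q v))"
    by (rule lin_comp[OF Q(1) mlin_append_Cons[OF mlin_tpure[OF s]]])
  moreover have "tpure s (map Q u @ Q x # map Q v) \<in> tpower s C n" for x
    using Q(2) n by (intro tpure_in_tspace) (auto simp: listset_replicate)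
  ultimately show ?thesis using s sV f by (simp add: Vector_Spaces.linear_iff linear_on_def)
qed

lemma lin_fun_apply:
  "vector_space sV \<Longrightarrow> lin s (fscale sV) K \<Longrightarrow> lin s sV (\<lambda>x. K x t)"
  by (simp add: Vector_Spaces.linear_iff fscale_def)

locale sub_hopf_bimodule = hopf_bimodule s D \<epsilon> S sM l r
  for s :: "'k::field \<Rightarrow> 'a::ring_1 \<Rightarrow> 'a" and D \<epsilon> S
    and sM :: "'k \<Rightarrow> 'm::ab_group_add \<Rightarrow> 'm" and l :: "'a \<Rightarrow> 'm \<Rightarrow> 'm" and r :: "'m \<Rightarrow> 'a \<Rightarrow> 'm" +
  fixes H :: "'a set"
  assumes H_subspace: "module.subspace s H" and H_one: "1 \<in> H"
    and H_mult: "x \<in> H \<Longrightarrow> y \<in> H \<Longrightarrow> x * y \<in> H" and H_ad: "h \<in> H \<Longrightarrow> ad a h \<in> H"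
begin

abbreviation "sB \<equiv> fscale (fscale (fscale (fscale sM)))"
abbreviation "DC \<equiv> double_cochains s H sM"
abbreviation "hoch \<equiv> hochschild_diff s sM l r"
abbreviation "rh \<equiv> rho s wor H sM l r"
abbreviation "shuf \<equiv> shuffle_map s wor H sM"
abbreviation "ev F as bs \<equiv> F (length as) (length bs) (tpure s as) (tpure s bs)"
abbreviation "homA n \<equiv> Hom_N s UNIV n sM UNIV"
abbreviation "homH q \<equiv> Hom_N s H q sM UNIV"
abbreviation "homAH p q \<equiv> Hom_N s UNIV p (fscale sM) (homH q)"

section \<open>The Hochschild complex on words\<close>

lemma vsF: "vector_space (fscale sM)" by (rule vector_space_fscale[OF vsM])

lemma subspace_UNIV_M: "module.subspace sM UNIV" by (rule M.subspace_UNIV)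
lemma subspace_UNIV_A: "module.subspace s UNIV" by (rule subspace_UNIV)

lemma subspace_homH: "module.subspace (fscale sM) (homH q)"
  by (rule subspace_Hom_N[OF vsM subspace_UNIV_M])

text \<open>Extension by \<open>0\<close> places a cochain of one degree among the multilinear
  functions on all words.\<close>

definition wordfn :: "nat \<Rightarrow> (('k, 'a) tensor \<Rightarrow> 'm) \<Rightarrow> 'a list \<Rightarrow> 'm"
  where "wordfn n f w = (if length w = n then f (tpure s w) else 0)"

lemma wordfn_normalized:
  assumes f: "f \<in> homA n" shows "wordfn n f \<in> normalized"
proof -
  have "lin s sM (\<lambda>x. wordfn n f (u @ x # v))" for u v
  proof (cases "Suc (length u + length v) = n")
    case True
    have "linear_on tscale sM (tpower s UNIV n) f" using f by (simp add: Hom_N_def)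
    from lin_tpure_slot[OF vs vsM this lin_ident _ True] True show ?thesis
      by (simp add: wordfn_def)
  qed (simp add: wordfn_def lin_zero[OF vs vsM])
  then show ?thesis using f
    by (auto simp: normalized_def mlin_def wordfn_def Hom_N_def listset_replicate)
qed

lemma mlin_hdiff: "mlin s sM g \<Longrightarrow> mlin s sM (hdiff l r g)"
  using mlin_hdiff_terms[OF lmlin_l _ rmlin_r, of g g g] by (simp add: hdiff_def[abs_def])

lemma hdiff_normalized: "g \<in> normalized \<Longrightarrow> hdiff l r g \<in> normalized"
  using bimodule_action.hdiff_vanish[OF bimodule_action_M, of g] by (auto simp: normalized_def mlin_hdiff)

lemma normalized_lift:
  assumes g: "g \<in> normalized"
  shows "tlift s sM (replicate n UNIV) g \<in> homA n"
    and "length w = n \<Longrightarrow> tlift s sM (replicate n UNIV) g (tpure s w) = g w"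
proof -
  have "mlin s sM g" "\<And>w. 1 \<in> set w \<Longrightarrow> g w = 0" using g by (auto simp: normalized_def)
  note * = tlift_Hom_N[OF vs vsM subspace_UNIV_A subspace_UNIV_M this(1) UNIV_I this(2)]
  show "tlift s sM (replicate n UNIV) g \<in> homA n" by (rule *(1))
  show "length w = n \<Longrightarrow> tlift s sM (replicate n UNIV) g (tpure s w) = g w" by (rule *(2)) auto
qed

lemma hochschild_diff_eq:
  "hoch n f = tlift s sM (replicate (Suc n) UNIV) (hdiff l r (wordfn n f))"
  unfolding hochschild_diff_def Suc_eq_plus1[symmetric]
proof (rule tlift_cong)
  fix w :: "'a list" assume "w \<in> listset (replicate (Suc n) UNIV)"
  then have w: "length w = Suc n" by (simp only: listset_replicate)
  then have "w \<noteq> []" by auto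
  have "bd (wordfn n f) w = (\<Sum>i = 1..n. sM ((-1) ^ i) (f (tpure s (merge i w))))"
    unfolding bd_def w using w
    by (intro sum.cong) (auto simp: alt_scale[OF vsM] wordfn_def length_merge)
  then show "l (hd w) (f (tpure s (tl w))) + (\<Sum>i = 1..n. sM ((-1) ^ i) (f (tpure s (merge i w)))) +
      sM ((-1) ^ Suc n) (r (f (tpure s (butlast w))) (last w)) = hdiff l r (wordfn n f) w"
    using w \<open>w \<noteq> []\<close> by (simp only: hdiff_def if_False alt_scale[OF vsM]) (simp add: wordfn_def)
qed

lemma hochschild_diff_homA: "f \<in> homA n \<Longrightarrow> hoch n f \<in> homA (Suc n)"
  unfolding hochschild_diff_eq by (intro normalized_lift(1) hdiff_normalized wordfn_normalized)

lemma hochschild_diff_tpure: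
  "f \<in> homA n \<Longrightarrow> length w = Suc n \<Longrightarrow> hoch n f (tpure s w) = hdiff l r (wordfn n f) w"
  unfolding hochschild_diff_eq by (intro normalized_lift(2) hdiff_normalized wordfn_normalized)

text \<open>Lets \<open>wordfn\<close> commute with the differential as an equality of functions, so
  that the differential can be iterated.\<close>

lemma hdiff_wordfn_length: "length w \<noteq> Suc n \<Longrightarrow> hdiff l r (wordfn n f) w = 0"
  by (cases w rule: rev_cases)
    (auto simp: hdiff_def wordfn_def l_zero r_zero bd_def length_merge intro!: sum.neutral)

lemma wordfn_hochschild_diff:
  "f \<in> homA n \<Longrightarrow> wordfn (Suc n) (hoch n f) = hdiff l r (wordfn n f)"
  by (auto simp: fun_eq_iff wordfn_def hochschild_diff_tpure hdiff_wordfn_length)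

lemma hdiff_add: "hdiff l r (\<lambda>w. g w + g' w) w = hdiff l r g w + hdiff l r g' w"
  by (simp add: hdiff_def l_add r_add bd_add alt_plus)

lemma hdiff_scale: "hdiff l r (\<lambda>w. sM c (g w)) w = sM c (hdiff l r g w)"
  by (simp add: hdiff_def l_scale r_scale scale_bd scale_alt M.scale_right_distrib)

lemma wordfn_add: "wordfn n (f + f') = (\<lambda>w. wordfn n f w + wordfn n f' w)"
  by (simp add: fun_eq_iff wordfn_def)

lemma wordfn_scale: "wordfn n (fscale sM c f) = (\<lambda>w. sM c (wordfn n f w))"
  by (simp add: fun_eq_iff wordfn_def fscale_def)

lemma subspace_homA: "module.subspace (fscale sM) (homA n)"
  by (rule subspace_Hom_N[OF vsM subspace_UNIV_M])

lemma homA_eqI: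
  "f \<in> homA n \<Longrightarrow> f' \<in> homA n \<Longrightarrow> (\<And>w. length w = n \<Longrightarrow> f (tpure s w) = f' (tpure s w)) \<Longrightarrow> f = f'"
  by (rule Hom_N_eqI[OF vsM])

lemma hochschild_complex:
  "cochain_complex (fscale sM) (hochschild_cochains s sM) hoch"
  unfolding cochain_complex_def hochschild_cochains_def
proof (intro conjI allI ballI)
  interpret F: vector_space "fscale sM :: 'k \<Rightarrow> (('k, 'a) tensor \<Rightarrow> 'm) \<Rightarrow> _" by (rule vsF)
  fix n
  note add = F.subspace_add[OF subspace_homA] and scale = F.subspace_scale[OF subspace_homA]
    and zero = F.subspace_0[OF subspace_homA]
  show "linear_on (fscale sM) (fscale sM) (homA n) (hoch n)"
    unfolding linear_on_def
  proof (intro conjI ballI allI)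
    fix f f' assume f: "f \<in> homA n" and f': "f' \<in> homA n"
    show "hoch n (f + f') = hoch n f + hoch n f'"
      by (rule homA_eqI[where n = "Suc n"]) (simp_all add: add hochschild_diff_homA f f' hochschild_diff_tpure wordfn_add hdiff_add)
  next
    fix f c assume f: "f \<in> homA n"
    show "hoch n (fscale sM c f) = fscale sM c (hoch n f)"
      by (rule homA_eqI[OF hochschild_diff_homA[OF scale[OF f]] scale[OF hochschild_diff_homA[OF f]]])
        (simp add: hochschild_diff_tpure scale f wordfn_scale hdiff_scale fscale_def[of sM c "hoch n f"])
  qed
  fix f assume f: "f \<in> homA n"
  have "hdiff l r (hdiff l r (wordfn n f)) w = 0" for w
    by (rule bimodule_action.hdiff_hdiff[OF bimodule_action_M]) simp
  then show "hoch (Suc n) (hoch n f) = 0"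
    by (intro homA_eqI[OF hochschild_diff_homA[OF hochschild_diff_homA[OF f]] zero])
      (simp_all add: hochschild_diff_homA f hochschild_diff_tpure wordfn_hochschild_diff)
qed (auto simp: vsF subspace_homA hochschild_diff_homA)

section \<open>Bicochains as functions of two words\<close>

definition proj :: "'a \<Rightarrow> 'a"
  where "proj = (SOME P. lin s s P \<and> range P \<subseteq> H \<and> (\<forall>x\<in>H. P x = x))"

lemma proj: "lin s s proj" "proj x \<in> H" "x \<in> H \<Longrightarrow> proj x = x"
  using someI_ex[OF projection_exists[OF vs H_subspace]] unfolding proj_def[symmetric] by auto

lemma map_proj: "set bs \<subseteq> H \<Longrightarrow> map proj bs = bs"
  by (auto intro!: map_idI proj(3))

text \<open>Composing with a projection onto \<open>H\<close> turns forms on \<open>H\<^sup>\<otimes>\<^sup>q\<close> into forms on \<open>A\<^sup>\<otimes>\<^sup>q\<close>, to which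
  the calculus on words applies.\<close>

definition wordfn2 :: "('k, 'a, 'm) bicochain \<Rightarrow> 'a list \<Rightarrow> 'a list \<Rightarrow> 'm"
  where "wordfn2 F as bs = F (length as) (length bs) (tpure s as) (tpure s (map proj bs))"

lemma double_cochainsD:
  assumes "F \<in> DC n"
  shows "p + q = n \<Longrightarrow> F p q \<in> homAH p q" "p + q \<noteq> n \<Longrightarrow> F p q = 0"
  using assms by (auto simp: double_cochains_def split: if_splits)

lemma homAH_apply:
  assumes "f \<in> homAH p q" "length as = p"
  shows "f (tpure s as) \<in> homH q"
  using assms by (auto simp: Hom_N_def intro!: tpure_in_tspace simp: listset_replicate)

lemma binormalized_wordfn2:
  assumes F: "F \<in> DC n" shows "binormalized (wordfn2 F)"
proof -
  have "lin s sM (\<lambda>x. wordfn2 F as (u @ x # v))" for as u v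
  proof (cases "length as + Suc (length u + length v) = n")
    case True
    then have "F (length as) (Suc (length u + length v)) (tpure s as) \<in> homH (Suc (length u + length v))"
      using homAH_apply[OF double_cochainsD(1)[OF F]] by blast
    then have "linear_on tscale sM (tpower s H (Suc (length u + length v))) (F (length as) (Suc (length u + length v)) (tpure s as))"
      by (simp add: Hom_N_def)
    from lin_tpure_slot[OF vs vsM this proj(1,2) refl] show ?thesis by (simp add: wordfn2_def)
  qed (simp add: wordfn2_def double_cochainsD(2)[OF F] lin_zero[OF vs vsM])
  moreover have "lin s sM (\<lambda>x. wordfn2 F (u @ x # v) bs)" for bs u v
  proof (cases "Suc (length u + length v) + length bs = n")
    case True
    then have "F (Suc (length u + length v)) (length bs) \<in> homAH (Suc (length u + length v)) (length bs)"
      using double_cochainsD(1)[OF F] by blast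
    then have "linear_on tscale (fscale sM) (tpower s UNIV (Suc (length u + length v))) (F (Suc (length u + length v)) (length bs))"
      by (simp add: Hom_N_def)
    from lin_fun_apply[OF vsM lin_tpure_slot[OF vs vsF this lin_ident _ refl]] show ?thesis by (simp add: wordfn2_def)
  qed (simp add: wordfn2_def double_cochainsD(2)[OF F] lin_zero[OF vs vsM])
  moreover have "wordfn2 F as bs = 0" if "1 \<in> set as" for as bs
  proof (cases "length as + length bs = n")
    case True
    then show ?thesis using double_cochainsD(1)[OF F True] that
      by (auto simp: wordfn2_def Hom_N_def listset_replicate)
  qed (simp add: wordfn2_def double_cochainsD(2)[OF F])
  moreover have "wordfn2 F as bs = 0" if "1 \<in> set bs" for as bs
  proof (cases "length as + length bs = n")
    case True
    \<comment> \<open>As \<open>1\<close> lies in \<open>H\<close>, the projection fixes it and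
      normalization survives.\<close>
    have "1 \<in> set (map proj bs)" using that proj(3)[OF H_one] by force
    moreover have "set (map proj bs) \<subseteq> H" using proj(2) by auto
    moreover have "F (length as) (length bs) (tpure s as) \<in> homH (length bs)"
      using homAH_apply[OF double_cochainsD(1)[OF F True]] by blast
    ultimately show ?thesis by (simp add: wordfn2_def Hom_N_def listset_replicate)
  qed (simp add: wordfn2_def double_cochainsD(2)[OF F])
  ultimately show ?thesis by (simp add: binormalized_def normalized_def mlin_def)
qed

definition lift2 :: "nat \<Rightarrow> nat \<Rightarrow> ('a list \<Rightarrow> 'a list \<Rightarrow> 'm) \<Rightarrow> ('k, 'a) tensor \<Rightarrow> ('k, 'a) tensor \<Rightarrow> 'm"
  where "lift2 p q G = tlift s (fscale sM) (replicate p UNIV) (\<lambda>as. tlift s sM (replicate q H) (G as))"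

text \<open>The inner lift is multilinear in the first word because a cochain on \<open>H\<close> is
  determined by its values on pure tensors of \<open>H\<close>; vanishing at units transfers in the
  same way.\<close>

lemma lift2:
  assumes G: "binormalized G"
  shows "lift2 p q G \<in> homAH p q"
    and "length as = p \<Longrightarrow> length bs = q \<Longrightarrow> set bs \<subseteq> H \<Longrightarrow> lift2 p q G (tpure s as) (tpure s bs) = G as bs"
proof -
  have m1: "mlin s sM (G as)" for as using G by (simp add: binormalized_def normalized_def)
  have m2: "lin s sM (\<lambda>x. G (u @ x # v) bs)" for u v bs
    using G by (simp add: binormalized_def normalized_def mlin_def)
  have van1: "G as bs = 0" if "1 \<in> set bs" for as bs using G that by (simp add: binormalized_def normalized_def)
  have van2: "G as bs = 0" if "1 \<in> set as" for as bs using G that by (simp add: binormalized_def normalized_def)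
  let ?I = "\<lambda>as. tlift s sM (replicate q H) (G as)"
  have I: "?I as \<in> homH q" for as
    by (rule tlift_Hom_N[OF vs vsM H_subspace subspace_UNIV_M m1]) (auto simp: van1)
  have Iev: "?I as (tpure s bs) = G as bs" if "length bs = q" "set bs \<subseteq> H" for as bs
    by (rule tlift_Hom_N(2)[OF vs vsM H_subspace subspace_UNIV_M m1]) (use that in \<open>auto simp: van1\<close>)
  interpret F: vector_space "fscale sM :: 'k \<Rightarrow> (('k, 'a) tensor \<Rightarrow> 'm) \<Rightarrow> _" by (rule vsF)
  note add = F.subspace_add[OF subspace_homH] and scale = F.subspace_scale[OF subspace_homH] and zero = F.subspace_0[OF subspace_homH]
  have mI: "mlin s (fscale sM) ?I"
  proof (rule mlinI)
    fix u v
    have "?I (u @ (x + y) # v) = ?I (u @ x # v) + ?I (u @ y # v)" for x y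
      by (rule Hom_N_eqI[OF vsM I add[OF I I]]) (simp add: Iev lin_plus[OF m2])
    moreover have "?I (u @ s c x # v) = fscale sM c (?I (u @ x # v))" for c x
      by (rule Hom_N_eqI[OF vsM I scale[OF I]]) (use m2 in \<open>simp add: Iev fscale_def Vector_Spaces.linear_iff\<close>)
    ultimately show "lin s (fscale sM) (\<lambda>x. ?I (u @ x # v))"
      using vs vsF unfolding Vector_Spaces.linear_iff by blast
  qed
  have vI: "?I as = 0" if "1 \<in> set as" for as
    by (rule Hom_N_eqI[OF vsM I zero]) (simp add: Iev van2 that)
  note * = tlift_Hom_N[OF vs vsF subspace_UNIV_A subspace_homH mI I vI]
  show "lift2 p q G \<in> homAH p q" unfolding lift2_def by (rule *(1))
  show "length as = p \<Longrightarrow> length bs = q \<Longrightarrow> set bs \<subseteq> H \<Longrightarrow> lift2 p q G (tpure s as) (tpure s bs) = G as bs"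
    unfolding lift2_def by (subst *(2)) (auto simp: Iev)
qed

lemma homAH_eqI:
  assumes f: "f \<in> homAH p q" and f': "f' \<in> homAH p q"
    and eq: "\<And>as bs. length as = p \<Longrightarrow> length bs = q \<Longrightarrow> set bs \<subseteq> H \<Longrightarrow> f (tpure s as) (tpure s bs) = f' (tpure s as) (tpure s bs)"
  shows "f = f'"
  by (rule Hom_N_eqI[OF vsF f f'], rule Hom_N_eqI[OF vsM homAH_apply[OF f] homAH_apply[OF f']]) (auto simp: eq)

lemma subspace_homAH: "module.subspace (fscale (fscale sM)) (homAH p q)"
  by (rule subspace_Hom_N[OF vsF subspace_homH])

definition bilift :: "nat \<Rightarrow> ('a list \<Rightarrow> 'a list \<Rightarrow> 'm) \<Rightarrow> ('k, 'a, 'm) bicochain"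
  where "bilift n G = (\<lambda>p q. if p + q = n then lift2 p q G else 0)"

lemma bilift_double_cochains: "binormalized G \<Longrightarrow> bilift n G \<in> DC n"
  by (simp add: double_cochains_def bilift_def lift2)

lemma bilift_tpure:
  "binormalized G \<Longrightarrow> length as + length bs = n \<Longrightarrow> set bs \<subseteq> H \<Longrightarrow>
    ev (bilift n G) as bs = G as bs"
  by (simp add: bilift_def lift2)

lemma double_cochains_eqI:
  assumes F: "F \<in> DC n" "F' \<in> DC n"
    and eq: "\<And>as bs. length as + length bs = n \<Longrightarrow> set bs \<subseteq> H \<Longrightarrow>
      ev F as bs = ev F' as bs"
  shows "F = F'"
proof (intro ext[of F F'] ext[of "F p" "F' p" for p])
  fix p q
  show "F p q = F' p q"
  proof (cases "p + q = n")
    case True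
    show ?thesis by (rule homAH_eqI[OF double_cochainsD(1)[OF F(1) True] double_cochainsD(1)[OF F(2) True]]) (use eq True in auto)
  qed (simp add: double_cochainsD(2)[OF F(1)] double_cochainsD(2)[OF F(2)])
qed

lemma wordfn2_H: "set bs \<subseteq> H \<Longrightarrow> wordfn2 F as bs = ev F as bs"
  by (simp add: wordfn2_def map_proj)

lemma vsB: "vector_space sB"
  by (intro vector_space_fscale vsM)

lemma subspace_double_cochains: "module.subspace sB (DC n)"
proof -
  interpret B: vector_space "sB :: 'k \<Rightarrow> ('k, 'a, 'm) bicochain \<Rightarrow> _" by (rule vsB)
  interpret F: vector_space "fscale (fscale sM) :: 'k \<Rightarrow> (('k, 'a) tensor \<Rightarrow> ('k, 'a) tensor \<Rightarrow> 'm) \<Rightarrow> _"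
    by (intro vector_space_fscale vsM)
  show ?thesis
  proof (rule B.subspaceI)
    show "0 \<in> DC n"
      using F.subspace_0[OF subspace_homAH] by (simp add: double_cochains_def)
    show "F + F' \<in> DC n"
      if "F \<in> DC n" "F' \<in> DC n" for F F'
      using F.subspace_add[OF subspace_homAH] double_cochainsD[OF that(1)] double_cochainsD[OF that(2)]
      by (simp add: double_cochains_def)
    show "sB c F \<in> DC n"
      if "F \<in> DC n" for F c
      using F.subspace_scale[OF subspace_homAH] double_cochainsD[OF that]
      by (simp add: double_cochains_def fscale_def[of "fscale (fscale (fscale sM))"] fscale_def[of "fscale (fscale sM)"])
  qed
qed

text \<open>The letters left behind by a passage have the form \<open>ad y b\<close>; here the
  stability of \<open>H\<close> under the adjoint action enters.\<close>

lemma pl_H: "set bs \<subseteq> H \<Longrightarrow> (x, w) \<in> set (pl bs a) \<Longrightarrow> set w \<subseteq> H"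
proof (induction bs arbitrary: x w)
  case (Cons b bs)
  from Cons.prems(2) obtain x' w' y where *: "(x', w') \<in> set (pl bs a)" "w = y # w'" "(x, y) \<in> set (br b x')"
    by (auto simp: pl.simps(2))
  moreover from this have "y \<in> H" using Cons.prems(1) H_ad by (auto simp: br_def)
  ultimately show ?case using Cons.IH[OF _ *(1)] Cons.prems(1) by simp
qed simp

lemma merge_H: "set bs \<subseteq> H \<Longrightarrow> 0 < i \<Longrightarrow> i < length bs \<Longrightarrow> set (merge i bs) \<subseteq> H"
  by (erule (1) split_at_pair) (auto simp: merge_append H_mult)

lemma bd_cong_H:
  assumes "set bs \<subseteq> H" "\<And>v. set v \<subseteq> H \<Longrightarrow> Suc (length v) = length bs \<Longrightarrow> g v = g' v"
  shows "bd g bs = bd g' bs"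
  unfolding bd_def
proof (intro sum.cong refl arg_cong[where f = "alt _"] assms(2))
  fix i assume "i \<in> {1..<length bs}"
  then show "set (merge i bs) \<subseteq> H" "Suc (length (merge i bs)) = length bs"
    using merge_H[OF assms(1)] by (auto simp: length_merge)
qed

text \<open>At a second word over \<open>H\<close> the differential reads its argument at such words
  only, by \<open>pl_H\<close>; functions that agree there may be exchanged.\<close>

lemma dA_cong_H:
  assumes bs: "set bs \<subseteq> H"
    and eq: "\<And>v w. set w \<subseteq> H \<Longrightarrow> Suc (length v + length w) = length as + length bs \<Longrightarrow> g v w = g' v w"
  shows "dA g as bs = dA g' as bs"
proof (cases as rule: rev_cases)
  case (snoc as' a)
  have "(\<Sum>(x, w)\<leftarrow>pl bs (hd as). l x (g (tl as) w)) = (\<Sum>(x, w)\<leftarrow>pl bs (hd as). l x (g' (tl as) w))"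
    by (intro sum_list_cong_prod arg_cong[where f = "l _"] eq) (auto simp: snoc length_pl dest: pl_H[OF bs])
  moreover have "bd (\<lambda>v. g v bs) as = bd (\<lambda>v. g' v bs) as"
    by (intro bd_cong eq bs) simp
  moreover have "g (butlast as) bs = g' (butlast as) bs"
    by (intro eq bs) (simp add: snoc)
  ultimately show ?thesis by (simp add: dA_def)
qed (simp add: dA_def)

lemma dH_cong_H:
  assumes bs: "set bs \<subseteq> H"
    and eq: "\<And>v w. set w \<subseteq> H \<Longrightarrow> Suc (length v + length w) = length as + length bs \<Longrightarrow> g v w = g' v w"
  shows "dH g as bs = dH g' as bs"
proof (cases bs rule: rev_cases)
  case (snoc bs' b)
  have tl: "set (tl bs) \<subseteq> H" using bs by (cases bs) auto
  have "(\<Sum>(v, z)\<leftarrow>pr as (last bs). r (g v (butlast bs)) z) = (\<Sum>(v, z)\<leftarrow>pr as (last bs). r (g' v (butlast bs)) z)"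
  proof (rule sum_list_cong_prod)
    fix v z assume "(v, z) \<in> set (pr as (last bs))"
    then have "length v = length as" by (rule length_pr)
    then have "g v (butlast bs) = g' v (butlast bs)" using bs by (intro eq) (auto simp: snoc)
    then show "r (g v (butlast bs)) z = r (g' v (butlast bs)) z" by simp
  qed
  moreover have "bd (g as) bs = bd (g' as) bs"
    by (intro bd_cong_H[OF bs] eq) auto
  moreover have "g as (tl bs) = g' as (tl bs)"
    by (intro eq tl) (simp add: snoc)
  ultimately show ?thesis by (simp add: dH_def)
qed (simp add: dH_def)

lemma total_diff_cong_H:
  assumes "set bs \<subseteq> H"
    and "\<And>v w. set w \<subseteq> H \<Longrightarrow> Suc (length v + length w) = length as + length bs \<Longrightarrow> g v w = g' v w"
  shows "total_diff g as bs = total_diff g' as bs"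
  unfolding total_diff_def using dA_cong_H[OF assms] dH_cong_H[OF assms] by simp

text \<open>The passage keeps the second word over \<open>H\<close>, so the braided tensor lies in
  the domain of the inner lift, which can then be evaluated term by term.\<close>

lemma rho_A_eq:
  assumes F: "F \<in> DC n"
  shows "rho_A s wor H sM l r p q (F p q) = lift2 (Suc p) q (\<lambda>as bs. alt (length bs) (dA (wordfn2 F) as bs))"
  unfolding rho_A_def Suc_eq_plus1[symmetric] lift2_def
proof (intro tlift_cong)
  fix as bs :: "'a list" assume "as \<in> listset (replicate (Suc p) UNIV)" "bs \<in> listset (replicate q H)"
  then have len: "length as = Suc p" "length bs = q" and bs: "set bs \<subseteq> H" by (simp_all only: listset_replicate)
  then have as: "as \<noteq> []" by auto
  note B = binormalized_wordfn2[OF F, unfolded binormalized_def normalized_def]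
  let ?g = "\<lambda>w. l (hd w) (F p q (tpure s (tl as)) (tpure s (tl w)))"
  \<comment> \<open>\<open>wordfn2 F\<close> in place of \<open>F\<close> gives a function
    multilinear on words of all lengths; the lift reads only words of length \<open>Suc q\<close>
    with tail over \<open>H\<close>, where both agree.\<close>
  let ?g' = "\<lambda>w. if w = [] then 0 else l (hd w) (wordfn2 F (tl as) (tl w))"
  have "mlin s sM (wordfn2 F (tl as))" using B by simp
  from lmlin_l[OF this] have "lmlin s sM (\<lambda>x w. l x (wordfn2 F (tl as) w))" .
  then have ml: "mlin s sM ?g'"
  proof (intro mlinI)
    fix u v
    assume "lmlin s sM (\<lambda>x w. l x (wordfn2 F (tl as) w))"
    then show "lin s sM (\<lambda>x. ?g' (u @ x # v))" by (cases u) (auto simp: lmlin_def mlin_def)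
  qed
  have "tlift s sM (UNIV # replicate q H) ?g (braid_word s wor (Suc q) [1..<Suc q] (tpure s (bs @ [hd as])))
      = tlift s sM (UNIV # replicate q H) ?g' (\<Sum>w\<leftarrow>braid_steps [1..<Suc q] (bs @ [hd as]). tpure s w)"
  proof -
    have "tlift s sM (UNIV # replicate q H) ?g = tlift s sM (UNIV # replicate q H) ?g'"
    proof (rule tlift_cong)
      fix w assume "w \<in> listset (UNIV # replicate q H)"
      then obtain x v where "w = x # v" "length v = q" "set v \<subseteq> H" by (auto simp: set_Cons_def listset_replicate)
      then show "?g w = ?g' w" using len by (simp add: wordfn2_H)
    qed
    moreover have "braid_word s wor (Suc q) [1..<Suc q] (tpure s (bs @ [hd as])) = (\<Sum>w\<leftarrow>braid_steps [1..<Suc q] (bs @ [hd as]). tpure s w)"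
      using len by (intro braid_word_tpure) auto
    ultimately show ?thesis by simp
  qed
  also have "(\<Sum>w\<leftarrow>braid_steps [1..<Suc q] (bs @ [hd as]). tpure s w) = (\<Sum>p\<leftarrow>pl bs (hd as). tpure s (fst p # snd p))"
    using sum_braid_steps_upt[of "tpure s" "[]" bs "hd as" "[]"] len by (simp add: case_prod_unfold del: upt_Suc)
  also have "tlift s sM (UNIV # replicate q H) ?g' \<dots> = (\<Sum>p\<leftarrow>pl bs (hd as). ?g' (fst p # snd p))"
  proof (rule tlift_sum_list[OF vs vsM _ mlin_multilinear_on[OF ml]])
    show "\<forall>C\<in>set (UNIV # replicate q H). module.subspace s C" using H_subspace subspace_UNIV_A by auto
    fix x assume "x \<in> set (pl bs (hd as))"
    then have "length (snd x) = q" "set (snd x) \<subseteq> H" using length_pl[of "fst x" "snd x"] pl_H[OF bs, of "fst x" "snd x"] len by auto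
    then show "fst x # snd x \<in> listset (UNIV # replicate q H)" by (simp add: set_Cons_def listset_replicate)
  qed
  finally have 1: "tlift s sM (UNIV # replicate q H) ?g (braid_word s wor (Suc q) [1..<Suc q] (tpure s (bs @ [hd as])))
      = (\<Sum>(x, w)\<leftarrow>pl bs (hd as). l x (wordfn2 F (tl as) w))" by (simp add: case_prod_unfold)
  have 2: "(\<Sum>i = 1..p. sM ((-1) ^ (i + q)) (F p q (tpure s (merge i as)) (tpure s bs))) = alt q (bd (\<lambda>v. wordfn2 F v bs) as)"
    unfolding bd_def len alt_sum alt_alt
    by (intro sum.cong) (auto simp: alt_scale[OF vsM] wordfn2_H[OF bs] length_merge len add.commute)
  have 3: "F p q (tpure s (butlast as)) (tpure s bs) = wordfn2 F (butlast as) bs"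
    using len by (simp add: wordfn2_H[OF bs])
  show "sM ((-1) ^ q) (tlift s sM (UNIV # replicate q H) ?g (braid_word s wor (Suc q) [1..<Suc q] (tpure s (bs @ [hd as]))))
      + (\<Sum>i = 1..p. sM ((-1) ^ (i + q)) (F p q (tpure s (merge i as)) (tpure s bs)))
      + sM ((-1) ^ Suc (p + q)) (r (F p q (tpure s (butlast as)) (tpure s bs)) (last as))
      = alt (length bs) (dA (wordfn2 F) as bs)"
    unfolding 1 2 3 unfolding dA_def alt_scale[OF vsM] using as len by (simp add: alt_plus alt_diff alt_alt add.commute)
qed

lemma rho_H_eq:
  assumes F: "F \<in> DC n"
  shows "rho_H s wor H sM l r p q (F p q) = lift2 p (Suc q) (dH (wordfn2 F))"
  unfolding rho_H_def Suc_eq_plus1[symmetric] lift2_def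
proof (intro tlift_cong)
  fix as bs :: "'a list" assume "as \<in> listset (replicate p UNIV)" "bs \<in> listset (replicate (Suc q) H)"
  then have len: "length as = p" "length bs = Suc q" and bs: "set bs \<subseteq> H" by (simp_all only: listset_replicate)
  then have ne: "bs \<noteq> []" by auto
  have bl: "set (butlast bs) \<subseteq> H" using bs by (auto dest: in_set_butlastD)
  have tl: "set (tl bs) \<subseteq> H" using bs ne by (auto dest: list.set_sel(2))
  note B = binormalized_wordfn2[OF F, unfolded binormalized_def normalized_def]
  let ?g = "\<lambda>w. r (F p q (tpure s (butlast w)) (tpure s (butlast bs))) (last w)"
  let ?g' = "\<lambda>w. if w = [] then 0 else r (wordfn2 F (butlast w) (butlast bs)) (last w)"
  have "mlin s sM (\<lambda>w. wordfn2 F w (butlast bs))" using B by simp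
  from rmlin_r[OF this] have "rmlin s sM (\<lambda>w x. r (wordfn2 F w (butlast bs)) x)" .
  then have ml: "mlin s sM ?g'"
  proof (intro mlinI)
    fix u v
    assume "rmlin s sM (\<lambda>w x. r (wordfn2 F w (butlast bs)) x)"
    then show "lin s sM (\<lambda>x. ?g' (u @ x # v))"
      by (cases v rule: rev_cases) (simp_all add: rmlin_def mlin_def butlast_append)
  qed
  have "tlift s sM (replicate (Suc p) UNIV) ?g (braid_word s wor (Suc p) (rev [1..<Suc p]) (tpure s (last bs # as)))
      = tlift s sM (replicate (Suc p) UNIV) ?g' (\<Sum>w\<leftarrow>braid_steps (rev [1..<Suc p]) (last bs # as). tpure s w)"
  proof -
    have "tlift s sM (replicate (Suc p) UNIV) ?g = tlift s sM (replicate (Suc p) UNIV) ?g'"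
    proof (rule tlift_cong)
      fix w :: "'a list" assume "w \<in> listset (replicate (Suc p) UNIV)"
      then have "length w = Suc p" by (simp only: listset_replicate)
      then show "?g w = ?g' w" using len by (auto simp: wordfn2_H[OF bl])
    qed
    moreover have "braid_word s wor (Suc p) (rev [1..<Suc p]) (tpure s (last bs # as)) = (\<Sum>w\<leftarrow>braid_steps (rev [1..<Suc p]) (last bs # as). tpure s w)"
      using len by (intro braid_word_tpure) auto
    ultimately show ?thesis by simp
  qed
  also have "(\<Sum>w\<leftarrow>braid_steps (rev [1..<Suc p]) (last bs # as). tpure s w) = (\<Sum>p\<leftarrow>pr as (last bs). tpure s (fst p @ [snd p]))"
    using sum_braid_steps_rev_upt[of "tpure s" "[]" as "last bs" "[]"] len by (simp add: case_prod_unfold del: upt_Suc)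
  also have "tlift s sM (replicate (Suc p) UNIV) ?g' \<dots> = (\<Sum>p\<leftarrow>pr as (last bs). ?g' (fst p @ [snd p]))"
  proof (rule tlift_sum_list[OF vs vsM subspaces_UNIV mlin_multilinear_on[OF ml]])
    fix x assume "x \<in> set (pr as (last bs))"
    then have "length (fst x) = p" using length_pr[of "fst x" "snd x"] len by auto
    then show "fst x @ [snd x] \<in> listset (replicate (Suc p) UNIV)" by (subst listset_replicate) simp
  qed
  finally have 1: "tlift s sM (replicate (Suc p) UNIV) ?g (braid_word s wor (Suc p) (rev [1..<Suc p]) (tpure s (last bs # as)))
      = (\<Sum>(v, z)\<leftarrow>pr as (last bs). r (wordfn2 F v (butlast bs)) z)" by (simp add: case_prod_unfold)
  have 2: "(\<Sum>i = 1..q. sM ((-1) ^ i) (F p q (tpure s as) (tpure s (merge i bs)))) = bd (wordfn2 F as) bs"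
    unfolding bd_def len
    by (intro sum.cong) (auto simp: alt_scale[OF vsM] wordfn2_H[OF merge_H[OF bs]] length_merge len)
  have 3: "F p q (tpure s as) (tpure s (tl bs)) = wordfn2 F as (tl bs)"
    using len by (simp add: wordfn2_H[OF tl])
  show "l (hd bs) (F p q (tpure s as) (tpure s (tl bs)))
      + (\<Sum>i = 1..q. sM ((-1) ^ i) (F p q (tpure s as) (tpure s (merge i bs))))
      + sM ((-1) ^ Suc q) (tlift s sM (replicate (Suc p) UNIV) ?g (braid_word s wor (Suc p) (rev [1..<Suc p]) (tpure s (last bs # as))))
      = dH (wordfn2 F) as bs"
    unfolding 1 2 3 unfolding dH_def alt_scale[OF vsM] using ne len by simp
qed

lemma rho_eq:
  assumes F: "F \<in> DC n"
  shows "rh n F = bilift (Suc n) (total_diff (wordfn2 F))"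
proof (intro ext[of "rh n F" "bilift (Suc n) (total_diff (wordfn2 F))"]
    ext[of "rh n F p" "bilift (Suc n) (total_diff (wordfn2 F)) p" for p])
  fix p q
  let ?G = "\<lambda>as bs. alt (length bs) (dA (wordfn2 F) as bs)"
  note B = binormalized_wordfn2[OF F]
  note BA = binormalized_alt[OF binormalized_dA[OF B]] and BH = binormalized_dH[OF B]
  interpret V: vector_space "fscale (fscale sM) :: 'k \<Rightarrow> (('k, 'a) tensor \<Rightarrow> ('k, 'a) tensor \<Rightarrow> 'm) \<Rightarrow> _"
    by (intro vector_space_fscale vsM)
  note zero = V.subspace_0[OF subspace_homAH] and add = V.subspace_add[OF subspace_homAH]
  \<comment> \<open>For \<open>p = 0\<close> the definition has no such component; \<open>dA\<close>
    vanishes at the empty word, so the lift is \<open>0\<close> as well.\<close>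
  have A: "(if p = 0 then 0 else rho_A s wor H sM l r (p - 1) q (F (p - 1) q)) = lift2 p q ?G"
  proof (cases p)
    case 0
    have "0 = lift2 0 q ?G" by (rule homAH_eqI[OF zero lift2(1)[OF BA]], subst lift2(2)[OF BA]) (auto simp: dA_def)
    then show ?thesis using 0 by simp
  qed (simp add: rho_A_eq[OF F])
  have H: "(if q = 0 then 0 else rho_H s wor H sM l r p (q - 1) (F p (q - 1))) = lift2 p q (dH (wordfn2 F))"
  proof (cases q)
    case 0
    have "0 = lift2 p 0 (dH (wordfn2 F))" by (rule homAH_eqI[OF zero lift2(1)[OF BH]], subst lift2(2)[OF BH]) (auto simp: dH_def)
    then show ?thesis using 0 by simp
  qed (simp add: rho_H_eq[OF F])
  have "lift2 p q ?G + lift2 p q (dH (wordfn2 F)) = lift2 p q (total_diff (wordfn2 F))"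
    by (rule homAH_eqI[OF add[OF lift2(1)[OF BA] lift2(1)[OF BH]] lift2(1)[OF binormalized_total_diff[OF B]]])
      (simp add: lift2(2)[OF BA] lift2(2)[OF BH] lift2(2)[OF binormalized_total_diff[OF B]] total_diff_def)
  then show "rh n F p q = bilift (Suc n) (total_diff (wordfn2 F)) p q"
    unfolding rho_def A H bilift_def by simp
qed

lemma rho_double_cochains:
  "F \<in> DC n \<Longrightarrow> rh n F \<in> DC (Suc n)"
  unfolding rho_eq by (intro bilift_double_cochains binormalized_total_diff binormalized_wordfn2)

lemma rho_tpure:
  "F \<in> DC n \<Longrightarrow> length as + length bs = Suc n \<Longrightarrow> set bs \<subseteq> H \<Longrightarrow>
    ev (rh n F) as bs = total_diff (wordfn2 F) as bs"
  unfolding rho_eq by (intro bilift_tpure binormalized_total_diff binormalized_wordfn2)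

lemma wordfn2_add: "wordfn2 (F + F') = (\<lambda>as bs. wordfn2 F as bs + wordfn2 F' as bs)"
  by (simp add: fun_eq_iff wordfn2_def)

lemma wordfn2_scale: "wordfn2 (sB c F) = (\<lambda>as bs. sM c (wordfn2 F as bs))"
  by (simp add: fun_eq_iff wordfn2_def fscale_def)

lemma double_complex:
  "cochain_complex sB DC rh"
  unfolding cochain_complex_def
proof (intro conjI allI ballI)
  interpret B: vector_space "sB :: 'k \<Rightarrow> ('k, 'a, 'm) bicochain \<Rightarrow> _" by (rule vsB)
  fix n
  note add = B.subspace_add[OF subspace_double_cochains] and scale = B.subspace_scale[OF subspace_double_cochains]
    and zero = B.subspace_0[OF subspace_double_cochains]
  show "linear_on sB sB (DC n) (rh n)"
    unfolding linear_on_def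
  proof (intro conjI ballI allI)
    fix F F' assume F: "F \<in> DC n" and F': "F' \<in> DC n"
    show "rh n (F + F') = rh n F + rh n F'"
    proof (rule double_cochains_eqI[OF rho_double_cochains[OF add[OF F F']] add[OF rho_double_cochains[OF F] rho_double_cochains[OF F']]])
      fix as bs :: "'a list" assume *: "length as + length bs = Suc n" "set bs \<subseteq> H"
      show "ev (rh n (F + F')) as bs =
          ev (rh n F + rh n F') as bs"
        unfolding rho_tpure[OF add[OF F F'] *] wordfn2_add total_diff_add by (simp add: rho_tpure[OF F *] rho_tpure[OF F' *])
    qed
  next
    fix F c assume F: "F \<in> DC n"
    show "rh n (sB c F) = sB c (rh n F)"
    proof (rule double_cochains_eqI[OF rho_double_cochains[OF scale[OF F]] scale[OF rho_double_cochains[OF F]]])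
      fix as bs :: "'a list" assume *: "length as + length bs = Suc n" "set bs \<subseteq> H"
      show "ev (rh n (sB c F)) as bs =
          ev (sB c (rh n F)) as bs"
        unfolding rho_tpure[OF scale[OF F] *] wordfn2_scale total_diff_scale by (simp add: fscale_def rho_tpure[OF F *])
    qed
  qed
  fix F assume F: "F \<in> DC n"
  show "rh (Suc n) (rh n F) = 0"
  proof (rule double_cochains_eqI[OF rho_double_cochains[OF rho_double_cochains[OF F]] zero])
    fix as bs :: "'a list" assume *: "length as + length bs = Suc (Suc n)" "set bs \<subseteq> H"
    \<comment> \<open>\<open>wordfn2 (rh n F)\<close> projects the second word to \<open>H\<close>
      before evaluating, so agreement with \<open>total_diff (wordfn2 F)\<close> is claimed over
      \<open>H\<close> only, which is all that the outer differential reads.\<close>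
    have "total_diff (wordfn2 (rh n F)) as bs = total_diff (total_diff (wordfn2 F)) as bs"
      by (rule total_diff_cong_H[OF *(2)]) (use * in \<open>simp add: wordfn2_H rho_tpure[OF F]\<close>)
    then show "ev (rh (Suc n) (rh n F)) as bs = ev 0 as bs"
      unfolding rho_tpure[OF rho_double_cochains[OF F] *] by (simp add: total_diff_total_diff[OF binormalized_wordfn2[OF F]])
  qed
qed (auto simp: vsB subspace_double_cochains rho_double_cochains)

section \<open>The induced map and its compatibility with the differentials\<close>

lemma shuffle_map_eq:
  assumes f: "f \<in> homA n"
  shows "shuf n f = bilift n (\<lambda>as bs. sh (wordfn n f) bs as)"
proof -
  have "tlift s (fscale sM) (replicate p UNIV) (\<lambda>as. tlift s sM (replicate q H) (\<lambda>bs. f (qshuffle s wor q p (tpure s (bs @ as)))))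
      = lift2 p q (\<lambda>as bs. sh (wordfn n f) bs as)" if n: "p + q = n" for p q
    unfolding lift2_def
  proof (intro tlift_cong)
    fix as bs :: "'a list" assume "as \<in> listset (replicate p UNIV)" "bs \<in> listset (replicate q H)"
    then have len: "length as = p" "length bs = q" by (auto simp: listset_replicate)
    have "linear_on tscale sM (tpower s UNIV n) f" using f by (simp add: Hom_N_def)
    from qshuffle_tpure[OF vsM _ this, of bs as "wordfn n f"] len n
    show "f (qshuffle s wor q p (tpure s (bs @ as))) = sh (wordfn n f) bs as"
      by (simp add: wordfn_def add.commute)
  qed
  then show ?thesis by (auto simp: shuffle_map_def bilift_def fun_eq_iff)
qed

lemma shuffle_map_double_cochains:
  "f \<in> homA n \<Longrightarrow> shuf n f \<in> DC n"
  unfolding shuffle_map_eq by (intro bilift_double_cochains binormalized_sh wordfn_normalized)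

lemma shuffle_map_tpure:
  "f \<in> homA n \<Longrightarrow> length as + length bs = n \<Longrightarrow> set bs \<subseteq> H \<Longrightarrow>
    ev (shuf n f) as bs = sh (wordfn n f) bs as"
  unfolding shuffle_map_eq
  by (rule bilift_tpure[of "\<lambda>as bs. sh (wordfn n f) bs as"]) (auto intro: binormalized_sh wordfn_normalized)

lemma shuffle_map_morphism:
  "complex_morphism
    (fscale sM) (hochschild_cochains s sM) hoch
    sB DC rh
    shuf"
  unfolding complex_morphism_def hochschild_cochains_def[abs_def]
proof (intro conjI allI ballI)
  interpret F: vector_space "fscale sM :: 'k \<Rightarrow> (('k, 'a) tensor \<Rightarrow> 'm) \<Rightarrow> _" by (rule vsF)
  interpret B: vector_space "sB :: 'k \<Rightarrow> ('k, 'a, 'm) bicochain \<Rightarrow> _" by (rule vsB)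
  show "cochain_complex (fscale sM) homA hoch"
    using hochschild_complex by (simp add: hochschild_cochains_def[abs_def])
  show "cochain_complex sB DC rh"
    by (rule double_complex)
  fix n
  note add = F.subspace_add[OF subspace_homA] and scale = F.subspace_scale[OF subspace_homA]
    and addB = B.subspace_add[OF subspace_double_cochains] and scaleB = B.subspace_scale[OF subspace_double_cochains]
  show "linear_on (fscale sM) sB (homA n) (shuf n)"
    unfolding linear_on_def
  proof (intro conjI ballI allI)
    fix f f' assume f: "f \<in> homA n" and f': "f' \<in> homA n"
    show "shuf n (f + f') = shuf n f + shuf n f'"
    proof (rule double_cochains_eqI[OF shuffle_map_double_cochains[OF add[OF f f']]
          addB[OF shuffle_map_double_cochains[OF f] shuffle_map_double_cochains[OF f']]])
      fix as bs :: "'a list" assume *: "length as + length bs = n" "set bs \<subseteq> H"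
      show "ev (shuf n (f + f')) as bs =
          ev (shuf n f + shuf n f') as bs"
        unfolding shuffle_map_tpure[OF add[OF f f'] *] wordfn_add sh_add
        by (simp add: shuffle_map_tpure[OF f *] shuffle_map_tpure[OF f' *])
    qed
  next
    fix f c assume f: "f \<in> homA n"
    show "shuf n (fscale sM c f) = sB c (shuf n f)"
    proof (rule double_cochains_eqI[OF shuffle_map_double_cochains[OF scale[OF f]] scaleB[OF shuffle_map_double_cochains[OF f]]])
      fix as bs :: "'a list" assume *: "length as + length bs = n" "set bs \<subseteq> H"
      have "sh (\<lambda>w. sM c (wordfn n f w)) bs as = sM c (sh (wordfn n f) bs as)"
        by (rule sh_additive) (auto simp: M.scale_right_distrib)
      then show "ev (shuf n (fscale sM c f)) as bs =
          ev (sB c (shuf n f)) as bs"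
        unfolding shuffle_map_tpure[OF scale[OF f] *] wordfn_scale by (simp add: fscale_def shuffle_map_tpure[OF f *])
    qed
  qed
  show "shuf n ` homA n \<subseteq> DC n" using shuffle_map_double_cochains by blast
  fix f assume f: "f \<in> homA n"
  show "shuf (Suc n) (hoch n f) = rh n (shuf n f)"
  proof (rule double_cochains_eqI[OF shuffle_map_double_cochains[OF hochschild_diff_homA[OF f]]
        rho_double_cochains[OF shuffle_map_double_cochains[OF f]]])
    fix as bs :: "'a list" assume *: "length as + length bs = Suc n" "set bs \<subseteq> H"
    have "mlin s sM (wordfn n f)" using wordfn_normalized[OF f] by (simp add: normalized_def)
    then have "sh (hdiff l r (wordfn n f)) bs as = total_diff (\<lambda>as bs. sh (wordfn n f) bs as) as bs"
      by (rule sh_hdiff)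
    \<comment> \<open>Again an agreement over \<open>H\<close>: on other second words
      \<open>wordfn2\<close> extends the bicochain by the projection, while \<open>sh\<close> uses
      the letters themselves.\<close>
    also have "\<dots> = total_diff (wordfn2 (shuf n f)) as bs"
      by (rule total_diff_cong_H[OF *(2)]) (use * in \<open>simp add: wordfn2_H shuffle_map_tpure[OF f]\<close>)
    finally show "ev (shuf (Suc n) (hoch n f)) as bs =
        ev (rh n (shuf n f)) as bs"
      unfolding shuffle_map_tpure[OF hochschild_diff_homA[OF f] *] wordfn_hochschild_diff[OF f]
        rho_tpure[OF shuffle_map_double_cochains[OF f] *] .
  qed
qed

end

theorem corollary2p3:
  fixes s :: "'k::field \<Rightarrow> 'a::ring_1 \<Rightarrow> 'a"
    and D :: "'a \<Rightarrow> ('k, 'a) tensor" and \<epsilon> :: "'a \<Rightarrow> 'k" and S :: "'a \<Rightarrow> 'a"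
    and H :: "'a set"
    and sM :: "'k \<Rightarrow> 'm::ab_group_add \<Rightarrow> 'm" and l :: "'a \<Rightarrow> 'm \<Rightarrow> 'm" and r :: "'m \<Rightarrow> 'a \<Rightarrow> 'm"
  assumes "hopf_algebra s D \<epsilon> S" and "bij S"
    and "sub_hopf_algebra s D S H"
    and "\<And>a h. h \<in> H \<Longrightarrow> adj s D S a h \<in> H"
    and "bimodule sM s l r"
  shows "complex_morphism
    (fscale sM) (hochschild_cochains s sM) (hochschild_diff s sM l r)
    (fscale (fscale (fscale (fscale sM)))) (double_cochains s H sM) (rho s (woronowicz s D S) H sM l r)
    (shuffle_map s (woronowicz s D S) H sM)"
proof -
  have "sub_hopf_bimodule s D \<epsilon> S sM l r H"
    by (intro sub_hopf_bimodule.intro hopf_bimodule.intro sub_hopf_bimodule_axioms.intro assms)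
      (use assms(3) in \<open>auto simp: sub_hopf_algebra_def\<close>)
  then show ?thesis by (rule sub_hopf_bimodule.shuffle_map_morphism)
qed

end
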